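(* Let $2<q<\infty$ and let $\alpha\in\mathbb R$ with $|\alpha|\le\frac12$. Suppose that $(q+2)\alpha^2\le1$. Then the function $r\equiv 1$ provides the minimal value in the problem $$J(r,\varphi)=\int_0^{2\pi}\bigl(r'^2+r^2\varphi'^2\bigr)\,dx\ \to\ \min,\qquad \int_0^{2\pi}r^q\,dx=2\pi,\qquad \int_0^{2\pi}\varphi'\,dx=2\pi\alpha$$ (i.e. some admissible pair $(r,\varphi)$ with $r\equiv1$ is a minimizer of $J$ over admissible pairs), and thus $$\mu_q(\alpha)=(2\pi)^{\frac12-\frac1q}\,|\alpha|.$$
   Context: For $2<q<\infty$ and real $\alpha$, define $$\mu_q(\alpha)=\min_u\frac{\|u'+i\alpha u\|_{L_2(0,2\pi)}}{\|u\|_{L_q(0,2\pi)}},$$ where the minimum is over all complex-valued $2\pi$-periodic absolutely continuous functions $u\not\equiv0$ (the minimum is attained). Normalizing $\|u\|_{L_q}^q=2\pi$ and writing $r=|u|$, $\varphi=\arg(u)+\alpha x$, one has $\int_0^{2\pi}|u'+i\alpha u|^2dx=J(r,\varphi)$. Admissible pairs $(r,\varphi)$ in the minimization problem for $J$ consist of a positive $2\pi$-periodic absolutely continuous function $r$ and a real-valued locally absolutely continuous function $\varphi$ such that $\varphi'$ is $2\pi$-periodic, $\int_0^{2\pi}\varphi'\,dx=2\pi\alpha$ and $\int_0^{2\pi}r^q\,dx=2\pi$. *)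

theory Defs
  imports "HOL-Analysis.Analysis"
begin

text \<open>
  The library has no absolute continuity for functions of a real variable (its
  \<^const>\<open>absolutely_continuous\<close> is about measures), so the usual \<open>\<epsilon>\<close>-\<open>\<delta>\<close> definition is given here.
  A division of \<open>\<Union>d\<close> is a finite family of non-overlapping compact intervals.
\<close>

definition abs_cont_on :: "real \<Rightarrow> real \<Rightarrow> (real \<Rightarrow> 'a::real_normed_vector) \<Rightarrow> bool" where
  "abs_cont_on a b f \<longleftrightarrow>
     (\<forall>\<epsilon>>0. \<exists>\<delta>>0. \<forall>d. d division_of \<Union>d \<and> \<Union>d \<subseteq> {a..b} \<and> (\<Sum>k\<in>d. Sup k - Inf k) < \<delta> \<longrightarrow>
        (\<Sum>k\<in>d. norm (f (Sup k) - f (Inf k))) < \<epsilon>)"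

definition loc_abs_cont :: "(real \<Rightarrow> 'a::real_normed_vector) \<Rightarrow> bool" where
  "loc_abs_cont f \<longleftrightarrow> (\<forall>a b. abs_cont_on a b f)"

definition periodic_2pi :: "(real \<Rightarrow> 'a) \<Rightarrow> bool" where
  "periodic_2pi f \<longleftrightarrow> (\<forall>x. f (x + 2 * pi) = f x)"

text \<open>
  The \<open>L\<^sub>p\<close> norm on \<open>(0, 2\<pi>)\<close>, equal to \<open>\<infinity>\<close> for functions not in \<open>L\<^sub>p\<close>: the derivative of an
  absolutely continuous function is integrable but need not be square integrable.
  All integrals are with respect to the completed measure, since derivatives are only known to
  exist almost everywhere.
\<close>

definition Lp_norm :: "real \<Rightarrow> (real \<Rightarrow> complex) \<Rightarrow> ennreal" where
  "Lp_norm p f =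
     (let I = (\<integral>\<^sup>+x\<in>{0<..<2*pi}. ennreal (cmod (f x) powr p) \<partial>lebesgue)
      in if I = top then top else ennreal (enn2real I powr (1 / p)))"

text \<open>
  For a periodic function, absolute continuity on a period is the same as local absolute
  continuity on the whole line.
\<close>

definition competitor :: "(real \<Rightarrow> complex) \<Rightarrow> bool" where
  "competitor u \<longleftrightarrow> loc_abs_cont u \<and> periodic_2pi u \<and> (\<exists>x. u x \<noteq> 0)"

definition mu_quotient :: "real \<Rightarrow> real \<Rightarrow> (real \<Rightarrow> complex) \<Rightarrow> ennreal" where
  "mu_quotient q \<alpha> u =
     Lp_norm 2 (\<lambda>x. vector_derivative u (at x) + \<i> * of_real \<alpha> * u x) / Lp_norm q u"

text \<open>A minimum, not merely an infimum.\<close>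

definition mu :: "real \<Rightarrow> real \<Rightarrow> ennreal" where
  "mu q \<alpha> = (LEAST m. \<exists>u. competitor u \<and> m = mu_quotient q \<alpha> u)"

definition J :: "(real \<Rightarrow> real) \<Rightarrow> (real \<Rightarrow> real) \<Rightarrow> ennreal" where
  "J r \<phi> = (\<integral>\<^sup>+x\<in>{0..2*pi}. ennreal ((deriv r x)\<^sup>2 + (r x)\<^sup>2 * (deriv \<phi> x)\<^sup>2) \<partial>lebesgue)"

definition admissible :: "real \<Rightarrow> real \<Rightarrow> (real \<Rightarrow> real) \<Rightarrow> (real \<Rightarrow> real) \<Rightarrow> bool" where
  "admissible q \<alpha> r \<phi> \<longleftrightarrow>
     (\<forall>x. r x > 0) \<and> periodic_2pi r \<and> loc_abs_cont r \<and>
     loc_abs_cont \<phi> \<and> (AE x in lebesgue. deriv \<phi> (x + 2 * pi) = deriv \<phi> x) \<and>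
     (LINT x:{0..2*pi}|lebesgue. deriv \<phi> x) = 2 * pi * \<alpha> \<and>
     (LINT x:{0..2*pi}|lebesgue. r x powr q) = 2 * pi"

end

theory Submission
  imports Defs
begin

text \<open>
  Write \<open>q\<close> for the exponent, put \<open>v = e\<^sup>i\<^sup>\<alpha>\<^sup>x u\<close>, so that \<open>|u' + i\<alpha>u| = |v'|\<close>, and let \<open>r = |u|\<close>. Where
  \<open>u\<close> does not vanish, \<open>|v'|\<^sup>2 = r'\<^sup>2 + r\<^sup>2\<phi>'\<^sup>2\<close>, where \<open>\<phi>\<close> is the argument of \<open>v\<close>. By periodicity of \<open>u\<close>
  the increment of \<open>\<phi>\<close> over a period is \<open>2\<pi>(\<alpha> + n)\<close> for an integer \<open>n\<close>, and \<open>|\<alpha> + n| \<ge> |\<alpha>|\<close> because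
  \<open>|\<alpha>| \<le> 1/2\<close>. All integrals below are over a period. The Cauchy-Schwarz inequality (\<open>phase_energy_bound\<close>)
  gives \<open>\<integral>r\<^sup>2\<phi>'\<^sup>2 \<ge> (2\<pi>\<alpha>)\<^sup>2 / \<integral>r\<^sup>-\<^sup>2\<close>. Both minimization problems therefore follow from an
  inequality for a positive periodic function,
  \<open>\<integral>r'\<^sup>2 + (2\<pi>\<alpha>)\<^sup>2 / \<integral>r\<^sup>-\<^sup>2 \<ge> \<alpha>\<^sup>2 K\<close> with \<open>K = 2\<pi> ((1/2\<pi>) \<integral>r\<^sup>q)\<^sup>2\<^sup>/\<^sup>q\<close>,
  which is an equality for constant \<open>r\<close>. It is a combination of two sharp inequalities:

  \<^item> \<open>\<integral>r'\<^sup>2 + \<pi>\<^sup>2 / \<integral>r\<^sup>-\<^sup>2 \<ge> (1/4) \<integral>r\<^sup>2\<close> (\<open>inverse_square_inequality\<close>). This is Wirtinger's inequality for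
    the function \<open>r e\<^sup>i\<^sup>\<Psi>\<close>, where the phase has \<open>\<Psi>'\<close> proportional to \<open>r\<^sup>-\<^sup>2\<close> and increment \<open>\<pi>\<close>: it is
    antiperiodic, so its lowest frequency is \<open>1/2\<close>.
  \<^item> \<open>(q - 2) \<integral>r'\<^sup>2 + \<integral>r\<^sup>2 \<ge> K\<close> (\<open>Beckner_inequality\<close>).

  Multiply the first by \<open>4\<alpha>\<^sup>2\<close> and the second by \<open>\<alpha>\<^sup>2\<close> and add: the coefficient of \<open>\<integral>r'\<^sup>2\<close> on the left
  becomes \<open>4\<alpha>\<^sup>2 + (q - 2)\<alpha>\<^sup>2 = (q + 2)\<alpha>\<^sup>2\<close>, and this is at most \<open>1\<close> exactly under the hypothesis.

  Beckner's inequality is proved with the heat flow. Let \<open>\<rho> = r\<^sup>q\<close> evolve by \<open>\<rho>\<^sub>t = \<rho>\<^sub>x\<^sub>x\<close>; then \<open>K\<close> is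
  constant in time, \<open>(q - 2) \<integral>r'\<^sup>2 + \<integral>r\<^sup>2\<close> does not increase (\<open>energy_rate_integral_nonpos\<close>), and it tends
  to \<open>K\<close> because \<open>\<rho>\<close> becomes constant. If \<open>\<rho>\<close> is a trigonometric polynomial, its heat evolution is
  a finite sum and every manipulation is elementary (\<open>mean_power_le\<close>); trigonometric polynomials are
  dense enough to give the inequality for all continuously differentiable \<open>r\<close>.

  The passage to absolutely continuous functions uses Steklov averages. They are continuously
  differentiable, converge to the function within its bounds, and do not increase the energy, provided
  that differences of the function are integrals of its derivative. This fundamental theorem of
  calculus for absolutely continuous functions (\<open>AC_FTC\<close>) is obtained from the Radon-Nikodym theorem
  and from the differentiability almost everywhere of an indefinite integral. Once \<open>u\<close> is continuously
  differentiable, adding a small constant removes its zeros (\<open>energy_bound_C1\<close>).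
\<close>

section \<open>Wirtinger inequalities\<close>

lemma has_integral_of_derivative:
  fixes F f :: "real \<Rightarrow> real"
  assumes "\<And>x. x \<in> {a..b} \<Longrightarrow> (F has_real_derivative f x) (at x)" "a \<le> b"
  shows "(f has_integral (F b - F a)) {a..b}"
  using assms by (intro fundamental_theorem_of_calculus)
    (auto simp: has_real_derivative_iff_has_vector_derivative[symmetric] intro: has_field_derivative_at_within)

lemma continuous_has_antiderivative:
  fixes g :: "real \<Rightarrow> real"
  assumes g: "continuous_on UNIV g"
  obtains G where "\<And>x. (G has_real_derivative g x) (at x)"
proof -
  have gi: "g integrable_on {a..b}" for a b
    by (intro integrable_continuous_real continuous_on_subset[OF g]) auto
  define G where "G x = integral {0..x} g - integral {x..0} g" for x
  have "(G has_real_derivative g x) (at x)" for x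
  proof -
    obtain n where n: "\<bar>x\<bar> < real n" using reals_Archimedean2 by blast
    let ?n = "real n"
    have *: "G y = integral {-?n..y} g - integral {-?n..0} g" if y: "y \<in> {-?n..?n}" for y
    proof (cases "y \<ge> 0")
      case True
      then have "integral {-?n..0} g + integral {0..y} g = integral {-?n..y} g"
        by (intro Henstock_Kurzweil_Integration.integral_combine gi) auto
      moreover have "integral {y..0} g = 0" using True by (cases "y = 0") auto
      ultimately show ?thesis by (simp add: G_def)
    next
      case False
      then have "integral {-?n..y} g + integral {y..0} g = integral {-?n..0} g"
        using y by (intro Henstock_Kurzweil_Integration.integral_combine gi) auto
      then show ?thesis using False by (simp add: G_def)
    qed
    have "((\<lambda>y. integral {-?n..y} g) has_real_derivative g x) (at x within {-?n..?n})"
      using n by (intro integral_has_real_derivative continuous_on_subset[OF g]) auto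
    then have "((\<lambda>y. integral {-?n..y} g - integral {-?n..0} g) has_real_derivative g x) (at x within {-?n..?n})"
      by (auto intro!: derivative_eq_intros)
    then have "(G has_real_derivative g x) (at x within {-?n..?n})"
      by (rule has_field_derivative_transform_within[OF _ zero_less_one]) (use n * in auto)
    then show ?thesis using n by (simp add: at_within_Icc_at)
  qed
  then show ?thesis using that by blast
qed

lemma integral_periodic_shift:
  fixes f :: "real \<Rightarrow> real"
  assumes f: "continuous_on UNIV f" and per: "\<And>x. f (x + P) = f x" and c: "0 \<le> c" "0 \<le> P"
  shows "integral {c..c+P} f = integral {0..P} f"
proof -
  have fi: "f integrable_on {a..b}" for a b
    by (intro integrable_continuous_real continuous_on_subset[OF f]) auto
  have "integral {0..c} f + integral {c..c+P} f = integral {0..c+P} f"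
    "integral {0..P} f + integral {P..c+P} f = integral {0..c+P} f"
    using c by (intro Henstock_Kurzweil_Integration.integral_combine fi; simp)+
  moreover have "integral {P..c+P} f = integral {0..c} (\<lambda>x. f (x + P))"
    using has_integral_shift_real_ivl[OF integrable_integral[OF fi], of P P "c + P"] by (simp add: integral_unique)
  ultimately show ?thesis using per by simp
qed

text \<open>
  For \<open>\<beta> < \<pi>/(b - a)\<close> the function \<open>t = tan (\<beta>(x - m))\<close>, with \<open>m\<close> the midpoint, is regular on \<open>[a, b]\<close>, and
  \<open>t' = \<beta>(1 + t\<^sup>2)\<close> turns \<open>(f' + \<beta>tf)\<^sup>2\<close> into \<open>f'\<^sup>2 - \<beta>\<^sup>2f\<^sup>2 + (\<beta>tf\<^sup>2)'\<close>. Integrating gives the inequality with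
  constant \<open>\<beta>\<^sup>2\<close>, and \<open>\<beta>\<close> may then tend to \<open>\<pi>/(b - a)\<close>.
\<close>

lemma Wirtinger_Dirichlet:
  fixes f f' :: "real \<Rightarrow> real"
  assumes ab: "a < b" and f: "\<And>x. (f has_real_derivative f' x) (at x)" and f': "continuous_on UNIV f'"
    and 0: "f a = 0" "f b = 0"
  shows "(pi / (b - a))\<^sup>2 * integral {a..b} (\<lambda>x. (f x)\<^sup>2) \<le> integral {a..b} (\<lambda>x. (f' x)\<^sup>2)"
proof -
  let ?c = "pi / (b - a)" and ?m = "(a + b) / 2"
  have fc: "continuous_on UNIV f" using f by (meson DERIV_isCont continuous_at_imp_continuous_on)
  have i: "(\<lambda>x. (f x)\<^sup>2) integrable_on {a..b}" "(\<lambda>x. (f' x)\<^sup>2) integrable_on {a..b}"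
    by (intro integrable_continuous_real continuous_intros continuous_on_subset[OF fc] continuous_on_subset[OF f']; simp)+
  have c: "?c > 0" using ab by simp
  have *: "\<beta>\<^sup>2 * integral {a..b} (\<lambda>x. (f x)\<^sup>2) \<le> integral {a..b} (\<lambda>x. (f' x)\<^sup>2)" if \<beta>: "0 < \<beta>" "\<beta> < ?c" for \<beta>
  proof -
    define t where "t x = tan (\<beta> * (x - ?m))" for x
    have cos: "cos (\<beta> * (x - ?m)) \<noteq> 0" if x: "x \<in> {a..b}" for x
    proof -
      have "\<bar>x - ?m\<bar> \<le> (b - a) / 2" using x by (auto simp: abs_le_iff field_simps)
      then have "\<bar>\<beta> * (x - ?m)\<bar> \<le> \<beta> * ((b - a) / 2)" using \<beta> by (simp add: abs_mult)
      also have "\<dots> < ?c * ((b - a) / 2)" using \<beta> ab by (intro mult_strict_right_mono) auto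
      also have "\<dots> = pi / 2" using ab by simp
      finally have "- (pi/2) < \<beta> * (x - ?m)" "\<beta> * (x - ?m) < pi/2" by linarith+
      then show ?thesis using cos_gt_zero_pi by force
    qed
    define D where "D x = \<beta>\<^sup>2 * (1 + (t x)\<^sup>2) * (f x)\<^sup>2 + 2 * \<beta> * t x * f x * f' x" for x
    have "((\<lambda>x. \<beta> * t x * (f x)\<^sup>2) has_real_derivative D x) (at x)" if x: "x \<in> {a..b}" for x
    proof -
      have "(t has_real_derivative \<beta> * (1 + (t x)\<^sup>2)) (at x)"
        unfolding t_def using cos[OF x]
        by (auto intro!: derivative_eq_intros simp: tan_sec power_inverse)
      then show ?thesis unfolding D_def
        by (auto intro!: derivative_eq_intros f simp: algebra_simps power2_eq_square)
    qed
    then have "(D has_integral (\<beta> * t b * (f b)\<^sup>2 - \<beta> * t a * (f a)\<^sup>2)) {a..b}"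
      using ab by (intro has_integral_of_derivative) auto
    then have D0: "(D has_integral 0) {a..b}" using 0 by simp
    have le1: "((\<lambda>x. \<beta>\<^sup>2 * (f x)\<^sup>2 - (f' x)\<^sup>2) has_integral (\<beta>\<^sup>2 * integral {a..b} (\<lambda>x. (f x)\<^sup>2) - integral {a..b} (\<lambda>x. (f' x)\<^sup>2))) {a..b}"
      using i by (intro has_integral_diff has_integral_mult_right integrable_integral)
    have le2: "\<beta>\<^sup>2 * (f x)\<^sup>2 - (f' x)\<^sup>2 \<le> D x" for x
    proof -
      have "D x - (\<beta>\<^sup>2 * (f x)\<^sup>2 - (f' x)\<^sup>2) = (f' x + \<beta> * t x * f x)\<^sup>2"
        unfolding D_def by (simp add: power2_eq_square algebra_simps)
      also have "\<dots> \<ge> 0" by simp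
      finally show ?thesis by linarith
    qed
    show ?thesis using has_integral_le[OF le1 D0 le2] by simp
  qed
  show ?thesis
  proof (rule tendsto_upperbound)
    show "((\<lambda>\<beta>. \<beta>\<^sup>2 * integral {a..b} (\<lambda>x. (f x)\<^sup>2)) \<longlongrightarrow> ?c\<^sup>2 * integral {a..b} (\<lambda>x. (f x)\<^sup>2)) (at_left ?c)"
      by (intro tendsto_intros)
    show "\<forall>\<^sub>F \<beta> in at_left ?c. \<beta>\<^sup>2 * integral {a..b} (\<lambda>x. (f x)\<^sup>2) \<le> integral {a..b} (\<lambda>x. (f' x)\<^sup>2)"
      using eventually_at_left_real[OF c] by eventually_elim (use * in auto)
  qed simp
qed

lemma DERIV_shift_unique:
  fixes f f' :: "real \<Rightarrow> real"
  assumes f: "\<And>x. (f has_real_derivative f' x) (at x)" and per: "\<And>x. f (x + P) = s * f x"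
  shows "f' (x + P) = s * f' x"
proof -
  have "((\<lambda>x. f (x + P)) has_real_derivative f' (x + P)) (at x)"
    using f[of "x + P"] by (simp add: DERIV_shift)
  moreover have "((\<lambda>x. f (x + P)) has_real_derivative s * f' x) (at x)"
    unfolding per by (intro DERIV_cmult f)
  ultimately show ?thesis by (rule DERIV_unique)
qed

text \<open>
  An antiperiodic function changes sign, so it has a zero \<open>c\<close>, and it vanishes again at \<open>c + P\<close>. Its square
  and the square of its derivative are periodic, so the integrals may be taken over \<open>[c, c + P]\<close>.
\<close>

lemma Wirtinger_antiperiodic:
  fixes f f' :: "real \<Rightarrow> real"
  assumes P: "0 < P" and f: "\<And>x. (f has_real_derivative f' x) (at x)" and f': "continuous_on UNIV f'"
    and anti: "\<And>x. f (x + P) = - f x"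
  shows "(pi / P)\<^sup>2 * integral {0..P} (\<lambda>x. (f x)\<^sup>2) \<le> integral {0..P} (\<lambda>x. (f' x)\<^sup>2)"
proof -
  have fc: "continuous_on UNIV f" using f by (meson DERIV_isCont continuous_at_imp_continuous_on)
  have anti': "f' (x + P) = - f' x" for x using DERIV_shift_unique[OF f, of P "-1"] anti by simp
  have "\<exists>c\<ge>0. f c = 0"
  proof (cases "f 0 \<le> 0")
    case True
    then show ?thesis using IVT'[of f 0 0 P] P anti[of 0] continuous_on_subset[OF fc] by auto
  next
    case False
    then show ?thesis using IVT2'[of f P 0 0] P anti[of 0] continuous_on_subset[OF fc] by auto
  qed
  then obtain c where c: "c \<ge> 0" "f c = 0" by blast
  have "(pi / (c + P - c))\<^sup>2 * integral {c..c+P} (\<lambda>x. (f x)\<^sup>2) \<le> integral {c..c+P} (\<lambda>x. (f' x)\<^sup>2)"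
    using P c anti by (intro Wirtinger_Dirichlet f f') auto
  moreover have "integral {c..c+P} (\<lambda>x. (f x)\<^sup>2) = integral {0..P} (\<lambda>x. (f x)\<^sup>2)"
    using c P anti fc by (intro integral_periodic_shift continuous_intros) auto
  moreover have "integral {c..c+P} (\<lambda>x. (f' x)\<^sup>2) = integral {0..P} (\<lambda>x. (f' x)\<^sup>2)"
    using c P anti' f' by (intro integral_periodic_shift continuous_intros) auto
  ultimately show ?thesis by simp
qed

text \<open>
  The difference \<open>f(x + \<pi>) - f(x)\<close> is antiperiodic, so it vanishes at some \<open>c\<close>. Then \<open>f - f(c)\<close> vanishes
  at \<open>c\<close>, \<open>c + \<pi>\<close> and \<open>c + 2\<pi>\<close>, and the Dirichlet inequality applies on both halves. Subtracting a constant
  from a function of mean zero only increases its square integral.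
\<close>

lemma Wirtinger_mean_zero:
  fixes f f' :: "real \<Rightarrow> real"
  assumes f: "\<And>x. (f has_real_derivative f' x) (at x)" and f': "continuous_on UNIV f'"
    and per: "\<And>x. f (x + 2 * pi) = f x" and mean: "integral {0..2*pi} f = 0"
  shows "integral {0..2*pi} (\<lambda>x. (f x)\<^sup>2) \<le> integral {0..2*pi} (\<lambda>x. (f' x)\<^sup>2)"
proof -
  have fc: "continuous_on UNIV f" using f by (meson DERIV_isCont continuous_at_imp_continuous_on)
  have per': "f' (x + 2*pi) = f' x" for x using DERIV_shift_unique[OF f, of "2*pi" 1] per by simp
  define g where "g x = f (x + pi) - f x" for x
  have gc: "continuous_on A g" for A
    unfolding g_def by (intro continuous_intros continuous_on_compose2[OF fc]) auto
  have g: "g pi = - g 0" using per[of 0] by (simp add: g_def)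
  have "\<exists>c\<ge>0. g c = 0"
  proof (cases "g 0 \<le> 0")
    case True
    then show ?thesis using IVT'[of g 0 0 pi] g gc by force
  next
    case False
    then show ?thesis using IVT2'[of g pi 0 0] g gc by force
  qed
  then obtain c where c: "c \<ge> 0" "f (c + pi) = f c" unfolding g_def by auto
  define h where "h x = f x - f c" for x
  have h: "(h has_real_derivative f' x) (at x)" for x unfolding h_def by (auto intro!: derivative_eq_intros f)
  have hc: "continuous_on A h" for A unfolding h_def by (intro continuous_intros continuous_on_subset[OF fc]) auto
  have h0: "h c = 0" "h (c + pi) = 0" "h (c + 2*pi) = 0" using c per by (auto simp: h_def)
  have hi: "(\<lambda>x. (h x)\<^sup>2) integrable_on {a..b}" "(\<lambda>x. (f' x)\<^sup>2) integrable_on {a..b}" for a b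
    by (intro integrable_continuous_real continuous_intros continuous_on_subset[OF f'] hc; simp)+
  have "integral {c..c+pi} (\<lambda>x. (h x)\<^sup>2) \<le> integral {c..c+pi} (\<lambda>x. (f' x)\<^sup>2)"
    using Wirtinger_Dirichlet[OF _ h f', of c "c+pi"] h0 by simp
  moreover have "integral {c+pi..c+2*pi} (\<lambda>x. (h x)\<^sup>2) \<le> integral {c+pi..c+2*pi} (\<lambda>x. (f' x)\<^sup>2)"
    using Wirtinger_Dirichlet[OF _ h f', of "c+pi" "c+2*pi"] h0 by simp
  moreover have "integral {c..c+pi} F + integral {c+pi..c+2*pi} F = integral {c..c+2*pi} F"
    if "F integrable_on {c..c+2*pi}" for F :: "real \<Rightarrow> real"
    using that by (intro Henstock_Kurzweil_Integration.integral_combine) auto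
  note this[OF hi(1)] this[OF hi(2)]
  moreover have "integral {c..c+2*pi} (\<lambda>x. (h x)\<^sup>2) = integral {0..2*pi} (\<lambda>x. (h x)\<^sup>2)"
    using c by (intro integral_periodic_shift continuous_intros hc) (auto simp: h_def per)
  moreover have "integral {c..c+2*pi} (\<lambda>x. (f' x)\<^sup>2) = integral {0..2*pi} (\<lambda>x. (f' x)\<^sup>2)"
    using c f' by (intro integral_periodic_shift continuous_intros) (auto simp: per')
  ultimately have le: "integral {0..2*pi} (\<lambda>x. (h x)\<^sup>2) \<le> integral {0..2*pi} (\<lambda>x. (f' x)\<^sup>2)" by linarith
  have fi: "f integrable_on {0..2*pi}" "(\<lambda>x. (f x)\<^sup>2) integrable_on {0..2*pi}"
    by (intro integrable_continuous_real continuous_intros continuous_on_subset[OF fc]; simp)+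
  have "((\<lambda>x. (f x)\<^sup>2 - 2 * f c * f x + (f c)\<^sup>2) has_integral
      (integral {0..2*pi} (\<lambda>x. (f x)\<^sup>2) - 2 * f c * integral {0..2*pi} f + 2 * pi * (f c)\<^sup>2)) {0..2*pi}"
    using fi has_integral_const_real[of "(f c)\<^sup>2" 0 "2*pi"]
    by (intro has_integral_add has_integral_diff has_integral_mult_right integrable_integral) simp_all
  moreover have "(\<lambda>x. (f x)\<^sup>2 - 2 * f c * f x + (f c)\<^sup>2) = (\<lambda>x. (h x)\<^sup>2)"
    by (auto simp: h_def power2_eq_square algebra_simps)
  ultimately have "integral {0..2*pi} (\<lambda>x. (h x)\<^sup>2) = integral {0..2*pi} (\<lambda>x. (f x)\<^sup>2) + 2 * pi * (f c)\<^sup>2"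
    using mean by (simp add: integral_unique)
  then show ?thesis using le by (smt (verit) mult_nonneg_nonneg pi_ge_zero zero_le_power2)
qed

section \<open>The inverse-square inequality\<close>

lemma inverse_square_integral:
  fixes r :: "real \<Rightarrow> real"
  assumes rc: "continuous_on UNIV r" and pos: "\<And>x. r x > 0"
  shows inverse_square_integrable: "(\<lambda>x. 1 / (r x)\<^sup>2) integrable_on {a..b}"
    and inverse_square_integral_pos: "0 < integral {0..2*pi} (\<lambda>x. 1 / (r x)\<^sup>2)"
proof -
  have rne: "r x \<noteq> 0" for x using pos[of x] by simp
  have ic: "continuous_on A (\<lambda>x. 1 / (r x)\<^sup>2)" for A
    using rne by (intro continuous_intros continuous_on_subset[OF rc]) auto
  then show ii: "(\<lambda>x. 1 / (r x)\<^sup>2) integrable_on {a..b}" for a b by (intro integrable_continuous_real)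
  have "integral {0..2*pi} (\<lambda>x. 1 / (r x)\<^sup>2) \<ge> 0" by (intro integral_nonneg ii) simp
  moreover have "integral {0..2*pi} (\<lambda>x. 1 / (r x)\<^sup>2) \<noteq> 0"
    using integral_eq_0_iff[OF ic, of 0 "2*pi"] rne by auto
  ultimately show "0 < integral {0..2*pi} (\<lambda>x. 1 / (r x)\<^sup>2)" by simp
qed

text \<open>
  With \<open>S = \<integral>r\<^sup>-\<^sup>2\<close> and \<open>\<Psi>' = \<pi>/(Sr\<^sup>2)\<close>, the functions \<open>r cos \<Psi>\<close> and \<open>r sin \<Psi>\<close> are antiperiodic. Adding their
  Wirtinger inequalities gives the claim: the squares of their derivatives add up to
  \<open>r'\<^sup>2 + \<pi>\<^sup>2/(S\<^sup>2r\<^sup>2)\<close>, whose last term has integral \<open>\<pi>\<^sup>2/S\<close>.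
\<close>

lemma inverse_square_inequality:
  fixes r r' :: "real \<Rightarrow> real"
  assumes r: "\<And>x. (r has_real_derivative r' x) (at x)" and r': "continuous_on UNIV r'"
    and per: "\<And>x. r (x + 2 * pi) = r x" and pos: "\<And>x. r x > 0"
  shows "1/4 * integral {0..2*pi} (\<lambda>x. (r x)\<^sup>2)
     \<le> integral {0..2*pi} (\<lambda>x. (r' x)\<^sup>2) + pi\<^sup>2 / integral {0..2*pi} (\<lambda>x. 1 / (r x)\<^sup>2)"
proof -
  define S where "S = integral {0..2*pi} (\<lambda>x. 1 / (r x)\<^sup>2)"
  have rc: "continuous_on UNIV r" using r by (meson DERIV_isCont continuous_at_imp_continuous_on)
  have rne: "r x \<noteq> 0" for x using pos[of x] by simp
  have ii: "(\<lambda>x. 1 / (r x)\<^sup>2) integrable_on {0..2*pi}" by (rule inverse_square_integrable[OF rc pos])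
  have S: "S > 0" unfolding S_def by (rule inverse_square_integral_pos[OF rc pos])
  have "continuous_on UNIV (\<lambda>x. pi / (S * (r x)\<^sup>2))"
    using rne S by (intro continuous_intros rc) auto
  then obtain \<Psi> where \<Psi>: "\<And>x. (\<Psi> has_real_derivative pi / (S * (r x)\<^sup>2)) (at x)"
    using continuous_has_antiderivative by blast
  have "((\<lambda>x. pi / S * (1 / (r x)\<^sup>2)) has_integral (\<Psi> (2*pi) - \<Psi> 0)) {0..2*pi}"
    using \<Psi> by (intro has_integral_of_derivative) auto
  moreover have "((\<lambda>x. pi / S * (1 / (r x)\<^sup>2)) has_integral (pi / S * S)) {0..2*pi}"
    unfolding S_def by (intro has_integral_mult_right integrable_integral ii)
  ultimately have "\<Psi> (2*pi) - \<Psi> 0 = pi / S * S" by (rule has_integral_unique)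
  then have \<Psi>1: "\<Psi> (2*pi) - \<Psi> 0 = pi" using S by simp
  have "((\<lambda>x. \<Psi> (x + 2*pi) - \<Psi> x) has_real_derivative 0) (at x)" for x
  proof -
    have "((\<lambda>x. \<Psi> (x + 2*pi)) has_real_derivative pi / (S * (r x)\<^sup>2)) (at x)"
      using \<Psi>[of "x + 2*pi"] per by (simp add: DERIV_shift)
    from DERIV_diff[OF this \<Psi>[of x]] show ?thesis by simp
  qed
  then have "\<Psi> (x + 2*pi) - \<Psi> x = \<Psi> (0 + 2*pi) - \<Psi> 0" for x
    using DERIV_isconst_all[of "\<lambda>x. \<Psi> (x + 2*pi) - \<Psi> x" x 0] by blast
  then have \<Psi>per: "\<Psi> (x + 2*pi) = \<Psi> x + pi" for x using \<Psi>1 by (simp add: algebra_simps)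
  have \<Psi>c: "continuous_on A \<Psi>" for A using \<Psi> by (meson DERIV_isCont continuous_at_imp_continuous_on)
  define f1 f2 where "f1 x = r' x * cos (\<Psi> x) - pi / (S * r x) * sin (\<Psi> x)"
    and "f2 x = r' x * sin (\<Psi> x) + pi / (S * r x) * cos (\<Psi> x)" for x
  have d1: "((\<lambda>x. r x * cos (\<Psi> x)) has_real_derivative f1 x) (at x)" for x
    unfolding f1_def by (auto intro!: derivative_eq_intros r \<Psi> simp: rne power2_eq_square)
  have d2: "((\<lambda>x. r x * sin (\<Psi> x)) has_real_derivative f2 x) (at x)" for x
    unfolding f2_def by (auto intro!: derivative_eq_intros r \<Psi> simp: rne power2_eq_square)
  have c12: "continuous_on UNIV f1" "continuous_on UNIV f2"
    unfolding f1_def f2_def using rne S by (intro continuous_intros r' rc \<Psi>c; simp)+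
  have W1: "1/4 * integral {0..2*pi} (\<lambda>x. (r x * cos (\<Psi> x))\<^sup>2) \<le> integral {0..2*pi} (\<lambda>x. (f1 x)\<^sup>2)"
    using Wirtinger_antiperiodic[OF _ d1 c12(1), of "2*pi"] by (simp add: \<Psi>per per power2_eq_square)
  have W2: "1/4 * integral {0..2*pi} (\<lambda>x. (r x * sin (\<Psi> x))\<^sup>2) \<le> integral {0..2*pi} (\<lambda>x. (f2 x)\<^sup>2)"
    using Wirtinger_antiperiodic[OF _ d2 c12(2), of "2*pi"] by (simp add: \<Psi>per per power2_eq_square)
  have I1: "integral {0..2*pi} (\<lambda>x. (r x * cos (\<Psi> x))\<^sup>2) + integral {0..2*pi} (\<lambda>x. (r x * sin (\<Psi> x))\<^sup>2)
      = integral {0..2*pi} (\<lambda>x. (r x)\<^sup>2)"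
  proof -
    have "(r x * cos (\<Psi> x))\<^sup>2 + (r x * sin (\<Psi> x))\<^sup>2 = (r x)\<^sup>2" for x
      by (simp add: power_mult_distrib distrib_left[symmetric])
    then show ?thesis
      by (subst Henstock_Kurzweil_Integration.integral_add[symmetric])
        (auto intro!: integrable_continuous_real continuous_intros continuous_on_subset[OF rc] \<Psi>c)
  qed
  have I2: "integral {0..2*pi} (\<lambda>x. (f1 x)\<^sup>2) + integral {0..2*pi} (\<lambda>x. (f2 x)\<^sup>2)
      = integral {0..2*pi} (\<lambda>x. (r' x)\<^sup>2) + pi\<^sup>2 / S"
  proof -
    have sq: "(f1 x)\<^sup>2 + (f2 x)\<^sup>2 = (r' x)\<^sup>2 + pi\<^sup>2 / S\<^sup>2 * (1 / (r x)\<^sup>2)" for x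
    proof -
      have "(f1 x)\<^sup>2 + (f2 x)\<^sup>2 = ((r' x)\<^sup>2 + (pi / (S * r x))\<^sup>2) * ((sin (\<Psi> x))\<^sup>2 + (cos (\<Psi> x))\<^sup>2)"
      proof -
        have "(a * c - b * s)\<^sup>2 + (a * s + b * c)\<^sup>2 = (a\<^sup>2 + b\<^sup>2) * (s\<^sup>2 + c\<^sup>2)" for a b c s :: real
          by (simp add: power2_eq_square algebra_simps)
        then show ?thesis unfolding f1_def f2_def .
      qed
      then show ?thesis by (simp add: power_divide power_mult_distrib)
    qed
    have "integral {0..2*pi} (\<lambda>x. (f1 x)\<^sup>2) + integral {0..2*pi} (\<lambda>x. (f2 x)\<^sup>2)
      = integral {0..2*pi} (\<lambda>x. (r' x)\<^sup>2 + pi\<^sup>2 / S\<^sup>2 * (1 / (r x)\<^sup>2))"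
      unfolding sq[symmetric] using c12
      by (intro Henstock_Kurzweil_Integration.integral_add[symmetric] integrable_continuous_real continuous_intros)
        (auto intro: continuous_on_subset)
    also have "\<dots> = integral {0..2*pi} (\<lambda>x. (r' x)\<^sup>2) + integral {0..2*pi} (\<lambda>x. pi\<^sup>2 / S\<^sup>2 * (1 / (r x)\<^sup>2))"
      by (intro Henstock_Kurzweil_Integration.integral_add integrable_on_mult_right ii
         integrable_continuous_real continuous_intros continuous_on_subset[OF r']) auto
    also have "integral {0..2*pi} (\<lambda>x. pi\<^sup>2 / S\<^sup>2 * (1 / (r x)\<^sup>2)) = pi\<^sup>2 / S\<^sup>2 * S"
      unfolding S_def by (rule integral_mult_right)
    also have "\<dots> = pi\<^sup>2 / S" using S by (simp add: power2_eq_square)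
    finally show ?thesis .
  qed
  show ?thesis using W1 W2 I1 I2 unfolding S_def[symmetric] by linarith
qed

section \<open>Heat flow of trigonometric polynomials\<close>

text \<open>
  Real trigonometric polynomials, generated by waves with a phase instead of by sines and cosines:
  this form is stable under products and antiderivatives. The frequency is an integer because the
  product of two waves contains the difference of their frequencies.
\<close>

inductive trig_poly :: "(real \<Rightarrow> real) \<Rightarrow> bool" where
  wave: "trig_poly (\<lambda>x. c * cos (of_int k * x + d))"
| sum: "trig_poly f \<Longrightarrow> trig_poly g \<Longrightarrow> trig_poly (\<lambda>x. f x + g x)"

lemma cos_shift_2pi: "cos (of_int k * (x + 2 * pi) + d) = cos (of_int k * x + d)"
proof -
  have "of_int k * (x + 2 * pi) + d = (of_int k * x + d) + 2 * pi * of_int k" by (simp add: algebra_simps)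
  then show ?thesis by (simp only: cos_add cos_int_2pin sin_int_2pin) simp
qed

text \<open>
  A function \<open>H t x\<close> solving the heat equation on the circle for all times, with its first three
  derivatives in \<open>x\<close>; the heat equation is expressed by the occurrence of \<open>H2\<close> and \<open>H3\<close> in \<open>dt\<close> and \<open>dtx\<close>. The
  number \<open>m\<close> is the mean of the initial function, to which \<open>H t\<close> converges at the rate of the slowest
  wave.
\<close>

locale heat_evolution =
  fixes H H1 H2 H3 :: "real \<Rightarrow> real \<Rightarrow> real" and m C :: real
  assumes dx: "\<And>t x. (H t has_real_derivative H1 t x) (at x)"
    and dxx: "\<And>t x. (H1 t has_real_derivative H2 t x) (at x)"
    and dxxx: "\<And>t x. (H2 t has_real_derivative H3 t x) (at x)"
    and dt: "\<And>t x. ((\<lambda>t. H t x) has_real_derivative H2 t x) (at t)"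
    and dtx: "\<And>t x. ((\<lambda>t. H1 t x) has_real_derivative H3 t x) (at t)"
    and c0: "continuous_on UNIV (\<lambda>(t, x). H t x)"
    and c1: "continuous_on UNIV (\<lambda>(t, x). H1 t x)"
    and c2: "continuous_on UNIV (\<lambda>(t, x). H2 t x)"
    and c3: "continuous_on UNIV (\<lambda>(t, x). H3 t x)"
    and per: "\<And>t x. H t (x + 2 * pi) = H t x"
    and decay: "\<And>t x. 0 \<le> t \<Longrightarrow> \<bar>H t x - m\<bar> \<le> C * exp (- t)"
    and mean: "(H 0 has_integral 2 * pi * m) {0..2*pi}"

text \<open>
  A wave of frequency \<open>k\<close> evolves by the factor \<open>exp (-k\<^sup>2t)\<close>, and all properties required are preserved by
  sums.
\<close>

lemma trig_poly_heat_evolution: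
  assumes "trig_poly f"
  shows "\<exists>H H1 H2 H3 m C. heat_evolution H H1 H2 H3 m C \<and> H 0 = f"
  using assms
proof induction
  case (wave c k d)
  let ?k = "of_int k :: real"
  define H where "H t x = c * exp (- ?k\<^sup>2 * t) * cos (?k * x + d)" for t x
  define H1 where "H1 t x = - ?k * c * exp (- ?k\<^sup>2 * t) * sin (?k * x + d)" for t x
  define H2 where "H2 t x = - ?k\<^sup>2 * c * exp (- ?k\<^sup>2 * t) * cos (?k * x + d)" for t x
  define H3 where "H3 t x = ?k^3 * c * exp (- ?k\<^sup>2 * t) * sin (?k * x + d)" for t x
  define m where "m = (if k = 0 then c * cos d else 0)"
  have "heat_evolution H H1 H2 H3 m \<bar>c\<bar>"
  proof
    fix t x
    show "(H t has_real_derivative H1 t x) (at x)" unfolding H_def H1_def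
      by (auto intro!: derivative_eq_intros)
    show "(H1 t has_real_derivative H2 t x) (at x)" unfolding H1_def H2_def
      by (auto intro!: derivative_eq_intros simp: power2_eq_square)
    show "(H2 t has_real_derivative H3 t x) (at x)" unfolding H2_def H3_def
      by (auto intro!: derivative_eq_intros simp: power2_eq_square power3_eq_cube)
    show "((\<lambda>t. H t x) has_real_derivative H2 t x) (at t)" unfolding H_def H2_def
      by (auto intro!: derivative_eq_intros)
    show "((\<lambda>t. H1 t x) has_real_derivative H3 t x) (at t)" unfolding H1_def H3_def
      by (auto intro!: derivative_eq_intros simp: power2_eq_square power3_eq_cube)
    show "H t (x + 2 * pi) = H t x" unfolding H_def by (simp only: cos_shift_2pi)
    show "\<bar>H t x - m\<bar> \<le> \<bar>c\<bar> * exp (- t)" if "0 \<le> t"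
    proof (cases "k = 0")
      case True
      then show ?thesis by (simp add: H_def m_def)
    next
      case False
      then have "1 \<le> \<bar>?k\<bar>" by (metis of_int_abs of_int_1_le_iff int_one_le_iff_zero_less zero_less_abs_iff)
      then have "1 * t \<le> ?k\<^sup>2 * t" using that by (intro mult_right_mono) (simp_all add: abs_le_square_iff[of 1, simplified])
      then have "exp (- ?k\<^sup>2 * t) \<le> exp (- t)" by simp
      then have "\<bar>exp (- ?k\<^sup>2 * t) * cos (?k * x + d)\<bar> \<le> exp (- t) * 1"
        unfolding abs_mult by (intro mult_mono) auto
      then have "\<bar>c\<bar> * \<bar>exp (- ?k\<^sup>2 * t) * cos (?k * x + d)\<bar> \<le> \<bar>c\<bar> * exp (- t)"
        by (intro mult_left_mono) auto
      then show ?thesis using False by (simp add: H_def m_def abs_mult mult.assoc)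
    qed
  next
    show "(H 0 has_integral 2 * pi * m) {0..2*pi}"
    proof (cases "k = 0")
      case True
      then have "H 0 = (\<lambda>x. c * cos d)" by (auto simp: H_def)
      then show ?thesis using True has_integral_const_real[of "c * cos d" 0 "2*pi"] by (simp add: m_def)
    next
      case False
      have e: "sin (?k * (2 * pi) + d) = sin d"
        using cos_shift_2pi[of k 0 "d - pi/2"] by (simp add: cos_diff sin_cos_eq[symmetric] algebra_simps cos_add sin_add)
      have "(H 0 has_integral (c / ?k * sin (?k * (2*pi) + d) - c / ?k * sin (?k * 0 + d))) {0..2*pi}"
        unfolding H_def using False
        by (intro has_integral_of_derivative) (auto intro!: derivative_eq_intros)
      then show ?thesis using False e by (simp add: m_def)
    qed
  qed (auto simp: H_def H1_def H2_def H3_def split_def intro!: continuous_intros)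
  moreover have "H 0 = (\<lambda>x. c * cos (?k * x + d))" by (auto simp: H_def)
  ultimately show ?case by blast
next
  case (sum f g)
  then obtain F F1 F2 F3 mF CF G G1 G2 G3 mG CG where
    "heat_evolution F F1 F2 F3 mF CF" and F0: "F 0 = f" and "heat_evolution G G1 G2 G3 mG CG" and G0: "G 0 = g"
    by metis
  then interpret F: heat_evolution F F1 F2 F3 mF CF + G: heat_evolution G G1 G2 G3 mG CG by auto
  have ca: "continuous_on UNIV (\<lambda>(t, x). A t x + B t x)"
    if "continuous_on UNIV (\<lambda>(t, x). A t x)" "continuous_on UNIV (\<lambda>(t, x). B t x)" for A B :: "real \<Rightarrow> real \<Rightarrow> real"
    using continuous_on_add[OF that] by (simp add: split_def)
  have "heat_evolution (\<lambda>t x. F t x + G t x) (\<lambda>t x. F1 t x + G1 t x) (\<lambda>t x. F2 t x + G2 t x)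
     (\<lambda>t x. F3 t x + G3 t x) (mF + mG) (CF + CG)"
  proof
    fix t x :: real assume t: "0 \<le> t"
    have "\<bar>F t x + G t x - (mF + mG)\<bar> \<le> CF * exp (-t) + CG * exp (-t)"
      using F.decay[OF t, of x] G.decay[OF t, of x] by linarith
    then show "\<bar>F t x + G t x - (mF + mG)\<bar> \<le> (CF + CG) * exp (-t)" by (simp add: algebra_simps)
  next
    show "((\<lambda>x. F 0 x + G 0 x) has_integral 2 * pi * (mF + mG)) {0..2*pi}"
      using has_integral_add[OF F.mean G.mean] by (simp add: algebra_simps)
  qed (auto intro!: DERIV_add ca F.dx F.dxx F.dxxx F.dt F.dtx F.c0 F.c1 F.c2 F.c3 G.dx G.dxx G.dxxx G.dt G.dtx G.c0 G.c1 G.c2 G.c3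
       simp: F.per G.per)
  moreover have "(\<lambda>x. F 0 x + G 0 x) = (\<lambda>x. f x + g x)" using F0 G0 by auto
  ultimately show ?case by (intro exI conjI)
qed

lemma periodic_int_shift:
  fixes g :: "real \<Rightarrow> 'a"
  assumes "\<And>x. g (x + P) = g x"
  shows "g (x + of_int n * P) = g x"
proof (induction n rule: int_induct[of _ 0])
  case (step1 i)
  then show ?case using assms[of "x + of_int i * P"] by (simp add: algebra_simps)
next
  case (step2 i)
  then show ?case using assms[of "x + (of_int i - 1) * P"] by (simp add: algebra_simps)
qed simp

lemma periodic_representative:
  fixes x :: real
  obtains n :: int where "x + of_int n * (2 * pi) \<in> {0..2*pi}"
proof -
  let ?n = "\<lfloor>x / (2*pi)\<rfloor>"
  have "of_int ?n \<le> x / (2*pi)" "x / (2*pi) < of_int ?n + 1" by linarith+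
  then have "of_int ?n * (2*pi) \<le> x / (2*pi) * (2*pi)" "x / (2*pi) * (2*pi) \<le> (of_int ?n + 1) * (2*pi)"
    by (intro mult_right_mono; simp)+
  then have "of_int ?n * (2*pi) \<le> x" "x \<le> (of_int ?n + 1) * (2*pi)" by simp_all
  then have "x + of_int (- ?n) * (2 * pi) \<in> {0..2*pi}" by (simp add: algebra_simps)
  then show ?thesis by (rule that)
qed

lemma DERIV_powr_const:
  assumes "(f has_real_derivative f') (at x)" "f x > (0::real)"
  shows "((\<lambda>x. f x powr a) has_real_derivative (f x powr a * (a * (f' / f x)))) (at x)"
  by (rule DERIV_cong[OF DERIV_powr[OF assms DERIV_const[of a]]]) simp

text \<open>
  A negative second derivative would make \<open>f'\<close> negative, and \<open>f\<close> decreasing, immediately to the right of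
  the minimum.
\<close>

lemma second_derivative_at_min:
  fixes f f' :: "real \<Rightarrow> real"
  assumes f: "\<And>x. (f has_real_derivative f' x) (at x)" and f': "(f' has_real_derivative l) (at x)"
    and min: "\<And>y. f x \<le> f y"
  shows "0 \<le> l"
proof (rule ccontr)
  assume "\<not> 0 \<le> l"
  then have "l < 0" by simp
  have 0: "f' x = 0" using DERIV_local_min[OF f zero_less_one] min by blast
  obtain d where d: "d > 0" "\<And>h. 0 < h \<Longrightarrow> h < d \<Longrightarrow> f' (x + h) < 0"
    using DERIV_neg_dec_right[OF f' \<open>l < 0\<close>] 0 by auto
  obtain z where z: "x < z" "z < x + d/2" "f (x + d/2) - f x = (x + d/2 - x) * f' z"
    using MVT2[of x "x + d/2" f f'] f d(1) by auto
  have "f' z < 0" using d(2)[of "z - x"] z(1,2) by simp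
  then have "(x + d/2 - x) * f' z < 0" using d(1) by (simp add: mult_pos_neg)
  then have "f (x + d/2) < f x" using z(3) by linarith
  then show False using min[of "x + d/2"] by simp
qed

context heat_evolution begin

text \<open>
  Otherwise \<open>H t x + \<delta>t\<close>, for a small \<open>\<delta> > 0\<close>, would have its minimum over \<open>[0, t\<^sub>0] \<times> [0, 2\<pi>]\<close> at a positive time. There
  \<open>H\<^sub>x\<^sub>x \<ge> 0\<close> and \<open>H\<^sub>t + \<delta> \<le> 0\<close>, which contradicts \<open>H\<^sub>t = H\<^sub>x\<^sub>x\<close>. By periodicity the minimum over one period is a
  minimum over the line, so the end points of the interval in \<open>x\<close> need no separate treatment.
\<close>

lemma minimum_principle:
  assumes \<mu>: "\<And>x. \<mu> \<le> H 0 x" and t0: "0 \<le> t0"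
  shows "\<mu> \<le> H t0 x0"
proof (rule ccontr)
  assume "\<not> \<mu> \<le> H t0 x0"
  then have less: "H t0 x0 < \<mu>" by simp
  then have t0: "0 < t0" using t0 \<mu>[of x0] by (cases "t0 = 0") auto
  \<comment> \<open>Small enough that the value at \<open>(t\<^sub>0, x\<^sub>0)\<close> stays below the values at time \<open>0\<close>.\<close>
  define \<delta> where "\<delta> = (\<mu> - H t0 x0) / (2 * t0)"
  have \<delta>: "\<delta> > 0" using less t0 by (simp add: \<delta>_def)
  have \<delta>t: "H t0 x0 + \<delta> * t0 < \<mu>" using less t0 by (simp add: \<delta>_def field_simps)
  define K where "K = (\<lambda>(t, x). H t x + \<delta> * t)"
  have "compact ({0..t0} \<times> {0..2*pi})" by (intro compact_Times) auto
  moreover have "({0..t0} \<times> {0..2*pi}) \<noteq> {}" using t0 by auto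
  moreover have "continuous_on ({0..t0} \<times> {0..2*pi}) K"
    unfolding K_def split_def using continuous_on_subset[OF c0, of "{0..t0} \<times> {0..2*pi}"]
    by (intro continuous_intros) (auto simp: split_def)
  ultimately obtain p where p: "p \<in> {0..t0} \<times> {0..2*pi}" "\<And>y. y \<in> {0..t0} \<times> {0..2*pi} \<Longrightarrow> K p \<le> K y"
    using continuous_attains_inf by metis
  obtain t1 x1 where p_eq: "p = (t1, x1)" by force
  have t1: "0 \<le> t1" "t1 \<le> t0" using p(1) p_eq by auto
  have min: "H t1 x1 + \<delta> * t1 \<le> H t x + \<delta> * t" if t: "0 \<le> t" "t \<le> t0" for t x
  proof -
    obtain n :: int where n: "x + of_int n * (2 * pi) \<in> {0..2*pi}" using periodic_representative by blast
    have "K p \<le> K (t, x + of_int n * (2 * pi))" using n t by (intro p(2)) auto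
    then show ?thesis using periodic_int_shift[of "H t" "2*pi", OF per] by (simp add: K_def p_eq)
  qed
  have "t1 \<noteq> 0"
  proof
    assume "t1 = 0"
    then show False using min[of t0 x0] t0 \<delta>t \<mu>[of x1] by simp
  qed
  then have t1p: "0 < t1" using t1 by simp
  have "0 \<le> H2 t1 x1"
    by (rule second_derivative_at_min[OF dx dxx]) (use min[of t1] t1 in auto)
  moreover have "\<not> 0 < H2 t1 x1 + \<delta>"
  proof
    assume pos: "0 < H2 t1 x1 + \<delta>"
    have "((\<lambda>t. H t x1 + \<delta> * t) has_real_derivative H2 t1 x1 + \<delta>) (at t1)"
      by (auto intro!: derivative_eq_intros dt)
    from DERIV_pos_inc_left[OF this pos] obtain d where d: "d > 0"
      "\<And>h. 0 < h \<Longrightarrow> h < d \<Longrightarrow> H (t1 - h) x1 + \<delta> * (t1 - h) < H t1 x1 + \<delta> * t1" by blast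
    let ?h = "min t1 d / 2"
    have h: "0 < ?h" "?h < d" using d(1) t1p by auto
    have "0 \<le> t1 - ?h" "t1 - ?h \<le> t0" using d(1) t1 t1p by (auto simp: min_def)
    then show False using d(2)[OF h] min[of "t1 - ?h" x1] by linarith
  qed
  ultimately show False using \<delta> by simp
qed

lemma H_cont: "continuous_on A (H t)" "continuous_on A (H1 t)" "continuous_on A (H2 t)" "continuous_on A (H3 t)"
proof -
  have *: "continuous_on A (B t)" if "continuous_on UNIV (\<lambda>(t, x). B t x)" for B :: "real \<Rightarrow> real \<Rightarrow> real"
    by (rule continuous_on_compose2[OF that, of A "\<lambda>x. (t, x)", simplified]) (auto intro!: continuous_intros)
  show "continuous_on A (H t)" "continuous_on A (H1 t)" "continuous_on A (H2 t)" "continuous_on A (H3 t)"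
    using * c0 c1 c2 c3 by blast+
qed

lemma H1_per: "H1 t (x + 2 * pi) = H1 t x"
  using DERIV_shift_unique[OF dx, of t "2*pi" 1] per by simp

lemma H2_per: "H2 t (x + 2 * pi) = H2 t x"
  using DERIV_shift_unique[OF dxx, of t "2*pi" 1] H1_per by simp

text \<open>
  With \<open>u = H\<^sup>1\<^sup>/\<^sup>q\<close> this is \<open>(q - 2) u\<^sub>x\<^sup>2 + u\<^sup>2\<close>, since \<open>u\<^sub>x = u H\<^sub>x/(qH)\<close>.
\<close>

definition energy_density :: "real \<Rightarrow> real \<Rightarrow> real \<Rightarrow> real" where
  "energy_density q t x = H t x powr (2/q) * ((q - 2) / q\<^sup>2 * (H1 t x / H t x)\<^sup>2 + 1)"

text \<open>
  The derivative in time of the energy density, after \<open>H\<^sub>t = H\<^sub>x\<^sub>x\<close> has been inserted.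
\<close>

definition energy_rate :: "real \<Rightarrow> real \<Rightarrow> real \<Rightarrow> real" where
  "energy_rate q t x = H t x powr (2/q) * (2 / q * (H2 t x / H t x) * ((q - 2) / q\<^sup>2 * (H1 t x / H t x)\<^sup>2 + 1)
     + 2 * (q - 2) / q\<^sup>2 * (H1 t x / H t x) * (H3 t x / H t x - H1 t x / H t x * (H2 t x / H t x)))"

lemma DERIV_energy_density:
  assumes pos: "H t x > 0"
  shows "((\<lambda>t. energy_density q t x) has_real_derivative energy_rate q t x) (at t)"
proof -
  have U: "((\<lambda>t. H t x powr (2/q)) has_real_derivative H t x powr (2/q) * (2/q * (H2 t x / H t x))) (at t)"
    by (rule DERIV_powr_const[OF dt pos])
  have A: "((\<lambda>t. H1 t x / H t x) has_real_derivative (H3 t x / H t x - H1 t x / H t x * (H2 t x / H t x))) (at t)"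
    using pos by (auto intro!: derivative_eq_intros dt dtx simp: field_simps)
  have "((\<lambda>t. (q - 2) / q\<^sup>2 * (H1 t x / H t x)\<^sup>2 + 1) has_real_derivative
      (q - 2) / q\<^sup>2 * (2 * (H1 t x / H t x) * (H3 t x / H t x - H1 t x / H t x * (H2 t x / H t x)))) (at t)"
    by (rule DERIV_cong[OF DERIV_add[OF DERIV_cmult[OF DERIV_power[OF A, of 2]] DERIV_const]]) simp
  note D = DERIV_mult[OF U this]
  have eq: "U * s * (k * A\<^sup>2 + 1) + k * (2 * A * A') * U = U * (s * (k * A\<^sup>2 + 1) + 2 * k * A * A')"
    for U s k A A' :: real by (simp add: algebra_simps)
  have "2 * (q - 2) / q\<^sup>2 = 2 * ((q - 2) / q\<^sup>2)" by simp
  then show ?thesis unfolding energy_density_def energy_rate_def using D eq by metis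
qed

text \<open>
  Put \<open>u = H\<^sup>1\<^sup>/\<^sup>q\<close> and \<open>w = u\<^sub>x/u\<close>. Up to a total derivative \<open>Q\<^sub>x\<close> of a periodic function, the rate is
  \<open>2(q - 2)(u\<^sub>x\<^sup>2 - u\<^sub>x\<^sub>x\<^sup>2) - (2/3)(q - 2)(q - 1) u\<^sup>2w\<^sup>4\<close>. The last term is not positive, and the integral of the first is
  not positive by Wirtinger's inequality for \<open>u\<^sub>x\<close>, which has mean zero.
  The function \<open>Q = u\<^sup>2(2(q - 2)ww' + (4q + 2)(q - 2)w\<^sup>3/3 + 2w)\<close> is found by comparing the coefficients of \<open>ww''\<close>,
  \<open>w\<^sup>2w'\<close> and \<open>w'\<close>.
\<close>

lemma energy_rate_integral_nonpos:
  assumes pos: "\<And>x. H t x > 0" and q: "q > 2"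
  shows "integral {0..2*pi} (energy_rate q t) \<le> 0"
proof -
  \<comment> \<open>The quotients \<open>A\<close>, \<open>B\<close>, \<open>C\<close> satisfy \<open>A' = B - A\<^sup>2\<close> and \<open>B' = C - AB\<close>, so that \<open>w = A/q\<close>, \<open>w' = (B - A\<^sup>2)/q\<close>, and
everything becomes a polynomial identity.\<close>
  define A B C U where "A x = H1 t x / H t x" and "B x = H2 t x / H t x" and "C x = H3 t x / H t x"
    and "U x = H t x powr (2/q)" for x
  define u where "u x = H t x powr (1/q)" for x
  have Hne: "H t x \<noteq> 0" for x using pos[of x] by simp
  have dA: "(A has_real_derivative (B x - (A x)\<^sup>2)) (at x)" for x
    unfolding A_def B_def using Hne[of x] by (auto intro!: derivative_eq_intros dx dxx simp: field_simps power2_eq_square)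
  have dB: "(B has_real_derivative (C x - A x * B x)) (at x)" for x
    unfolding A_def B_def C_def using Hne[of x] by (auto intro!: derivative_eq_intros dx dxx dxxx simp: field_simps power2_eq_square)
  have dU: "(U has_real_derivative (U x * (2/q * A x))) (at x)" for x
    unfolding U_def A_def by (rule DERIV_powr_const[OF dx pos])
  have du: "(u has_real_derivative (u x * (1/q * A x))) (at x)" for x
    unfolding u_def A_def by (rule DERIV_powr_const[OF dx pos])
  have Uu: "U x = (u x)\<^sup>2" for x
    unfolding U_def u_def by (simp add: power2_eq_square powr_add[symmetric])
  have Ac: "continuous_on S A" "continuous_on S B" "continuous_on S C" "continuous_on S u" for S
    unfolding A_def B_def C_def u_def using Hne pos by (intro continuous_intros H_cont; simp)+
  have perA: "A (x + 2*pi) = A x" "B (x + 2*pi) = B x" "u (x + 2*pi) = u x" for x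
    unfolding A_def B_def u_def by (simp_all add: per H1_per H2_per)
  define ux where "ux x = u x * (A x / q)" for x
  define uxx where "uxx x = u x * ((B x - (A x)\<^sup>2) / q + (A x / q)\<^sup>2)" for x
  have dux: "(ux has_real_derivative uxx x) (at x)" for x
    unfolding ux_def uxx_def using q
    by (auto intro!: derivative_eq_intros du dA simp: power2_eq_square field_simps)
  have cux: "continuous_on S ux" "continuous_on S uxx" for S
    unfolding ux_def uxx_def using q by (intro continuous_intros Ac; simp)+
  define Q where "Q x = U x * (2 * (q-2) * (A x / q) * ((B x - (A x)\<^sup>2) / q)
      + (4*q+2) * (q-2) / 3 * (A x / q)^3 + 2 * (A x / q))" for x
  define R where "R x = 2 * (q-2) * ((ux x)\<^sup>2 - (uxx x)\<^sup>2) - 2 * (q-2) * (q-1) / 3 * U x * (A x / q)^4" for x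
  have dQ: "(Q has_real_derivative (energy_rate q t x - R x)) (at x)" for x
  proof -
    let ?b = "\<lambda>x. (B x - (A x)\<^sup>2) / q"
    have da: "((\<lambda>x. A x / q) has_real_derivative ?b x) (at x)"
      by (rule DERIV_cdivide[OF dA])
    have db: "(?b has_real_derivative ((C x - A x * B x - 2 * A x * (B x - (A x)\<^sup>2)) / q)) (at x)"
      by (rule DERIV_cong[OF DERIV_cdivide[OF DERIV_diff[OF dB DERIV_power[OF dA, of 2]]]]) simp
    have p: "((\<lambda>x. 2 * (q-2) * (A x / q) * ?b x + (4*q+2) * (q-2) / 3 * (A x / q)^3 + 2 * (A x / q)) has_real_derivative
        (2 * (q-2) * ?b x * ?b x + 2 * (q-2) * (A x / q) * ((C x - A x * B x - 2 * A x * (B x - (A x)\<^sup>2)) / q)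
      + (4*q+2) * (q-2) / 3 * (3 * (A x / q)^2 * ?b x) + 2 * ?b x)) (at x)"
      by (rule DERIV_cong[OF DERIV_add[OF DERIV_add[OF DERIV_mult[OF DERIV_cmult[OF da] db]
          DERIV_cmult[OF DERIV_power[OF da, of 3]]] DERIV_cmult[OF da]]]) (simp add: mult_ac)
    have "(Q has_real_derivative (U x * (2/q * A x) * (2 * (q-2) * (A x / q) * ((B x - (A x)\<^sup>2) / q)
      + (4*q+2) * (q-2) / 3 * (A x / q)^3 + 2 * (A x / q))
      + U x * (2 * (q-2) * ((B x - (A x)\<^sup>2) / q) * ((B x - (A x)\<^sup>2) / q)
         + 2 * (q-2) * (A x / q) * ((C x - A x * B x - 2 * A x * (B x - (A x)\<^sup>2)) / q)
      + (4*q+2) * (q-2) / 3 * (3 * (A x / q)^2 * ((B x - (A x)\<^sup>2) / q)) + 2 * ((B x - (A x)\<^sup>2) / q)))) (at x)"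
      unfolding Q_def by (rule DERIV_cong[OF DERIV_mult[OF dU p]]) (simp only: mult_ac)
    moreover have "U x * (2/q * A x) * (2 * (q-2) * (A x / q) * ((B x - (A x)\<^sup>2) / q)
      + (4*q+2) * (q-2) / 3 * (A x / q)^3 + 2 * (A x / q))
      + U x * (2 * (q-2) * ((B x - (A x)\<^sup>2) / q) * ((B x - (A x)\<^sup>2) / q)
         + 2 * (q-2) * (A x / q) * ((C x - A x * B x - 2 * A x * (B x - (A x)\<^sup>2)) / q)
      + (4*q+2) * (q-2) / 3 * (3 * (A x / q)^2 * ((B x - (A x)\<^sup>2) / q)) + 2 * ((B x - (A x)\<^sup>2) / q)) = energy_rate q t x - R x"
    proof -
      \<comment> \<open>Substituting multiples of \<open>q\<close> clears the denominators.\<close>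
      have "\<exists>a b c. A x = q * a \<and> B x = q * b \<and> C x = q * c"
        using q by (intro exI[of _ "A x / q"] exI[of _ "B x / q"] exI[of _ "C x / q"]) auto
      then obtain a b c where abc: "A x = q * a" "B x = q * b" "C x = q * c" by blast
      have G: "energy_rate q t x = U x * (2 / q * B x * ((q - 2) / q\<^sup>2 * (A x)\<^sup>2 + 1) + 2 * (q - 2) / q\<^sup>2 * A x * (C x - A x * B x))"
        unfolding energy_rate_def U_def A_def B_def C_def ..
      have qne: "q \<noteq> 0" using q by simp
      have e: "q * a / q = a" "(q * b - (q * a)\<^sup>2) / q = b - q * a\<^sup>2"
        "(q * c - q * a * (q * b) - 2 * (q * a) * (q * b - (q * a)\<^sup>2)) / q = c - q * a * b - 2 * q * a * (b - q * a\<^sup>2)"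
        "2 / q * (q * a) = 2 * a" "2 / q * (q * b) = 2 * b" "(q - 2) / q\<^sup>2 * (q * a)\<^sup>2 = (q - 2) * a\<^sup>2"
        "2 * (q - 2) / q\<^sup>2 * (q * a) * (q * c - q * a * (q * b)) = 2 * (q - 2) * a * (c - q * a * b)"
        using qne by (simp_all add: field_simps power2_eq_square)
      show ?thesis
        unfolding G R_def ux_def uxx_def power_mult_distrib Uu[symmetric]
        unfolding abc unfolding e
        by (simp add: field_simps power2_eq_square power3_eq_cube power4_eq_xxxx)
    qed
    ultimately show ?thesis by simp
  qed
  have Qint: "((\<lambda>x. energy_rate q t x - R x) has_integral (Q (2*pi) - Q 0)) {0..2*pi}"
    using dQ by (intro has_integral_of_derivative) auto
  have "Q (2*pi) = Q 0" using perA[of 0] unfolding Q_def Uu by simp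
  then have Q0: "((\<lambda>x. energy_rate q t x - R x) has_integral 0) {0..2*pi}" using Qint by simp
  have Rc: "R integrable_on {0..2*pi}"
    unfolding R_def Uu using q by (intro integrable_continuous_real continuous_intros cux Ac) auto
  have GR: "integral {0..2*pi} (energy_rate q t) = integral {0..2*pi} R"
    using has_integral_add[OF Q0 integrable_integral[OF Rc]] by (simp add: integral_unique)
  have "integral {0..2*pi} ux = 0"
  proof -
    have "(ux has_integral (u (2*pi) - u 0)) {0..2*pi}"
      using du by (intro has_integral_of_derivative) (auto simp: ux_def)
    then show ?thesis using perA(3)[of 0] by (simp add: integral_unique)
  qed
  moreover have "ux (x + 2*pi) = ux x" for x unfolding ux_def perA ..
  ultimately have W: "integral {0..2*pi} (\<lambda>x. (ux x)\<^sup>2) \<le> integral {0..2*pi} (\<lambda>x. (uxx x)\<^sup>2)"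
    by (intro Wirtinger_mean_zero[OF dux cux(2)])
  have i: "(\<lambda>x. (ux x)\<^sup>2) integrable_on {0..2*pi}" "(\<lambda>x. (uxx x)\<^sup>2) integrable_on {0..2*pi}"
    by (intro integrable_continuous_real continuous_intros cux)+
  have "((\<lambda>x. 2 * (q-2) * ((ux x)\<^sup>2 - (uxx x)\<^sup>2)) has_integral
      2 * (q-2) * (integral {0..2*pi} (\<lambda>x. (ux x)\<^sup>2) - integral {0..2*pi} (\<lambda>x. (uxx x)\<^sup>2))) {0..2*pi}"
    using i by (intro has_integral_mult_right has_integral_diff integrable_integral)
  note RW = has_integral_le[OF integrable_integral[OF Rc] this]
  have "R x \<le> 2 * (q-2) * ((ux x)\<^sup>2 - (uxx x)\<^sup>2)" for x
    unfolding R_def Uu using q by simp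
  then have "integral {0..2*pi} R \<le> 2 * (q-2) * (integral {0..2*pi} (\<lambda>x. (ux x)\<^sup>2) - integral {0..2*pi} (\<lambda>x. (uxx x)\<^sup>2))"
    by (rule RW)
  also have "\<dots> \<le> 0" using W q by (simp add: mult_nonneg_nonpos)
  finally show ?thesis unfolding GR .
qed

text \<open>
  The integral of the energy density does not increase, and at time \<open>T\<close> it is at least
  \<open>2\<pi>(m - C exp (-T))\<^sup>2\<^sup>/\<^sup>q\<close> because \<open>H\<close> is that close to its mean \<open>m\<close>. Let \<open>T\<close> tend to infinity.
\<close>

lemma mean_power_le:
  assumes pos: "\<And>x. H 0 x > 0" and q: "q > 2"
  shows "2 * pi * m powr (2/q) \<le> integral {0..2*pi} (energy_density q 0)"
proof -
  obtain x0 where x0: "\<And>x. x \<in> {0..2*pi} \<Longrightarrow> H 0 x0 \<le> H 0 x"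
    using continuous_attains_inf[of "{0..2*pi}" "H 0"] H_cont(1) by (metis atLeastAtMost_iff compact_Icc empty_iff mult_nonneg_nonneg order_refl pi_ge_zero zero_le_numeral)
  define \<mu> where "\<mu> = H 0 x0"
  have \<mu>: "\<mu> > 0" using pos by (simp add: \<mu>_def)
  have "\<mu> \<le> H 0 x" for x
  proof -
    obtain n :: int where n: "x + of_int n * (2 * pi) \<in> {0..2*pi}" using periodic_representative by blast
    then show ?thesis using x0[OF n] periodic_int_shift[of "H 0" "2*pi", OF per] by (simp add: \<mu>_def)
  qed
  then have low: "\<mu> \<le> H t x" if "0 \<le> t" for t x using minimum_principle that by blast
  have Hpos: "H t x > 0" if "0 \<le> t" for t x using low[OF that, of x] \<mu> by linarith
  have e0: "((\<lambda>t. C * exp (- t)) \<longlongrightarrow> 0) at_top"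
    by (intro tendsto_mult_right_zero filterlim_compose[OF exp_at_bot filterlim_uminus_at_bot_at_top])
  have ev: "\<forall>\<^sub>F t in at_top. (0::real) \<le> t" by (rule eventually_ge_at_top)
  have "\<mu> \<le> m"
  proof (rule tendsto_upperbound)
    show "((\<lambda>t. \<mu> - C * exp (- t)) \<longlongrightarrow> \<mu>) at_top" using tendsto_diff[OF tendsto_const e0, of \<mu>] by simp
    show "\<forall>\<^sub>F t in at_top. \<mu> - C * exp (- t) \<le> m"
      using ev
    proof eventually_elim
      case (elim t)
      then show ?case using low[OF elim, of 0] decay[OF elim, of 0] by linarith
    qed
  qed simp
  then have m: "m > 0" using \<mu> by simp
  define F where "F t = integral {0..2*pi} (energy_density q t)" for t
  have Gc: "continuous_on {0..2*pi} (energy_density q t)" if "0 \<le> t" for t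
    unfolding energy_density_def using Hpos[OF that] q by (intro continuous_intros H_cont) (auto simp: less_imp_neq[symmetric])
  have dF: "(F has_real_derivative integral {0..2*pi} (energy_rate q t)) (at t within {0..})" if t: "0 \<le> t" for t
  proof -
    have c: "continuous_on ({0..} \<times> cbox 0 (2*pi)) (\<lambda>p. H (fst p) (snd p))"
      "continuous_on ({0..} \<times> cbox 0 (2*pi)) (\<lambda>p. H1 (fst p) (snd p))"
      "continuous_on ({0..} \<times> cbox 0 (2*pi)) (\<lambda>p. H2 (fst p) (snd p))"
      "continuous_on ({0..} \<times> cbox 0 (2*pi)) (\<lambda>p. H3 (fst p) (snd p))"
      using c0 c1 c2 c3 by (auto simp: split_def intro: continuous_on_subset)
    have ne: "\<forall>p\<in>{0..} \<times> cbox 0 (2*pi). H (fst p) (snd p) \<noteq> 0"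
      using Hpos by (force simp: less_imp_neq[symmetric])
    have "((\<lambda>t. integral (cbox 0 (2*pi)) (energy_density q t)) has_field_derivative integral (cbox 0 (2*pi)) (energy_rate q t)) (at t within {0..})"
    proof (rule leibniz_rule_field_derivative)
      show "((\<lambda>s. energy_density q s x) has_field_derivative energy_rate q s x) (at s within {0..})" if "s \<in> {0..}" for s x
        using DERIV_energy_density[OF Hpos, of s] that by (auto intro: has_field_derivative_at_within)
      show "energy_density q s integrable_on cbox 0 (2*pi)" if "s \<in> {0..}" for s
        using Gc[of s] that by (simp add: integrable_continuous_real)
      show "continuous_on ({0..} \<times> cbox 0 (2*pi)) (\<lambda>(s, x). energy_rate q s x)"
        unfolding energy_rate_def split_def using q ne by (intro continuous_intros c ballI) auto
    qed (use t in auto)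
    then show ?thesis unfolding F_def by simp
  qed
  have mono: "F T \<le> F 0" if T: "0 \<le> T" for T
  proof (rule DERIV_nonpos_imp_decreasing_open[OF T])
    fix t assume t: "0 < t" "t < T"
    have "(F has_real_derivative integral {0..2*pi} (energy_rate q t)) (at t)"
      using dF[of t] t by (simp add: at_within_interior[of t "{0..}"])
    moreover have "integral {0..2*pi} (energy_rate q t) \<le> 0"
      using t by (intro energy_rate_integral_nonpos Hpos q) auto
    ultimately show "\<exists>y. (F has_real_derivative y) (at t) \<and> y \<le> 0" by blast
  next
    have "continuous_on {0..} F"
      using dF by (auto simp: continuous_on_eq_continuous_within intro: DERIV_continuous)
    then show "continuous_on {0..T} F" by (rule continuous_on_subset) auto
  qed
  have "2 * pi * (m - C * exp (-T)) powr (2/q) \<le> F 0" if T: "0 \<le> T" "0 < m - C * exp (-T)" for T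
  proof -
    have "2 * pi * (m - C * exp (-T)) powr (2/q) = integral {0..2*pi} (\<lambda>x. (m - C * exp (-T)) powr (2/q))" by simp
    also have "\<dots> \<le> F T" unfolding F_def
    proof (rule integral_le)
      show "energy_density q T integrable_on {0..2*pi}" using Gc[OF T(1)] by (rule integrable_continuous_real)
      fix x
      have "(m - C * exp (-T)) powr (2/q) \<le> H T x powr (2/q)"
        using decay[OF T(1), of x] T q by (intro powr_mono2) auto
      also have "\<dots> \<le> energy_density q T x" unfolding energy_density_def using q
        by (simp add: mult_le_cancel_left1)
      finally show "(m - C * exp (-T)) powr (2/q) \<le> energy_density q T x" .
    qed (rule integrable_const_ivl)
    also have "\<dots> \<le> F 0" using mono[OF T(1)] .
    finally show ?thesis .
  qed
  note lowF = this
  have "2 * pi * m powr (2/q) \<le> F 0"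
  proof (rule tendsto_upperbound)
    have l: "((\<lambda>t. m - C * exp (- t)) \<longlongrightarrow> m) at_top" using tendsto_diff[OF tendsto_const e0, of m] by simp
    then show "((\<lambda>t. 2 * pi * (m - C * exp (- t)) powr (2/q)) \<longlongrightarrow> 2 * pi * m powr (2/q)) at_top"
      using m by (intro tendsto_intros) auto
    show "\<forall>\<^sub>F t in at_top. 2 * pi * (m - C * exp (- t)) powr (2/q) \<le> F 0"
      using ev order_tendstoD(1)[OF l m] by eventually_elim (rule lowF)
  qed simp
  then show ?thesis by (simp add: F_def)
qed

end

section \<open>Approximation by trigonometric polynomials\<close>

lemma trig_poly_const: "trig_poly (\<lambda>x. c)"
  using trig_poly.wave[of c 0 0] by simp

lemma trig_poly_mult:
  assumes "trig_poly f" "trig_poly g"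
  shows "trig_poly (\<lambda>x. f x * g x)"
  using assms(1)
proof induction
  case (wave c k d)
  show ?case using assms(2)
  proof induction
    case (wave c' k' d')
    have "trig_poly (\<lambda>x. (c * c' / 2) * cos (of_int (k - k') * x + (d - d')) + (c * c' / 2) * cos (of_int (k + k') * x + (d + d')))"
      by (intro trig_poly.intros)
    moreover have "(c * c' / 2) * cos (of_int (k - k') * x + (d - d')) + (c * c' / 2) * cos (of_int (k + k') * x + (d + d'))
        = c * cos (of_int k * x + d) * (c' * cos (of_int k' * x + d'))" for x
    proof -
      have "cos (of_int k * x + d) * cos (of_int k' * x + d')
        = (cos ((of_int k * x + d) - (of_int k' * x + d')) + cos ((of_int k * x + d) + (of_int k' * x + d'))) / 2"
        by (rule cos_times_cos)
      moreover have "(of_int k * x + d) - (of_int k' * x + d') = of_int (k - k') * x + (d - d')"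
        "(of_int k * x + d) + (of_int k' * x + d') = of_int (k + k') * x + (d + d')" by (simp_all add: algebra_simps)
      ultimately have "c * c' * (cos (of_int k * x + d) * cos (of_int k' * x + d'))
        = c * c' * ((cos (of_int (k - k') * x + (d - d')) + cos (of_int (k + k') * x + (d + d'))) / 2)" by simp
      then show ?thesis by (simp only: distrib_left add_divide_distrib times_divide_eq_left times_divide_eq_right mult_ac)
    qed
    ultimately show ?case by simp
  next
    case (sum f g)
    then show ?case using trig_poly.sum by (fastforce simp: distrib_left)
  qed
next
  case (sum f h)
  then show ?case using trig_poly.sum[OF sum.IH] by (simp add: distrib_right)
qed

lemma trig_poly_periodic: "trig_poly f \<Longrightarrow> f (x + 2 * pi) = f x"
  by (induction rule: trig_poly.induct) (simp_all only: cos_shift_2pi)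

text \<open>
  The constant \<open>m\<close> is the contribution of the waves of frequency \<open>0\<close>, which have no periodic
  antiderivative.
\<close>

lemma trig_poly_antiderivative:
  assumes "trig_poly f"
  shows "\<exists>m P. trig_poly P \<and> (\<forall>x. (P has_real_derivative (f x - m)) (at x))"
  using assms
proof induction
  case (wave c k d)
  show ?case
  proof (cases "k = 0")
    case True
    then have "\<forall>x. ((\<lambda>x. 0) has_real_derivative c * cos (of_int k * x + d) - c * cos d) (at x)" by simp
    then show ?thesis using trig_poly_const[of 0] by blast
  next
    case False
    have "((\<lambda>x. c / of_int k * cos (of_int k * x + (d - pi/2))) has_real_derivative c * cos (of_int k * x + d) - 0) (at x)" for x
    proof (rule DERIV_cong)
      show "((\<lambda>x. c / of_int k * cos (of_int k * x + (d - pi/2))) has_real_derivative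
          c / of_int k * (- sin (of_int k * x + (d - pi/2)) * of_int k)) (at x)"
        by (auto intro!: derivative_eq_intros)
      have "sin (of_int k * x + (d - pi/2)) = - cos (of_int k * x + d)"
        using sin_diff[of "of_int k * x + d" "pi/2"] by (simp add: algebra_simps)
      then show "c / of_int k * (- sin (of_int k * x + (d - pi/2)) * of_int k) = c * cos (of_int k * x + d) - 0"
        using False by simp
    qed
    then show ?thesis using trig_poly.wave[of "c / of_int k" k "d - pi/2"] by blast
  qed
next
  case (sum f g)
  then obtain m P n Q where "trig_poly P" "\<And>x. (P has_real_derivative (f x - m)) (at x)"
    "trig_poly Q" "\<And>x. (Q has_real_derivative (g x - n)) (at x)" by blast
  then have "trig_poly (\<lambda>x. P x + Q x)" "\<forall>x. ((\<lambda>x. P x + Q x) has_real_derivative (f x + g x - (m + n))) (at x)"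
    by (auto intro!: trig_poly.sum derivative_eq_intros)
  then show ?case by blast
qed

text \<open>
  A linear functional of \<open>cis x\<close> is a combination of \<open>cos x\<close> and \<open>sin x = cos (x - \<pi>/2)\<close>; sums and products
  preserve trigonometric polynomials.
\<close>

lemma trig_poly_of_polynomial:
  fixes p :: "complex \<Rightarrow> real"
  assumes "real_polynomial_function p"
  shows "trig_poly (\<lambda>x. p (cis x))"
  using assms
proof induction
  case (linear L)
  interpret L: bounded_linear L by fact
  have "L (cis x) = L 1 * cos (of_int 1 * x + 0) + L \<i> * cos (of_int 1 * x + (- pi/2))" for x
  proof -
    have "cis x = cos x *\<^sub>R 1 + sin x *\<^sub>R \<i>" by (simp add: complex_eq_iff)
    then have "L (cis x) = cos x * L 1 + sin x * L \<i>" by (simp only: L.add L.scaleR real_scaleR_def)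
    moreover have "cos (x + (- pi/2)) = sin x" by (simp add: cos_diff)
    ultimately show ?thesis by (simp add: mult.commute)
  qed
  then show ?case using trig_poly.sum[OF trig_poly.wave[of "L 1" 1 0] trig_poly.wave[of "L \<i>" 1 "-pi/2"]] by simp
qed (auto intro: trig_poly_const trig_poly.sum trig_poly_mult)

lemma periodic_cong_cis:
  fixes g :: "real \<Rightarrow> 'a"
  assumes per: "\<And>x. g (x + 2 * pi) = g x" and "cis a = cis b"
  shows "g a = g b"
proof -
  have "sin a = sin b \<and> cos a = cos b" using assms(2) by (simp add: complex_eq_iff)
  then obtain n :: int where "a = b + 2 * pi * n" using sin_cos_eq_iff by blast
  then show ?thesis using periodic_int_shift[of g "2*pi", OF per] by (simp add: mult.commute)
qed

text \<open>
  A periodic function is a function on the unit circle, to which the Stone-Weierstrass theorem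
  applies.
\<close>

lemma trig_poly_dense:
  fixes g :: "real \<Rightarrow> real"
  assumes g: "continuous_on UNIV g" and per: "\<And>x. g (x + 2 * pi) = g x" and e: "0 < e"
  obtains T where "trig_poly T" "\<And>x. \<bar>g x - T x\<bar> < e"
proof -
  \<comment> \<open>\<open>Arg\<close> jumps at the negative real axis, where continuity is seen from the other branch \<open>Arg2pi\<close>; by
periodicity of \<open>g\<close> the branch does not matter.\<close>
  define f where "f z = g (Arg z)" for z
  have fcis: "f z = g a" if "z = cis a" for z a
    unfolding f_def using that by (intro periodic_cong_cis[of g, OF per]) (simp add: cis_Arg)
  have "continuous_on (sphere 0 1) f"
  proof (rule continuous_at_imp_continuous_on, intro ballI)
    fix z :: complex assume z: "z \<in> sphere 0 1"
    have gc: "isCont g x" for x using g by (simp add: continuous_on_eq_continuous_at)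
    show "isCont f z"
    proof (cases "z \<in> \<real>\<^sub>\<le>\<^sub>0")
      case False
      then show ?thesis unfolding f_def by (intro continuous_intros isCont_o2[OF continuous_at_Arg gc])
    next
      case True
      moreover have "z \<noteq> 0" using z by auto
      ultimately have "z \<notin> \<real>\<^sub>\<ge>\<^sub>0"
        by (auto simp: complex_nonneg_Reals_iff complex_nonpos_Reals_iff complex_eq_iff)
      then have c: "isCont (\<lambda>z. g (Arg2pi z)) z"
        by (intro isCont_o2[OF continuous_at_Arg2pi gc])
      have "\<forall>\<^sub>F y in nhds z. f y = g (Arg2pi y)"
      proof -
        have "z \<noteq> 0" using z by auto
        then have "\<forall>\<^sub>F y in nhds z. y \<noteq> 0" by (rule t1_space_nhds)
        then show ?thesis
        proof eventually_elim
          case (elim y)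
          have "cis (Arg y) = cis (Arg2pi y)"
          proof -
            have "of_real (cmod y) * exp (\<i> * of_real (Arg y)) = of_real (cmod y) * exp (\<i> * of_real (Arg2pi y))"
              using Arg_eq[OF elim] Arg2pi_eq[of y] by simp
            then show ?thesis using elim by (simp add: cis_conv_exp)
          qed
          then show ?case unfolding f_def by (intro periodic_cong_cis[of g, OF per])
        qed
      qed
      then show ?thesis using c isCont_cong[of f "\<lambda>z. g (Arg2pi z)" z] by simp
    qed
  qed
  then obtain p where p: "real_polynomial_function p" "\<And>z. z \<in> sphere 0 1 \<Longrightarrow> \<bar>f z - p z\<bar> < e"
    using Stone_Weierstrass_real_polynomial_function[of "sphere 0 1 :: complex set" f e] e compact_sphere by blast
  have "\<bar>g x - p (cis x)\<bar> < e" for x using p(2)[of "cis x"] fcis[of "cis x" x] by simp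
  then show ?thesis using that trig_poly_of_polynomial[OF p(1)] by blast
qed

text \<open>
  Approximate the derivative, remove from the approximation its mean, which is small because \<open>\<rho>'\<close> has mean
  zero, and take the antiderivative that agrees with \<open>\<rho>\<close> at \<open>0\<close>.
\<close>

lemma trig_poly_dense_C1:
  fixes \<rho> \<rho>' :: "real \<Rightarrow> real"
  assumes \<rho>: "\<And>x. (\<rho> has_real_derivative \<rho>' x) (at x)" and \<rho>': "continuous_on UNIV \<rho>'"
    and per: "\<And>x. \<rho> (x + 2 * pi) = \<rho> x" and e: "0 < e"
  obtains P P' where "trig_poly P" "\<And>x. (P has_real_derivative P' x) (at x)" "continuous_on UNIV P'"
    "\<And>x. x \<in> {0..2*pi} \<Longrightarrow> \<bar>P x - \<rho> x\<bar> < e" "\<And>x. \<bar>P' x - \<rho>' x\<bar> < e"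
proof -
  have per': "\<rho>' (x + 2*pi) = \<rho>' x" for x using DERIV_shift_unique[OF \<rho>, of "2*pi" 1] per by simp
  obtain T where T: "trig_poly T" "\<And>x. \<bar>\<rho>' x - T x\<bar> < e / 20"
    using trig_poly_dense[OF \<rho>' per', of "e/20"] e by auto
  obtain m P0 where P0: "trig_poly P0" "\<And>x. (P0 has_real_derivative (T x - m)) (at x)"
    using trig_poly_antiderivative[OF T(1)] by blast
  define D where "D x = P0 x - \<rho> x" for x
  have dD: "(D has_real_derivative (T x - m - \<rho>' x)) (at x)" for x
    unfolding D_def by (intro DERIV_diff P0 \<rho>)
  have "D (2*pi) = D 0" using trig_poly_periodic[OF P0(1), of 0] per[of 0] by (simp add: D_def)
  then obtain z where "T z - m - \<rho>' z = 0"
    using MVT2[of 0 "2*pi" D "\<lambda>x. T x - m - \<rho>' x"] dD by auto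
  then have m: "\<bar>m\<bar> < e / 20" using T(2)[of z] by linarith
  have b: "\<bar>T x - m - \<rho>' x\<bar> < e / 10" for x using m T(2)[of x] by linarith
  have Dd: "\<bar>D x - D 0\<bar> < e" if x: "x \<in> {0..2*pi}" for x
  proof (cases "x = 0")
    case True
    then show ?thesis using e by simp
  next
    case False
    then have "0 < x" using x by simp
    then obtain z where "D x - D 0 = (x - 0) * (T z - m - \<rho>' z)"
      using MVT2[of 0 x D "\<lambda>x. T x - m - \<rho>' x"] dD by blast
    then have "\<bar>D x - D 0\<bar> = x * \<bar>T z - m - \<rho>' z\<bar>" using \<open>0 < x\<close> by (simp add: abs_mult)
    also have "\<dots> \<le> 8 * (e / 10)"
      using x b[of z] e pi_less_4 by (intro mult_mono) auto
    also have "\<dots> < e" using e by simp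
    finally show ?thesis .
  qed
  have Tc: "continuous_on UNIV T"
    using trig_poly_heat_evolution[OF T(1)] heat_evolution.H_cont(1) by metis
  show ?thesis
  proof (rule that[of "\<lambda>x. P0 x + (- D 0)" "\<lambda>x. T x - m"])
    show "trig_poly (\<lambda>x. P0 x + (- D 0))" by (intro trig_poly.sum P0 trig_poly_const)
    show "((\<lambda>x. P0 x + (- D 0)) has_real_derivative T x - m) (at x)" for x
      using DERIV_add[OF P0(2)[of x] DERIV_const[of "- D 0"]] by simp
    show "continuous_on UNIV (\<lambda>x. T x - m)" by (intro continuous_intros Tc)
    show "\<bar>P0 x + (- D 0) - \<rho> x\<bar> < e" if "x \<in> {0..2*pi}" for x using Dd[OF that] by (simp add: D_def)
    show "\<bar>T x - m - \<rho>' x\<bar> < e" for x using b[of x] e by simp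
  qed
qed

section \<open>Beckner's inequality on the circle\<close>

text \<open>
  The inequality is \<open>mean_power_le\<close> at time \<open>0\<close> for \<open>\<rho> = u\<^sup>q\<close>, expressed through \<open>\<rho>\<close> and \<open>\<rho>'\<close> by the function \<open>\<Phi>\<close>. It
  passes to the limit from trigonometric polynomials \<open>P n\<close> by dominated convergence: they stay above
  half the minimum of \<open>\<rho>\<close>, so \<open>P n\<close>, \<open>P' n\<close> and \<open>1 / P n\<close> are bounded.
\<close>

lemma Beckner_inequality:
  fixes u u' :: "real \<Rightarrow> real"
  assumes u: "\<And>x. (u has_real_derivative u' x) (at x)" and u': "continuous_on UNIV u'"
    and per: "\<And>x. u (x + 2 * pi) = u x" and pos: "\<And>x. u x > 0" and q: "2 < q"
  shows "2 * pi * (integral {0..2*pi} (\<lambda>x. u x powr q) / (2 * pi)) powr (2/q)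
    \<le> (q - 2) * integral {0..2*pi} (\<lambda>x. (u' x)\<^sup>2) + integral {0..2*pi} (\<lambda>x. (u x)\<^sup>2)"
proof -
  define \<rho> where "\<rho> x = u x powr q" for x
  define \<rho>' where "\<rho>' x = u x powr q * (q * (u' x / u x))" for x
  define \<Phi> where "\<Phi> a b = a powr (2/q) * ((q - 2) / q\<^sup>2 * (b / a)\<^sup>2 + 1)" for a b
  have une: "u x \<noteq> 0" for x using pos[of x] by simp
  have uc: "continuous_on A u" for A using u by (meson DERIV_isCont continuous_at_imp_continuous_on)
  have \<rho>: "(\<rho> has_real_derivative \<rho>' x) (at x)" for x
    unfolding \<rho>_def \<rho>'_def by (rule DERIV_powr_const[OF u pos])
  have \<rho>c: "continuous_on A \<rho>" for A using \<rho> by (meson DERIV_isCont continuous_at_imp_continuous_on)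
  have \<rho>'c: "continuous_on A \<rho>'" for A
    unfolding \<rho>'_def by (intro continuous_intros uc continuous_on_subset[OF u']) (simp_all add: une)
  have \<rho>per: "\<rho> (x + 2*pi) = \<rho> x" for x by (simp add: \<rho>_def per)
  have \<rho>pos: "\<rho> x > 0" for x by (simp add: \<rho>_def une)
  have I: "compact {0..2*pi}" "{0..2*pi} \<noteq> {}" by auto
  obtain x0 where x0: "\<And>x. x \<in> {0..2*pi} \<Longrightarrow> \<rho> x0 \<le> \<rho> x"
    using continuous_attains_inf[OF I \<rho>c] by blast
  define \<mu> where "\<mu> = \<rho> x0"
  have \<mu>: "\<mu> > 0" "\<And>x. x \<in> {0..2*pi} \<Longrightarrow> \<mu> \<le> \<rho> x" using \<rho>pos x0 by (auto simp: \<mu>_def)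
  obtain x1 where x1: "\<And>x. x \<in> {0..2*pi} \<Longrightarrow> \<rho> x \<le> \<rho> x1"
    using continuous_attains_sup[OF I \<rho>c] by blast
  have "continuous_on {0..2*pi} (\<lambda>x. \<bar>\<rho>' x\<bar>)" by (intro continuous_intros \<rho>'c)
  then obtain x2 where x2: "\<And>x. x \<in> {0..2*pi} \<Longrightarrow> \<bar>\<rho>' x\<bar> \<le> \<bar>\<rho>' x2\<bar>"
    using continuous_attains_sup[OF I] by blast
  define e where "e n = \<mu> / 2 * inverse (real (Suc n))" for n
  have e: "e n > 0" "e n \<le> \<mu> / 2" for n
  proof -
    show "e n > 0" unfolding e_def using \<mu>(1) by simp
    have "inverse (real (Suc n)) \<le> 1" by (simp add: inverse_le_1_iff)
    then have "e n \<le> \<mu> / 2 * 1" unfolding e_def using \<mu>(1) by (intro mult_left_mono) simp_all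
    then show "e n \<le> \<mu> / 2" by simp
  qed
  have e0: "e \<longlonglongrightarrow> 0"
    unfolding e_def by (rule tendsto_mult_right_zero[OF LIMSEQ_inverse_real_of_nat])
  have "\<exists>P P'. trig_poly P \<and> (\<forall>x. (P has_real_derivative P' x) (at x)) \<and> continuous_on UNIV P' \<and>
      (\<forall>x\<in>{0..2*pi}. \<bar>P x - \<rho> x\<bar> < e n) \<and> (\<forall>x. \<bar>P' x - \<rho>' x\<bar> < e n)" for n
    using trig_poly_dense_C1[OF \<rho> \<rho>'c \<rho>per e(1)[of n]] by metis
  then obtain P P' where P: "\<And>n. trig_poly (P n)" "\<And>n x. (P n has_real_derivative P' n x) (at x)"
    "\<And>n. continuous_on UNIV (P' n)" "\<And>n x. x \<in> {0..2*pi} \<Longrightarrow> \<bar>P n x - \<rho> x\<bar> < e n"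
    "\<And>n x. \<bar>P' n x - \<rho>' x\<bar> < e n" by metis
  have Ppos: "\<mu> / 2 \<le> P n x" if "x \<in> {0..2*pi}" for n x
    using P(4)[OF that, of n] \<mu>(2)[OF that] e(2)[of n] by linarith
  have Ppos': "0 < P n x" for n x
  proof -
    obtain k :: int where k: "x + of_int k * (2 * pi) \<in> {0..2*pi}" using periodic_representative by blast
    then show ?thesis using Ppos[OF k, of n] \<mu>(1) periodic_int_shift[of "P n" "2*pi", OF trig_poly_periodic[OF P(1)]] by simp
  qed
  have Pne: "P n x \<noteq> 0" for n x using Ppos'[of n x] by simp
  have Pc: "continuous_on A (P n)" for A n using P(2) by (meson DERIV_isCont continuous_at_imp_continuous_on)
  have ineq: "2 * pi * (integral {0..2*pi} (P n) / (2*pi)) powr (2/q) \<le> integral {0..2*pi} (\<lambda>x. \<Phi> (P n x) (P' n x))" for n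
  proof -
    obtain H H1 H2 H3 m C where h: "heat_evolution H H1 H2 H3 m C" and H0: "H 0 = P n"
      using trig_poly_heat_evolution[OF P(1)[of n]] by blast
    interpret heat_evolution H H1 H2 H3 m C by (rule h)
    have H1: "H1 0 x = P' n x" for x using dx[of 0 x] P(2)[of n x] unfolding H0 by (rule DERIV_unique)
    have m: "integral {0..2*pi} (P n) = 2 * pi * m" using mean unfolding H0 by (rule integral_unique)
    have "2 * pi * m powr (2/q) \<le> integral {0..2*pi} (energy_density q 0)"
      using Ppos' by (intro mean_power_le q) (simp add: H0)
    moreover have "energy_density q 0 = (\<lambda>x. \<Phi> (P n x) (P' n x))" by (auto simp: energy_density_def \<Phi>_def H0 H1)
    ultimately show ?thesis by (simp add: m)
  qed
  have pw: "(\<lambda>n. P n x) \<longlonglongrightarrow> \<rho> x" if x: "x \<in> {0..2*pi}" for x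
  proof (rule LIM_zero_cancel, rule Lim_null_comparison[OF _ e0])
    show "\<forall>\<^sub>F n in sequentially. norm (P n x - \<rho> x) \<le> e n"
      using P(4)[OF x] by (intro always_eventually allI) (simp add: less_imp_le)
  qed
  have pw': "(\<lambda>n. P' n x) \<longlonglongrightarrow> \<rho>' x" for x
  proof (rule LIM_zero_cancel, rule Lim_null_comparison[OF _ e0])
    show "\<forall>\<^sub>F n in sequentially. norm (P' n x - \<rho>' x) \<le> e n"
      using P(5) by (intro always_eventually allI) (simp add: less_imp_le)
  qed
  define M M' where "M = \<rho> x1 + \<mu>" and "M' = \<bar>\<rho>' x2\<bar> + \<mu>"
  have M: "P n x \<le> M" if "x \<in> {0..2*pi}" for n x
    using P(4)[OF that, of n] x1[OF that] e(2)[of n] \<mu>(1) unfolding M_def by linarith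
  have M': "\<bar>P' n x\<bar> \<le> M'" if "x \<in> {0..2*pi}" for n x
    using P(5)[of n x] x2[OF that] e(2)[of n] \<mu>(1) unfolding M'_def by linarith
  have lim1: "(\<lambda>n. integral {0..2*pi} (P n)) \<longlonglongrightarrow> integral {0..2*pi} \<rho>"
  proof (rule dominated_convergence(2))
    show "P n integrable_on {0..2*pi}" for n by (intro integrable_continuous_real Pc)
    show "(\<lambda>x. M) integrable_on {0..2*pi}" by (rule integrable_const_ivl)
    show "norm (P n x) \<le> M" if "x \<in> {0..2*pi}" for n x
      using M[OF that, of n] Ppos'[of n x] by simp
  qed (rule pw)
  have lim2: "(\<lambda>n. integral {0..2*pi} (\<lambda>x. \<Phi> (P n x) (P' n x))) \<longlonglongrightarrow> integral {0..2*pi} (\<lambda>x. \<Phi> (\<rho> x) (\<rho>' x))"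
  proof (rule dominated_convergence(2))
    show "(\<lambda>x. \<Phi> (P n x) (P' n x)) integrable_on {0..2*pi}" for n
      unfolding \<Phi>_def using q Ppos' Pne
      by (intro integrable_continuous_real continuous_intros Pc continuous_on_subset[OF P(3)]) auto
    show "(\<lambda>x. M powr (2/q) * ((q - 2) / q\<^sup>2 * (M' / (\<mu> / 2))\<^sup>2 + 1)) integrable_on {0..2*pi}"
      by (rule integrable_const_ivl)
    show "norm (\<Phi> (P n x) (P' n x)) \<le> M powr (2/q) * ((q - 2) / q\<^sup>2 * (M' / (\<mu> / 2))\<^sup>2 + 1)"
      if x: "x \<in> {0..2*pi}" for n x
    proof -
      have "\<bar>P' n x / P n x\<bar> \<le> M' / (\<mu> / 2)"
        unfolding abs_divide using M'[OF x, of n] Ppos[OF x, of n] \<mu>(1) by (intro frac_le) auto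
      then have "(P' n x / P n x)\<^sup>2 \<le> (M' / (\<mu> / 2))\<^sup>2" by (metis abs_ge_zero power2_abs power_mono)
      moreover have "P n x powr (2/q) \<le> M powr (2/q)"
        using M[OF x, of n] Ppos'[of n x] q by (intro powr_mono2) auto
      ultimately have "\<Phi> (P n x) (P' n x) \<le> M powr (2/q) * ((q - 2) / q\<^sup>2 * (M' / (\<mu> / 2))\<^sup>2 + 1)"
        unfolding \<Phi>_def using q by (intro mult_mono add_mono mult_left_mono) auto
      moreover have "0 \<le> \<Phi> (P n x) (P' n x)" unfolding \<Phi>_def using q by simp
      ultimately show ?thesis by simp
    qed
    show "(\<lambda>n. \<Phi> (P n x) (P' n x)) \<longlonglongrightarrow> \<Phi> (\<rho> x) (\<rho>' x)" if x: "x \<in> {0..2*pi}" for x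
      unfolding \<Phi>_def using \<rho>pos[of x] q by (intro tendsto_intros pw[OF x] pw') auto
  qed
  have Ipos: "0 < integral {0..2*pi} \<rho>"
  proof -
    have "0 < integral {0..2*pi} (\<lambda>x. \<mu>)" using \<mu>(1) by simp
    also have "\<dots> \<le> integral {0..2*pi} \<rho>"
      by (rule integral_le[OF integrable_const_ivl integrable_continuous_real[OF \<rho>c] \<mu>(2)])
    finally show ?thesis .
  qed
  have "2 * pi * (integral {0..2*pi} \<rho> / (2*pi)) powr (2/q) \<le> integral {0..2*pi} (\<lambda>x. \<Phi> (\<rho> x) (\<rho>' x))"
  proof (rule LIMSEQ_le[OF _ lim2])
    show "(\<lambda>n. 2 * pi * (integral {0..2*pi} (P n) / (2*pi)) powr (2/q)) \<longlonglongrightarrow> 2 * pi * (integral {0..2*pi} \<rho> / (2*pi)) powr (2/q)"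
      using Ipos by (intro tendsto_intros lim1) auto
  qed (use ineq in blast)
  also have "(\<lambda>x. \<Phi> (\<rho> x) (\<rho>' x)) = (\<lambda>x. (q - 2) * (u' x)\<^sup>2 + (u x)\<^sup>2)"
  proof
    fix x
    have a: "\<rho> x powr (2/q) = (u x)\<^sup>2"
      using pos[of x] q by (simp add: \<rho>_def powr_powr)
    have b: "\<rho>' x / \<rho> x = q * (u' x / u x)" using pos[of x] by (simp add: \<rho>_def \<rho>'_def)
    show "\<Phi> (\<rho> x) (\<rho>' x) = (q - 2) * (u' x)\<^sup>2 + (u x)\<^sup>2"
      unfolding \<Phi>_def a b using pos[of x] q by (simp add: field_simps power2_eq_square)
  qed
  also have "integral {0..2*pi} \<dots> = (q - 2) * integral {0..2*pi} (\<lambda>x. (u' x)\<^sup>2) + integral {0..2*pi} (\<lambda>x. (u x)\<^sup>2)"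
  proof -
    have i: "(\<lambda>x. (u' x)\<^sup>2) integrable_on {0..2*pi}" "(\<lambda>x. (u x)\<^sup>2) integrable_on {0..2*pi}"
      by (intro integrable_continuous_real continuous_intros uc continuous_on_subset[OF u']; simp)+
    show ?thesis
      using has_integral_add[OF has_integral_mult_right[OF integrable_integral[OF i(1)]] integrable_integral[OF i(2)]]
      by (rule integral_unique)
  qed
  finally show ?thesis unfolding \<rho>_def .
qed

section \<open>The energy inequality for continuously differentiable functions\<close>

text \<open>
  The sum of \<open>4\<alpha>\<^sup>2\<close> times the inverse-square inequality and \<open>\<alpha>\<^sup>2\<close> times Beckner's inequality; the condition
  \<open>(q + 2)\<alpha>\<^sup>2 \<le> 1\<close> bounds the resulting coefficient of the integral of \<open>r'\<^sup>2\<close>.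
\<close>

lemma reduced_energy_bound_C1:
  fixes r r' :: "real \<Rightarrow> real"
  assumes r: "\<And>x. (r has_real_derivative r' x) (at x)" and r': "continuous_on UNIV r'"
    and per: "\<And>x. r (x + 2 * pi) = r x" and pos: "\<And>x. r x > 0" and q: "2 < q" and \<alpha>: "(q + 2) * \<alpha>\<^sup>2 \<le> 1"
  shows "\<alpha>\<^sup>2 * (2 * pi * (integral {0..2*pi} (\<lambda>x. r x powr q) / (2 * pi)) powr (2/q))
    \<le> integral {0..2*pi} (\<lambda>x. (r' x)\<^sup>2) + (2 * pi * \<alpha>)\<^sup>2 / integral {0..2*pi} (\<lambda>x. 1 / (r x)\<^sup>2)"
proof -
  define K where "K = 2 * pi * (integral {0..2*pi} (\<lambda>x. r x powr q) / (2 * pi)) powr (2/q)"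
  define I1 I2 S where "I1 = integral {0..2*pi} (\<lambda>x. (r' x)\<^sup>2)" and "I2 = integral {0..2*pi} (\<lambda>x. (r x)\<^sup>2)"
    and "S = integral {0..2*pi} (\<lambda>x. 1 / (r x)\<^sup>2)"
  have B: "K \<le> (q - 2) * I1 + I2" unfolding K_def I1_def I2_def
    by (rule Beckner_inequality[OF r r' per pos q])
  have E: "1/4 * I2 \<le> I1 + pi\<^sup>2 / S" unfolding I1_def I2_def S_def
    by (rule inverse_square_inequality[OF r r' per pos])
  have I1: "I1 \<ge> 0" unfolding I1_def
    by (intro integral_nonneg integrable_continuous_real continuous_intros continuous_on_subset[OF r']) auto
  have "\<alpha>\<^sup>2 * K \<le> \<alpha>\<^sup>2 * ((q - 2) * I1 + I2)" using B by (intro mult_left_mono) auto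
  also have "\<dots> = ((q + 2) * \<alpha>\<^sup>2) * I1 - 4 * \<alpha>\<^sup>2 * I1 + 4 * \<alpha>\<^sup>2 * (1/4 * I2)" by (simp add: algebra_simps)
  also have "\<dots> \<le> 1 * I1 - 4 * \<alpha>\<^sup>2 * I1 + 4 * \<alpha>\<^sup>2 * (I1 + pi\<^sup>2 / S)"
    using E I1 \<alpha> by (intro add_mono diff_mono mult_right_mono mult_left_mono) auto
  also have "\<dots> = I1 + (2 * pi * \<alpha>)\<^sup>2 / S" by (simp add: algebra_simps power2_eq_square)
  finally show ?thesis unfolding K_def I1_def S_def .
qed

text \<open>
  This is the Cauchy-Schwarz inequality for \<open>r\<theta>\<close> and \<open>1/r\<close>: integrate \<open>(r\<theta> - k/r)\<^sup>2 \<ge> 0\<close> for the optimal constant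
  \<open>k\<close>. Here \<open>\<theta>\<close> is the derivative of a phase and \<open>c\<close> the increment of the phase.
\<close>

lemma phase_energy_bound:
  fixes r \<theta> :: "real \<Rightarrow> real"
  assumes rc: "continuous_on UNIV r" and pos: "\<And>x. r x > 0"
    and \<theta>: "(\<theta> has_integral c) {0..2*pi}" and e: "(\<lambda>x. (r x)\<^sup>2 * (\<theta> x)\<^sup>2) integrable_on {0..2*pi}"
  shows "c\<^sup>2 / integral {0..2*pi} (\<lambda>x. 1 / (r x)\<^sup>2) \<le> integral {0..2*pi} (\<lambda>x. (r x)\<^sup>2 * (\<theta> x)\<^sup>2)"
proof -
  define S where "S = integral {0..2*pi} (\<lambda>x. 1 / (r x)\<^sup>2)"
  define k where "k = c / S"
  have S: "S > 0" unfolding S_def by (rule inverse_square_integral_pos[OF rc pos])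
  have "((\<lambda>x. (r x)\<^sup>2 * (\<theta> x)\<^sup>2 - 2 * k * \<theta> x + k\<^sup>2 * (1 / (r x)\<^sup>2)) has_integral
     (integral {0..2*pi} (\<lambda>x. (r x)\<^sup>2 * (\<theta> x)\<^sup>2) - 2 * k * c + k\<^sup>2 * S)) {0..2*pi}"
    unfolding S_def
    by (intro has_integral_add has_integral_diff has_integral_mult_right integrable_integral \<theta> e inverse_square_integrable[OF rc pos])
  moreover have "0 \<le> (r x)\<^sup>2 * (\<theta> x)\<^sup>2 - 2 * k * \<theta> x + k\<^sup>2 * (1 / (r x)\<^sup>2)" for x
  proof -
    have "(r x)\<^sup>2 * (\<theta> x)\<^sup>2 - 2 * k * \<theta> x + k\<^sup>2 * (1 / (r x)\<^sup>2) = (r x * \<theta> x - k / r x)\<^sup>2"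
      using pos[of x] by (simp add: power2_eq_square field_simps)
    then show ?thesis by simp
  qed
  ultimately have "0 \<le> integral {0..2*pi} (\<lambda>x. (r x)\<^sup>2 * (\<theta> x)\<^sup>2) - 2 * k * c + k\<^sup>2 * S"
    by (rule has_integral_nonneg)
  moreover have "2 * k * c - k\<^sup>2 * S = c\<^sup>2 / S" using S by (simp add: k_def power2_eq_square field_simps)
  ultimately show ?thesis unfolding S_def by linarith
qed


text \<open>
  The square of the \<open>L\<^sub>q\<close> norm for the normalized measure \<open>dx/2\<pi>\<close>, times \<open>2\<pi>\<close>: for a constant function \<open>r\<close> it
  is \<open>2\<pi>r\<^sup>2\<close>, the square of the \<open>L\<^sub>2\<close> norm.
\<close>

definition Lq_square :: "real \<Rightarrow> (real \<Rightarrow> real) \<Rightarrow> real" where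
  "Lq_square q r = 2 * pi * (integral {0..2*pi} (\<lambda>x. r x powr q) / (2 * pi)) powr (2/q)"

lemma Lq_square_tendsto:
  assumes c: "\<And>n. continuous_on {0..2*pi} (f n)" and nonneg: "\<And>n x. 0 \<le> f n x"
    and le: "\<And>n x. x \<in> {0..2*pi} \<Longrightarrow> f n x \<le> M" and lim: "\<And>x. (\<lambda>n. f n x) \<longlonglongrightarrow> g x"
    and q: "0 < q"
  shows "(\<lambda>n. Lq_square q (f n)) \<longlonglongrightarrow> Lq_square q g"
proof -
  have i: "(\<lambda>x. f n x powr q) integrable_on {0..2*pi}" for n
  proof (rule integrable_continuous_real, rule continuous_on_powr')
    show "\<forall>x\<in>{0..2*pi}. 0 \<le> f n x \<and> (f n x = 0 \<longrightarrow> 0 < q)" using nonneg q by simp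
  qed (intro c continuous_intros)+
  have "(\<lambda>n. integral {0..2*pi} (\<lambda>x. f n x powr q)) \<longlonglongrightarrow> integral {0..2*pi} (\<lambda>x. g x powr q)"
  proof (rule dominated_convergence(2)[OF i integrable_const_ivl[of "M powr q"]])
    show "norm (f n x powr q) \<le> M powr q" if "x \<in> {0..2*pi}" for n x
      using le[OF that, of n] nonneg[of n x] q by (simp add: powr_mono2)
    show "(\<lambda>n. f n x powr q) \<longlonglongrightarrow> g x powr q" for x
      using nonneg q by (intro tendsto_powr'[OF lim tendsto_const]) auto
  qed
  then have "(\<lambda>n. integral {0..2*pi} (\<lambda>x. f n x powr q) / (2*pi)) \<longlonglongrightarrow> integral {0..2*pi} (\<lambda>x. g x powr q) / (2*pi)"
    by (intro tendsto_intros) auto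
  moreover have "0 \<le> integral {0..2*pi} (\<lambda>x. f n x powr q) / (2*pi)" for n
    by (intro divide_nonneg_pos integral_nonneg i) auto
  ultimately show ?thesis
    unfolding Lq_square_def using q by (intro tendsto_mult_left tendsto_powr'[OF _ tendsto_const]) auto
qed


text \<open>
  The pair \<open>(p, s)\<close> stands for \<open>u = p + is\<close>. In polar coordinates the energy density is
  \<open>r'\<^sup>2 + r\<^sup>2(\<omega> + \<alpha>)\<^sup>2\<close>, where \<open>\<omega> = (ps' - sp')/r\<^sup>2\<close> is the derivative of the argument of \<open>u\<close>. The
  increment of the argument over a period is a multiple of \<open>2\<pi>\<close>, so \<open>\<omega> + \<alpha>\<close> has integral \<open>2\<pi>(n + \<alpha>)\<close>.
\<close>

lemma energy_bound_nonvanishing: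
  fixes p s p' s' :: "real \<Rightarrow> real"
  assumes p: "\<And>x. (p has_real_derivative p' x) (at x)" and s: "\<And>x. (s has_real_derivative s' x) (at x)"
    and c: "continuous_on UNIV p'" "continuous_on UNIV s'"
    and per: "\<And>x. p (x + 2 * pi) = p x" "\<And>x. s (x + 2 * pi) = s x"
    and nz: "\<And>x. p x \<noteq> 0 \<or> s x \<noteq> 0"
    and q: "2 < q" and \<alpha>: "\<bar>\<alpha>\<bar> \<le> 1/2" "(q + 2) * \<alpha>\<^sup>2 \<le> 1"
  shows "\<alpha>\<^sup>2 * Lq_square q (\<lambda>x. sqrt ((p x)\<^sup>2 + (s x)\<^sup>2))
    \<le> integral {0..2*pi} (\<lambda>x. (p' x - \<alpha> * s x)\<^sup>2 + (s' x + \<alpha> * p x)\<^sup>2)"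
proof -
  define r where "r x = sqrt ((p x)\<^sup>2 + (s x)\<^sup>2)" for x
  define r' where "r' x = (p x * p' x + s x * s' x) / r x" for x
  define \<omega> where "\<omega> x = (p x * s' x - s x * p' x) / (r x)\<^sup>2" for x
  have r2: "(r x)\<^sup>2 = (p x)\<^sup>2 + (s x)\<^sup>2" for x unfolding r_def by simp
  have r2p: "0 < (p x)\<^sup>2 + (s x)\<^sup>2" for x using nz[of x] by (simp add: sum_power2_gt_zero_iff)
  have rpos: "r x > 0" for x unfolding r_def using r2p by simp
  have rne: "r x \<noteq> 0" for x using rpos[of x] by simp
  have pc: "continuous_on A p" "continuous_on A s" for A
    using p s by (meson DERIV_isCont continuous_at_imp_continuous_on)+
  have pc': "continuous_on A p'" "continuous_on A s'" for A using c continuous_on_subset by blast+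
  have dr: "(r has_real_derivative r' x) (at x)" for x
  proof -
    have "(r has_real_derivative (inverse (sqrt ((p x)\<^sup>2 + (s x)\<^sup>2)) / 2 * (2 * p x * p' x + 2 * s x * s' x))) (at x)"
    proof -
      have D: "((\<lambda>x. (p x)\<^sup>2 + (s x)\<^sup>2) has_real_derivative 2 * p x * p' x + 2 * s x * s' x) (at x)"
        by (auto intro!: derivative_eq_intros p s)
      show ?thesis unfolding r_def by (rule DERIV_chain2[OF DERIV_real_sqrt[OF r2p] D])
    qed
    moreover have "inverse (sqrt ((p x)\<^sup>2 + (s x)\<^sup>2)) / 2 * (2 * p x * p' x + 2 * s x * s' x) = r' x"
      unfolding r'_def r_def[symmetric] using rne[of x] by (simp add: field_simps)
    ultimately show ?thesis by simp
  qed
  have rc: "continuous_on A r" for A using dr by (meson DERIV_isCont continuous_at_imp_continuous_on)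
  have rc': "continuous_on A r'" for A unfolding r'_def using rne by (intro continuous_intros pc pc' rc) auto
  have \<omega>c: "continuous_on A \<omega>" for A unfolding \<omega>_def using rne by (intro continuous_intros pc pc' rc) auto
  have rper: "r (x + 2*pi) = r x" for x unfolding r_def per ..
  obtain \<Theta> where \<Theta>: "\<And>x. (\<Theta> has_real_derivative \<omega> x) (at x)"
    using continuous_has_antiderivative[OF \<omega>c] by blast
  define X Y where "X x = p x / r x" and "Y x = s x / r x" for x
  have XY: "(X x)\<^sup>2 + (Y x)\<^sup>2 = 1" for x
  proof -
    have "(p x)\<^sup>2 + (s x)\<^sup>2 \<noteq> 0" using r2p[of x] by linarith
    then show ?thesis unfolding X_def Y_def power_divide r2 add_divide_distrib[symmetric] by (rule divide_self)
  qed
  have dX: "(X has_real_derivative - Y x * \<omega> x) (at x)" for x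
  proof -
    have "(X has_real_derivative (p' x * r x - p x * r' x) / (r x * r x)) (at x)"
      unfolding X_def by (rule DERIV_divide[OF p dr rne])
    moreover have "(p' x * r x - p x * r' x) / (r x * r x) = (p' x * (r x)\<^sup>2 - p x * (p x * p' x + s x * s' x)) / (r x)^3"
      unfolding r'_def using rne[of x] by (simp add: field_simps power2_eq_square power3_eq_cube)
    moreover have "p' x * (r x)\<^sup>2 - p x * (p x * p' x + s x * s' x) = - s x * (p x * s' x - s x * p' x)"
      unfolding r2 by (simp add: power2_eq_square algebra_simps)
    moreover have "- Y x * \<omega> x = - s x * (p x * s' x - s x * p' x) / (r x)^3"
      unfolding Y_def \<omega>_def by (simp add: power2_eq_square power3_eq_cube)
    ultimately show ?thesis by simp
  qed
  have dY: "(Y has_real_derivative X x * \<omega> x) (at x)" for x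
  proof -
    have "(Y has_real_derivative (s' x * r x - s x * r' x) / (r x * r x)) (at x)"
      unfolding Y_def by (rule DERIV_divide[OF s dr rne])
    moreover have "(s' x * r x - s x * r' x) / (r x * r x) = (s' x * (r x)\<^sup>2 - s x * (p x * p' x + s x * s' x)) / (r x)^3"
      unfolding r'_def using rne[of x] by (simp add: field_simps power2_eq_square power3_eq_cube)
    moreover have "s' x * (r x)\<^sup>2 - s x * (p x * p' x + s x * s' x) = p x * (p x * s' x - s x * p' x)"
      unfolding r2 by (simp add: power2_eq_square algebra_simps)
    moreover have "X x * \<omega> x = p x * (p x * s' x - s x * p' x) / (r x)^3"
      unfolding X_def \<omega>_def by (simp add: power2_eq_square power3_eq_cube)
    ultimately show ?thesis by simp
  qed
  \<comment> \<open>Turning \<open>u/|u| = X + iY\<close> back by the angle \<open>\<Theta>\<close> gives the constant \<open>C + iD\<close>. Hence \<open>\<Theta>\<close> is determined modulo \<open>2\<pi>\<close>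
by the periodic functions \<open>X\<close> and \<open>Y\<close>.\<close>
  define C D where "C x = X x * cos (\<Theta> x) + Y x * sin (\<Theta> x)" and "D x = Y x * cos (\<Theta> x) - X x * sin (\<Theta> x)" for x
  have "(C has_real_derivative 0) (at x)" "(D has_real_derivative 0) (at x)" for x
    unfolding C_def D_def by (auto intro!: derivative_eq_intros dX dY \<Theta> simp: algebra_simps)
  then have CD: "C (2*pi) = C 0" "D (2*pi) = D 0" using DERIV_isconst_all by blast+
  have XY0: "X (2*pi) = X 0" "Y (2*pi) = Y 0" using per[of 0] rper[of 0] unfolding X_def Y_def by simp_all
  have cs: "cos (\<Theta> x) = C x * X x + D x * Y x" "sin (\<Theta> x) = C x * Y x - D x * X x" for x
  proof -
    have "C x * X x + D x * Y x = cos (\<Theta> x) * ((X x)\<^sup>2 + (Y x)\<^sup>2)" "C x * Y x - D x * X x = sin (\<Theta> x) * ((X x)\<^sup>2 + (Y x)\<^sup>2)"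
      unfolding C_def D_def by (simp_all add: power2_eq_square algebra_simps)
    then show "cos (\<Theta> x) = C x * X x + D x * Y x" "sin (\<Theta> x) = C x * Y x - D x * X x" by (simp_all add: XY)
  qed
  have "sin (\<Theta> (2*pi)) = sin (\<Theta> 0) \<and> cos (\<Theta> (2*pi)) = cos (\<Theta> 0)" unfolding cs CD XY0 by simp
  then obtain n :: int where n: "\<Theta> (2*pi) = \<Theta> 0 + 2 * pi * n" using sin_cos_eq_iff by blast
  have "((\<lambda>x. \<omega> x + \<alpha>) has_integral ((\<Theta> (2*pi) + \<alpha> * (2*pi)) - (\<Theta> 0 + \<alpha> * 0))) {0..2*pi}"
    by (rule has_integral_of_derivative) (auto intro!: derivative_eq_intros \<Theta>)
  then have I\<theta>: "((\<lambda>x. \<omega> x + \<alpha>) has_integral 2 * pi * (n + \<alpha>)) {0..2*pi}"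
    unfolding n by (simp add: algebra_simps)
  define S where "S = integral {0..2*pi} (\<lambda>x. 1 / (r x)\<^sup>2)"
  have "(2 * pi * (n + \<alpha>))\<^sup>2 / S \<le> integral {0..2*pi} (\<lambda>x. (r x)\<^sup>2 * (\<omega> x + \<alpha>)\<^sup>2)"
    unfolding S_def
    by (rule phase_energy_bound[OF rc rpos I\<theta>])
      (intro integrable_continuous_real continuous_intros rc \<omega>c)
  moreover have "(2 * pi * \<alpha>)\<^sup>2 / S \<le> (2 * pi * (n + \<alpha>))\<^sup>2 / S"
  proof -
    have "\<bar>\<alpha>\<bar> \<le> \<bar>n + \<alpha>\<bar>"
    proof (cases "n = 0")
      case False
      then have "1 \<le> \<bar>real_of_int n\<bar>" by linarith
      then show ?thesis using \<alpha>(1) by linarith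
    qed simp
    then have "\<alpha>\<^sup>2 \<le> (n + \<alpha>)\<^sup>2" by (simp add: abs_le_square_iff)
    then show ?thesis
      unfolding power_mult_distrib S_def using inverse_square_integral_pos[OF rc rpos]
      by (intro divide_right_mono mult_left_mono) auto
  qed
  moreover have "\<alpha>\<^sup>2 * Lq_square q r \<le> integral {0..2*pi} (\<lambda>x. (r' x)\<^sup>2) + (2 * pi * \<alpha>)\<^sup>2 / S"
    unfolding Lq_square_def S_def by (rule reduced_energy_bound_C1[OF dr rc' rper rpos q \<alpha>(2)])
  moreover have "integral {0..2*pi} (\<lambda>x. (r' x)\<^sup>2) + integral {0..2*pi} (\<lambda>x. (r x)\<^sup>2 * (\<omega> x + \<alpha>)\<^sup>2)
      = integral {0..2*pi} (\<lambda>x. (p' x - \<alpha> * s x)\<^sup>2 + (s' x + \<alpha> * p x)\<^sup>2)"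
  proof -
    have "(p' x - \<alpha> * s x)\<^sup>2 + (s' x + \<alpha> * p x)\<^sup>2 = (r' x)\<^sup>2 + (r x)\<^sup>2 * (\<omega> x + \<alpha>)\<^sup>2" for x
    proof -
      have "(r' x)\<^sup>2 + (r x)\<^sup>2 * (\<omega> x)\<^sup>2 = ((p x * p' x + s x * s' x)\<^sup>2 + (p x * s' x - s x * p' x)\<^sup>2) / (r x)\<^sup>2"
      proof -
        have "(a / k)\<^sup>2 + k\<^sup>2 * (b / k\<^sup>2)\<^sup>2 = (a\<^sup>2 + b\<^sup>2) / k\<^sup>2" if "k \<noteq> 0" for a b k :: real
          using that by (simp add: field_simps power2_eq_square)
        then show ?thesis unfolding r'_def \<omega>_def using rne[of x] by blast
      qed
      also have "(p x * p' x + s x * s' x)\<^sup>2 + (p x * s' x - s x * p' x)\<^sup>2 = ((p' x)\<^sup>2 + (s' x)\<^sup>2) * (r x)\<^sup>2"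
        unfolding r2 by (simp add: power2_eq_square algebra_simps)
      finally have 1: "(r' x)\<^sup>2 + (r x)\<^sup>2 * (\<omega> x)\<^sup>2 = (p' x)\<^sup>2 + (s' x)\<^sup>2" using rne[of x] by simp
      have 2: "(r x)\<^sup>2 * \<omega> x = p x * s' x - s x * p' x" unfolding \<omega>_def using rne[of x] by simp
      have "(r' x)\<^sup>2 + (r x)\<^sup>2 * (\<omega> x + \<alpha>)\<^sup>2 = ((r' x)\<^sup>2 + (r x)\<^sup>2 * (\<omega> x)\<^sup>2) + 2 * \<alpha> * ((r x)\<^sup>2 * \<omega> x) + \<alpha>\<^sup>2 * (r x)\<^sup>2"
        by (simp add: power2_eq_square algebra_simps)
      also have "\<dots> = (p' x - \<alpha> * s x)\<^sup>2 + (s' x + \<alpha> * p x)\<^sup>2"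
        unfolding 1 2 unfolding r2 by (simp add: power2_eq_square algebra_simps)
      finally show ?thesis ..
    qed
    then show ?thesis
      by (subst Henstock_Kurzweil_Integration.integral_add[symmetric])
        (auto intro!: integrable_continuous_real continuous_intros rc rc' \<omega>c)
  qed
  ultimately show ?thesis unfolding r_def[symmetric] by linarith
qed

text \<open>
  The image of a continuously differentiable curve in the plane is negligible, so arbitrarily small
  constants \<open>z n\<close> exist for which \<open>u + z n\<close> has no zero. Let \<open>z n\<close> tend to \<open>0\<close>.
\<close>

lemma energy_bound_C1:
  fixes p s p' s' :: "real \<Rightarrow> real"
  assumes p: "\<And>x. (p has_real_derivative p' x) (at x)" and s: "\<And>x. (s has_real_derivative s' x) (at x)"
    and c: "continuous_on UNIV p'" "continuous_on UNIV s'"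
    and per: "\<And>x. p (x + 2 * pi) = p x" "\<And>x. s (x + 2 * pi) = s x"
    and q: "2 < q" and \<alpha>: "\<bar>\<alpha>\<bar> \<le> 1/2" "(q + 2) * \<alpha>\<^sup>2 \<le> 1"
  shows "\<alpha>\<^sup>2 * Lq_square q (\<lambda>x. sqrt ((p x)\<^sup>2 + (s x)\<^sup>2))
    \<le> integral {0..2*pi} (\<lambda>x. (p' x - \<alpha> * s x)\<^sup>2 + (s' x + \<alpha> * p x)\<^sup>2)"
proof -
  have pc: "continuous_on A p" "continuous_on A s" for A
    using p s by (meson DERIV_isCont continuous_at_imp_continuous_on)+
  have pc': "continuous_on A p'" "continuous_on A s'" for A using c continuous_on_subset by blast+
  let ?w = "\<lambda>x. - Complex (p x) (s x)"
  have "?w differentiable_on UNIV"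
  proof -
    have "((\<lambda>x. Complex (p x) (s x)) has_vector_derivative Complex (p' x) (s' x)) (at x)" for x
      unfolding has_vector_derivative_complex_iff using p[of x] s[of x]
      by (simp add: has_real_derivative_iff_has_vector_derivative)
    then have "?w differentiable (at x)" for x
      using differentiableI_vector[OF has_vector_derivative_minus] by blast
    then show ?thesis by (simp add: differentiable_on_def)
  qed
  then have neg: "negligible (range ?w)"
    by (intro negligible_differentiable_image_lowdim) auto
  have "\<exists>z\<in>ball 0 (inverse (real (Suc n))). z \<notin> range ?w" for n
  proof (rule ccontr)
    assume "\<not> (\<exists>z\<in>ball 0 (inverse (real (Suc n))). z \<notin> range ?w)"
    then have "ball 0 (inverse (real (Suc n))) \<subseteq> range ?w" by blast
    then have "negligible (ball (0::complex) (inverse (real (Suc n))))" using neg negligible_subset by blast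
    then show False using open_not_negligible[of "ball (0::complex) (inverse (real (Suc n)))"] by simp
  qed
  then obtain z where z: "\<And>n. norm (z n) < inverse (real (Suc n))" "\<And>n. z n \<notin> range ?w"
    by (simp only: mem_ball dist_0_norm Bex_def) metis
  have z0: "z \<longlonglongrightarrow> 0"
    by (rule Lim_null_comparison[OF _ LIMSEQ_inverse_real_of_nat]) (use z(1) in \<open>auto simp: less_imp_le intro!: always_eventually\<close>)
  have R0: "(\<lambda>n. Re (z n)) \<longlonglongrightarrow> 0" "(\<lambda>n. Im (z n)) \<longlonglongrightarrow> 0"
    using tendsto_Re[OF z0] tendsto_Im[OF z0] by simp_all
  have z1: "\<bar>Re (z n)\<bar> \<le> 1" "\<bar>Im (z n)\<bar> \<le> 1" for n
  proof -
    have "inverse (real (Suc n)) \<le> 1" by (simp add: inverse_le_1_iff)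
    then show "\<bar>Re (z n)\<bar> \<le> 1" "\<bar>Im (z n)\<bar> \<le> 1" using abs_Re_le_cmod[of "z n"] abs_Im_le_cmod[of "z n"] z(1)[of n] by linarith+
  qed
  define P S where "P n x = p x + Re (z n)" and "S n x = s x + Im (z n)" for n x
  have PS: "(\<lambda>n. P n x) \<longlonglongrightarrow> p x" "(\<lambda>n. S n x) \<longlonglongrightarrow> s x" for x
    unfolding P_def S_def using tendsto_add[OF tendsto_const R0(1), of "p x"] tendsto_add[OF tendsto_const R0(2), of "s x"]
    by simp_all
  have ineq: "\<alpha>\<^sup>2 * Lq_square q (\<lambda>x. sqrt ((P n x)\<^sup>2 + (S n x)\<^sup>2))
    \<le> integral {0..2*pi} (\<lambda>x. (p' x - \<alpha> * S n x)\<^sup>2 + (s' x + \<alpha> * P n x)\<^sup>2)" for n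
  proof (rule energy_bound_nonvanishing[OF _ _ c _ _ _ q \<alpha>])
    show "(P n has_real_derivative p' x) (at x)" "(S n has_real_derivative s' x) (at x)" for x
      unfolding P_def S_def by (auto intro!: derivative_eq_intros p s)
    show "P n (x + 2*pi) = P n x" "S n (x + 2*pi) = S n x" for x
      by (simp_all add: P_def S_def per)
    show "P n x \<noteq> 0 \<or> S n x \<noteq> 0" for x
    proof (rule ccontr)
      assume "\<not> (P n x \<noteq> 0 \<or> S n x \<noteq> 0)"
      then have "p x + Re (z n) = 0" "s x + Im (z n) = 0" unfolding P_def S_def by simp_all
      then have "z n = ?w x" by (intro complex_eqI) simp_all
      then have "z n \<in> range ?w" by (rule range_eqI)
      with z(2)[of n] show False ..
    qed
  qed
  have K: "compact {0..2*pi}" "{0..2*pi} \<noteq> {}" by auto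
  have "continuous_on {0..2*pi} (\<lambda>x. \<bar>p x\<bar> + \<bar>s x\<bar>)" by (intro continuous_intros pc)
  from continuous_attains_sup[OF K this] obtain x1 where
    x1: "\<And>x. x \<in> {0..2*pi} \<Longrightarrow> \<bar>p x\<bar> + \<bar>s x\<bar> \<le> \<bar>p x1\<bar> + \<bar>s x1\<bar>" by blast
  have L: "(\<lambda>n. Lq_square q (\<lambda>x. sqrt ((P n x)\<^sup>2 + (S n x)\<^sup>2))) \<longlonglongrightarrow> Lq_square q (\<lambda>x. sqrt ((p x)\<^sup>2 + (s x)\<^sup>2))"
  proof (rule Lq_square_tendsto)
    show "continuous_on {0..2*pi} (\<lambda>x. sqrt ((P n x)\<^sup>2 + (S n x)\<^sup>2))" for n
      unfolding P_def S_def by (intro continuous_intros pc)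
    show "sqrt ((P n x)\<^sup>2 + (S n x)\<^sup>2) \<le> \<bar>p x1\<bar> + \<bar>s x1\<bar> + 2" if "x \<in> {0..2*pi}" for n x
      using sqrt_sum_squares_le_sum_abs[of "P n x" "S n x"] x1[OF that] z1[of n] unfolding P_def S_def by linarith
    show "(\<lambda>n. sqrt ((P n x)\<^sup>2 + (S n x)\<^sup>2)) \<longlonglongrightarrow> sqrt ((p x)\<^sup>2 + (s x)\<^sup>2)" for x
      by (intro tendsto_intros PS)
  qed (use q in auto)
  have E: "(\<lambda>n. integral {0..2*pi} (\<lambda>x. (p' x - \<alpha> * S n x)\<^sup>2 + (s' x + \<alpha> * P n x)\<^sup>2))
      \<longlonglongrightarrow> integral {0..2*pi} (\<lambda>x. (p' x - \<alpha> * s x)\<^sup>2 + (s' x + \<alpha> * p x)\<^sup>2)"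
  proof (rule dominated_convergence(2))
    show "(\<lambda>x. (p' x - \<alpha> * S n x)\<^sup>2 + (s' x + \<alpha> * P n x)\<^sup>2) integrable_on {0..2*pi}" for n
      unfolding P_def S_def by (intro integrable_continuous_real continuous_intros pc pc')
    show "(\<lambda>x. (\<bar>p' x\<bar> + \<bar>\<alpha>\<bar> * (\<bar>s x\<bar> + 1))\<^sup>2 + (\<bar>s' x\<bar> + \<bar>\<alpha>\<bar> * (\<bar>p x\<bar> + 1))\<^sup>2) integrable_on {0..2*pi}"
      by (intro integrable_continuous_real continuous_intros pc pc')
    show "norm ((p' x - \<alpha> * S n x)\<^sup>2 + (s' x + \<alpha> * P n x)\<^sup>2)
        \<le> (\<bar>p' x\<bar> + \<bar>\<alpha>\<bar> * (\<bar>s x\<bar> + 1))\<^sup>2 + (\<bar>s' x\<bar> + \<bar>\<alpha>\<bar> * (\<bar>p x\<bar> + 1))\<^sup>2" for n x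
    proof -
      have "\<bar>\<alpha> * S n x\<bar> \<le> \<bar>\<alpha>\<bar> * (\<bar>s x\<bar> + 1)" "\<bar>\<alpha> * P n x\<bar> \<le> \<bar>\<alpha>\<bar> * (\<bar>p x\<bar> + 1)"
        unfolding abs_mult using z1[of n] by (auto intro!: mult_left_mono simp: P_def S_def)
      then have "\<bar>p' x - \<alpha> * S n x\<bar> \<le> \<bar>p' x\<bar> + \<bar>\<alpha>\<bar> * (\<bar>s x\<bar> + 1)" "\<bar>s' x + \<alpha> * P n x\<bar> \<le> \<bar>s' x\<bar> + \<bar>\<alpha>\<bar> * (\<bar>p x\<bar> + 1)"
        by linarith+
      then have "(p' x - \<alpha> * S n x)\<^sup>2 \<le> (\<bar>p' x\<bar> + \<bar>\<alpha>\<bar> * (\<bar>s x\<bar> + 1))\<^sup>2"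
         "(s' x + \<alpha> * P n x)\<^sup>2 \<le> (\<bar>s' x\<bar> + \<bar>\<alpha>\<bar> * (\<bar>p x\<bar> + 1))\<^sup>2"
        by (metis abs_ge_zero power2_abs power_mono)+
      then show ?thesis by simp
    qed
    show "(\<lambda>n. (p' x - \<alpha> * S n x)\<^sup>2 + (s' x + \<alpha> * P n x)\<^sup>2) \<longlonglongrightarrow> (p' x - \<alpha> * s x)\<^sup>2 + (s' x + \<alpha> * p x)\<^sup>2" for x
      by (intro tendsto_intros PS)
  qed
  show ?thesis
    by (rule LIMSEQ_le[OF tendsto_mult_left[OF L] E]) (use ineq in blast)
qed

section \<open>Variation of an absolutely continuous function\<close>

text \<open>
  Degenerate intervals are allowed: they contribute nothing to oscillation sums, so two packings may be
  joined even when they share some.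
\<close>

definition interval_packing :: "real set \<Rightarrow> real set set \<Rightarrow> bool" where
  "interval_packing E d \<longleftrightarrow> d division_of \<Union>d \<and> \<Union>d \<subseteq> E"

definition osc_sum :: "(real \<Rightarrow> real) \<Rightarrow> real set set \<Rightarrow> real" where
  "osc_sum f d = (\<Sum>k\<in>d. \<bar>f (Sup k) - f (Inf k)\<bar>)"

text \<open>
  Defined for arbitrary sets and not only for intervals, because the absolute continuity of the
  variation concerns finite unions of intervals.
\<close>

definition variation :: "(real \<Rightarrow> real) \<Rightarrow> real set \<Rightarrow> real" where
  "variation f E = (SUP d\<in>Collect (interval_packing E). osc_sum f d)"

lemma packing_finite: "interval_packing E d \<Longrightarrow> finite d"
  by (auto simp: interval_packing_def)

lemma packing_member:
  assumes "interval_packing E d" "k \<in> d"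
  shows "\<exists>s t. s \<le> t \<and> k = {s..t} \<and> {s..t} \<subseteq> E"
proof -
  have d: "d division_of \<Union>d" "\<Union>d \<subseteq> E" using assms by (auto simp: interval_packing_def)
  obtain s t where "k = cbox s t" using division_ofD(4)[OF d(1) assms(2)] by blast
  moreover have "k \<noteq> {}" using division_ofD(3)[OF d(1) assms(2)] .
  moreover have "k \<subseteq> E" using d(2) assms(2) by blast
  ultimately show ?thesis by auto
qed

lemma packing_empty: "interval_packing E {}"
  by (auto simp: interval_packing_def)

lemma packing_mono: "interval_packing E d \<Longrightarrow> E \<subseteq> E' \<Longrightarrow> interval_packing E' d"
  by (auto simp: interval_packing_def)

lemma packing_subset: "interval_packing E d \<Longrightarrow> d' \<subseteq> d \<Longrightarrow> interval_packing (\<Union>d') d'"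
  using division_of_subset by (auto simp: interval_packing_def)

lemma packing_filter:
  assumes "interval_packing E d" "d' \<subseteq> d"
    and "\<And>s t. s \<le> t \<Longrightarrow> {s..t} \<in> d' \<Longrightarrow> {s..t} \<subseteq> E \<Longrightarrow> {s..t} \<subseteq> E'"
  shows "interval_packing E' d'"
proof -
  have "k \<subseteq> E'" if "k \<in> d'" for k
    using packing_member[OF assms(1), of k] assms(2,3) that by (metis subsetD)
  then show ?thesis using packing_subset[OF assms(1,2)] by (auto simp: interval_packing_def)
qed

lemma packing_singleton: "s \<le> t \<Longrightarrow> interval_packing {s..t} {{s..t}}"
  unfolding interval_packing_def by (auto intro!: division_ofI)

text \<open>
  The two families can only share degenerate intervals, which do not contribute to the sums.
\<close>

lemma packing_Un:
  assumes "interval_packing E d" "interval_packing E' d'" "interior E \<inter> interior E' = {}"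
  shows "interval_packing (E \<union> E') (d \<union> d')" "osc_sum f (d \<union> d') = osc_sum f d + osc_sum f d'"
proof -
  have "interior (\<Union>d) \<inter> interior (\<Union>d') = {}"
    using assms interior_mono unfolding interval_packing_def by blast
  then show "interval_packing (E \<union> E') (d \<union> d')"
    using division_disjoint_union[of d "\<Union>d" d' "\<Union>d'"] assms unfolding interval_packing_def
    by auto
  show "osc_sum f (d \<union> d') = osc_sum f d + osc_sum f d'"
    unfolding osc_sum_def
  proof (rule sum.union_inter_neutral)
    show "\<forall>k\<in>d \<inter> d'. \<bar>f (Sup k) - f (Inf k)\<bar> = 0"
    proof
      fix k assume k: "k \<in> d \<inter> d'"
      obtain s t where st: "s \<le> t" "k = {s..t}" "{s..t} \<subseteq> E" using packing_member[OF assms(1)] k by blast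
      moreover have "{s..t} \<subseteq> E'" using packing_member[OF assms(2)] k st by (metis IntD2)
      ultimately have "interior {s..t} = {}" using assms(3) interior_mono by blast
      then have "s = t" using st by (simp)
      then show "\<bar>f (Sup k) - f (Inf k)\<bar> = 0" using st by simp
    qed
  qed (use assms packing_finite in auto)
qed

text \<open>
  Cut at \<open>c\<close> the unique interval of the packing that contains \<open>c\<close> in its interior, if there is one; the
  triangle inequality bounds its oscillation by those of the two pieces.
\<close>

lemma packing_split:
  assumes p: "interval_packing {A..B} d" and c: "A \<le> c" "c \<le> B"
  obtains d1 d2 where "interval_packing {A..c} d1" "interval_packing {c..B} d2"
    "osc_sum f d \<le> osc_sum f d1 + osc_sum f d2"
proof (cases "\<exists>k\<in>d. Inf k < c \<and> c < Sup k")
  case False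
  let ?d1 = "{k\<in>d. Sup k \<le> c}" and ?d2 = "{k\<in>d. c < Sup k}"
  have "interval_packing {A..c} ?d1"
    by (rule packing_filter[OF p]) auto
  moreover have "interval_packing {c..B} ?d2"
  proof (rule packing_filter[OF p])
    fix s t assume st: "s \<le> t" "{s..t} \<in> ?d2" "{s..t} \<subseteq> {A..B}"
    then have "c \<le> s" using False by force
    then show "{s..t} \<subseteq> {c..B}" using st by auto
  qed auto
  moreover have "osc_sum f d = osc_sum f ?d1 + osc_sum f ?d2"
    unfolding osc_sum_def using packing_finite[OF p]
    by (subst sum.union_disjoint[symmetric]) (auto intro!: sum.cong)
  ultimately show ?thesis using that by simp
next
  case True
  then obtain k0 where k0: "k0 \<in> d" "Inf k0 < c" "c < Sup k0" by blast
  obtain s t where st: "s \<le> t" "k0 = {s..t}" "{s..t} \<subseteq> {A..B}" using packing_member[OF p k0(1)] by blast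
  have stc: "s < c" "c < t" using k0 st by auto
  have dd: "d division_of \<Union>d" using p by (simp add: interval_packing_def)
  have sep: "(Sup k \<le> s) \<or> (t \<le> Inf k)" if k: "k \<in> d" "k \<noteq> k0" "Inf k \<noteq> Sup k" for k
  proof -
    obtain a b where ab: "a \<le> b" "k = {a..b}" using packing_member[OF p k(1)] by blast
    have "interior k \<inter> interior k0 = {}" using division_ofD(5)[OF dd k(1) k0(1) k(2)] .
    then have "{a<..<b} \<inter> {s<..<t} = {}" using ab st by simp
    moreover have "a < b" using ab k by auto
    ultimately have "max a s \<ge> min b t"
      by (metis Int_greaterThanLessThan greaterThanLessThan_empty_iff2 linorder_not_le max_def min_def)
    then show ?thesis using ab stc \<open>a < b\<close> by auto
  qed
  let ?d1 = "{k\<in>d. k \<noteq> k0 \<and> Inf k \<noteq> Sup k \<and> Sup k \<le> s}"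
  let ?d2 = "{k\<in>d. k \<noteq> k0 \<and> Inf k \<noteq> Sup k \<and> t \<le> Inf k}"
  have p1: "interval_packing {A..s} ?d1"
    by (rule packing_filter[OF p]) auto
  have p2: "interval_packing {t..B} ?d2"
    by (rule packing_filter[OF p]) auto
  have i1: "interior {A..s} \<inter> interior {s..c} = {}" by auto
  have i2: "interior {t..B} \<inter> interior {c..t} = {}" by auto
  have "{A..s} \<union> {s..c} = {A..c}" "{t..B} \<union> {c..t} = {c..B}" using st stc by auto
  note q1 = packing_Un[OF p1 packing_singleton[of s c] i1, unfolded this]
   and q2 = packing_Un[OF p2 packing_singleton[of c t] i2, unfolded this]
  have "osc_sum f d = osc_sum f ({k0} \<union> (?d1 \<union> ?d2))"
    unfolding osc_sum_def
  proof (rule sum.mono_neutral_right)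
    show "finite d" using packing_finite[OF p] .
    show "{k0} \<union> (?d1 \<union> ?d2) \<subseteq> d" using k0 by auto
    show "\<forall>i\<in>d - ({k0} \<union> (?d1 \<union> ?d2)). \<bar>f (Sup i) - f (Inf i)\<bar> = 0"
      using sep by force
  qed
  also have "\<dots> = \<bar>f t - f s\<bar> + (osc_sum f ?d1 + osc_sum f ?d2)"
  proof -
    have "osc_sum f ({k0} \<union> (?d1 \<union> ?d2)) = osc_sum f {k0} + osc_sum f (?d1 \<union> ?d2)"
      unfolding osc_sum_def using packing_finite[OF p] by (subst sum.union_disjoint) auto
    also have "osc_sum f (?d1 \<union> ?d2) = osc_sum f ?d1 + osc_sum f ?d2"
    proof -
      have "?d1 \<inter> ?d2 = {}"
      proof -
        have False if k: "k \<in> ?d1" "k \<in> ?d2" for k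
        proof -
          obtain u v where "u \<le> v" "k = {u..v}" using packing_member[OF p, of k] k(1) by blast
          then show False using k stc by simp
        qed
        then show ?thesis by blast
      qed
      then show ?thesis
        unfolding osc_sum_def using packing_finite[OF p] by (subst sum.union_disjoint) auto
    qed
    finally show ?thesis using st by (simp add: osc_sum_def)
  qed
  also have "\<dots> \<le> osc_sum f (?d1 \<union> {{s..c}}) + osc_sum f (?d2 \<union> {{c..t}})"
    using q1(2)[of f] q2(2)[of f] stc by (simp add: osc_sum_def)
  finally show ?thesis using that q1(1) q2(1) stc by simp
qed

text \<open>
  The condition of absolute continuity in terms of packings, with the total length measured by Lebesgue
  measure so that it is monotone in the covered set.
\<close>

lemma AC_osc_small:
  assumes "abs_cont_on a b f" "\<epsilon> > 0"
  obtains \<delta> where "\<delta> > 0" "\<And>d. interval_packing {a..b} d \<Longrightarrow> measure lebesgue (\<Union>d) < \<delta> \<Longrightarrow> osc_sum f d < \<epsilon>"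
proof -
  obtain \<delta> where \<delta>: "\<delta> > 0" "\<And>d. d division_of \<Union>d \<and> \<Union>d \<subseteq> {a..b} \<and> (\<Sum>k\<in>d. Sup k - Inf k) < \<delta> \<Longrightarrow>
        (\<Sum>k\<in>d. norm (f (Sup k) - f (Inf k))) < \<epsilon>"
    using assms unfolding abs_cont_on_def by meson
  have "osc_sum f d < \<epsilon>" if d: "interval_packing {a..b} d" "measure lebesgue (\<Union>d) < \<delta>" for d
  proof -
    have dv: "d division_of \<Union>d" using d by (simp add: interval_packing_def)
    have "(\<Sum>k\<in>d. Sup k - Inf k) = (\<Sum>k\<in>d. measure lebesgue k)"
    proof (rule sum.cong)
      fix k assume "k \<in> d"
      then obtain s t where "s \<le> t" "k = {s..t}" using packing_member[OF d(1)] by blast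
      then show "Sup k - Inf k = measure lebesgue k" by simp
    qed simp
    also have "\<dots> = measure lebesgue (\<Union>d)" using content_division[OF dv] .
    finally show ?thesis using \<delta>(2)[of d] d dv by (simp add: osc_sum_def interval_packing_def)
  qed
  then show ?thesis using that \<delta>(1) by blast
qed

lemma packing_measure_le:
  assumes "interval_packing {a..b} d" "a \<le> b"
  shows "measure lebesgue (\<Union>d) \<le> b - a"
proof -
  have dv: "d division_of \<Union>d" "\<Union>d \<subseteq> {a..b}" using assms by (auto simp: interval_packing_def)
  have "measure lebesgue (\<Union>d) \<le> measure lebesgue {a..b}"
    using dv by (intro measure_mono_fmeasurable fmeasurableD) (auto intro: lmeasurable_division)
  then show ?thesis using assms by simp
qed

text \<open>
  On an interval shorter than the \<open>\<delta>\<close> belonging to \<open>\<epsilon> = 1\<close> all oscillation sums are at most \<open>1\<close>; finitely many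
  such intervals cover \<open>[a, b]\<close>.
\<close>

lemma AC_bounded_variation:
  assumes "abs_cont_on a b f"
  shows "\<exists>M. \<forall>d. interval_packing {a..b} d \<longrightarrow> osc_sum f d \<le> M"
proof (cases "a \<le> b")
  case False
  have "d = {}" if p: "interval_packing {a..b} d" for d
  proof (rule ccontr)
    assume "d \<noteq> {}"
    then obtain k where k: "k \<in> d" by blast
    obtain s t where "s \<le> t" "{s..t} \<subseteq> {a..b}" using packing_member[OF p k] by blast
    then show False using False by simp
  qed
  then show ?thesis by (metis order_refl)
next
  case True
  obtain \<delta> where \<delta>: "\<delta> > 0" "\<And>d. interval_packing {a..b} d \<Longrightarrow> measure lebesgue (\<Union>d) < \<delta> \<Longrightarrow> osc_sum f d < 1"
    using AC_osc_small[OF assms, of 1] by auto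
  have "\<forall>d. interval_packing {a..min b (a + real n * (\<delta>/2))} d \<longrightarrow> osc_sum f d \<le> 1 + real n" for n
  proof (induction n)
    case 0
    show ?case
    proof (intro allI impI)
      fix d assume d: "interval_packing {a..min b (a + real 0 * (\<delta>/2))} d"
      then have "measure lebesgue (\<Union>d) \<le> 0" using packing_measure_le[of a a d] True by (simp add: min_absorb2)
      moreover have "interval_packing {a..b} d" using packing_mono[OF d] by auto
      ultimately show "osc_sum f d \<le> 1 + real 0" using \<delta> by (smt (verit) of_nat_0)
    qed
  next
    case (Suc n)
    show ?case
    proof (intro allI impI)
      let ?c = "min b (a + real n * (\<delta>/2))" and ?B = "min b (a + real (Suc n) * (\<delta>/2))"
      fix d assume d: "interval_packing {a..?B} d"
      have c: "a \<le> ?c" "?c \<le> ?B" "?B \<le> b" "?B \<le> ?c + \<delta>/2" using True \<delta>(1) by (auto simp: min_def field_simps)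
      obtain d1 d2 where "interval_packing {a..?c} d1" and d2: "interval_packing {?c..?B} d2"
        and s: "osc_sum f d \<le> osc_sum f d1 + osc_sum f d2" using packing_split[OF d c(1,2)] by blast
      then have "osc_sum f d1 \<le> 1 + real n" using Suc by blast
      moreover have "osc_sum f d2 < 1"
      proof (rule \<delta>(2))
        show "interval_packing {a..b} d2" using c by (intro packing_mono[OF d2]) auto
        show "measure lebesgue (\<Union>d2) < \<delta>" using packing_measure_le[OF d2 c(2)] c \<delta>(1) by linarith
      qed
      ultimately show "osc_sum f d \<le> 1 + real (Suc n)" using s by simp
    qed
  qed
  moreover obtain n where "b - a < real n * (\<delta>/2)"
    using reals_Archimedean3[of "\<delta>/2"] \<delta>(1) by (meson half_gt_zero)
  then have "min b (a + real n * (\<delta>/2)) = b" by auto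
  ultimately show ?thesis by metis
qed

locale AC_fun =
  fixes f :: "real \<Rightarrow> real"
  assumes AC: "abs_cont_on a b f"
begin

lemma osc_sums_bounded: "E \<subseteq> {a..b} \<Longrightarrow> bdd_above (osc_sum f ` Collect (interval_packing E))"
proof -
  assume E: "E \<subseteq> {a..b}"
  obtain M where "\<And>d. interval_packing {a..b} d \<Longrightarrow> osc_sum f d \<le> M"
    using AC_bounded_variation[OF AC[of a b]] by blast
  then show ?thesis using packing_mono[OF _ E] by (intro bdd_aboveI2[of _ _ M]) simp
qed

lemma osc_le_variation: "interval_packing E d \<Longrightarrow> E \<subseteq> {a..b} \<Longrightarrow> osc_sum f d \<le> variation f E"
  unfolding variation_def by (rule cSUP_upper) (auto intro: osc_sums_bounded)

lemma variation_le: "(\<And>d. interval_packing E d \<Longrightarrow> osc_sum f d \<le> M) \<Longrightarrow> variation f E \<le> M"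
  unfolding variation_def by (rule cSUP_least) (auto intro: packing_empty)

lemma variation_nonneg: "E \<subseteq> {a..b} \<Longrightarrow> 0 \<le> variation f E"
  using osc_le_variation[OF packing_empty, of E] by (auto simp: osc_sum_def)

lemma variation_superadd:
  assumes "E \<union> E' \<subseteq> {a..b}" "interior E \<inter> interior E' = {}"
  shows "variation f E + variation f E' \<le> variation f (E \<union> E')"
proof -
  have *: "osc_sum f d + osc_sum f d' \<le> variation f (E \<union> E')" if "interval_packing E d" "interval_packing E' d'" for d d'
    using packing_Un[OF that assms(2)] osc_le_variation[OF _ assms(1)] by metis
  have "osc_sum f d + variation f E' \<le> variation f (E \<union> E')" if "interval_packing E d" for d
    using variation_le[of E' "variation f (E \<union> E') - osc_sum f d"] *[OF that] by (smt (verit))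
  then show ?thesis using variation_le[of E "variation f (E \<union> E') - variation f E'"] by (smt (verit))
qed

lemma variation_combine:
  assumes "s \<le> c" "c \<le> t"
  shows "variation f {s..t} = variation f {s..c} + variation f {c..t}"
proof (rule antisym)
  show "variation f {s..t} \<le> variation f {s..c} + variation f {c..t}"
  proof (rule variation_le)
    fix d assume d: "interval_packing {s..t} d"
    obtain d1 d2 where "interval_packing {s..c} d1" "interval_packing {c..t} d2"
      "osc_sum f d \<le> osc_sum f d1 + osc_sum f d2" using packing_split[OF d assms] by blast
    then show "osc_sum f d \<le> variation f {s..c} + variation f {c..t}"
      using osc_le_variation[of "{s..c}" d1 s c] osc_le_variation[of "{c..t}" d2 c t] by simp
  qed
  have "{s..c} \<union> {c..t} = {s..t}" using assms by auto
  then show "variation f {s..c} + variation f {c..t} \<le> variation f {s..t}"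
    using variation_superadd[of "{s..c}" "{c..t}" s t] by auto
qed

text \<open>
  The signed variation measured from \<open>0\<close>: its increment over \<open>[s, t]\<close> is the variation on \<open>[s, t]\<close> for all real
  \<open>s \<le> t\<close>.
\<close>

definition variation_fun :: "real \<Rightarrow> real" where
  "variation_fun x = variation f {0..x} - variation f {x..0}"

lemma variation_trivial: "t \<le> s \<Longrightarrow> variation f {s..t} = 0"
proof -
  assume "t \<le> s"
  have "osc_sum f d \<le> 0" if p: "interval_packing {s..t} d" for d
    unfolding osc_sum_def
  proof (rule sum_nonpos)
    fix k assume k: "k \<in> d"
    obtain u v where uv: "u \<le> v" "k = {u..v}" "{u..v} \<subseteq> {s..t}" using packing_member[OF p k] by blast
    then have "u = v" using \<open>t \<le> s\<close> by auto
    then show "\<bar>f (Sup k) - f (Inf k)\<bar> \<le> 0" using uv by simp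
  qed
  then show ?thesis using variation_le[of "{s..t}" 0] variation_nonneg[of "{s..t}" s t] by force
qed

lemma variation_fun_diff: "s \<le> t \<Longrightarrow> variation_fun t - variation_fun s = variation f {s..t}"
proof -
  assume st: "s \<le> t"
  consider "0 \<le> s" | "s \<le> 0" "0 \<le> t" | "t \<le> 0" by linarith
  then show ?thesis
  proof cases
    case 1
    then show ?thesis using variation_combine[of 0 s t] variation_trivial[of 0 s] variation_trivial[of 0 t] st
      by (simp add: variation_fun_def)
  next
    case 2
    then show ?thesis using variation_combine[of s 0 t] variation_trivial[of s 0] variation_trivial[of 0 t] st
      by (simp add: variation_fun_def)
  next
    case 3
    then show ?thesis using variation_combine[of s t 0] variation_trivial[of s 0] variation_trivial[of t 0] st
      by (simp add: variation_fun_def)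
  qed
qed

lemma osc_le_variation_fun: "s \<le> t \<Longrightarrow> \<bar>f t - f s\<bar> \<le> variation_fun t - variation_fun s"
  using osc_le_variation[OF packing_singleton[of s t], of s t] by (simp add: variation_fun_diff osc_sum_def)

lemma sum_variation_le:
  assumes "interval_packing {a..b} d"
  shows "(\<Sum>k\<in>d. variation f k) \<le> variation f (\<Union>d)"
proof -
  have "D \<subseteq> d \<Longrightarrow> (\<Sum>k\<in>D. variation f k) \<le> variation f (\<Union>D)" if "finite D" for D
    using that
  proof (induction D rule: finite_induct)
    case empty
    have "variation f {} = 0" using variation_trivial[of 0 1] by simp
    then show ?case by simp
  next
    case (insert k D)
    have dv: "d division_of \<Union>d" "\<Union>d \<subseteq> {a..b}" using assms by (auto simp: interval_packing_def)
    have "interior k \<inter> interior (\<Union>D) = {}"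
    proof (rule Int_interior_Union_intervals)
      show "\<exists>a b. T = cbox a b" if "T \<in> D" for T using division_ofD(4)[OF dv(1)] insert that by blast
      show "interior k \<inter> interior T = {}" if "T \<in> D" for T
        using division_ofD(5)[OF dv(1), of k T] insert that by blast
    qed (use insert in auto)
    moreover have "k \<union> \<Union>D \<subseteq> {a..b}" using insert dv by blast
    ultimately have "variation f k + variation f (\<Union>D) \<le> variation f (\<Union>(insert k D))"
      using variation_superadd[of k "\<Union>D" a b] by simp
    then show ?case using insert by simp
  qed
  from this[OF packing_finite[OF assms]] show ?thesis by simp
qed

text \<open>
  The increments over the intervals of a packing add up to at most the variation on their union, by
  superadditivity; every packing inside a union of small length has a small oscillation sum.
\<close>

lemma variation_fun_AC: "abs_cont_on a b variation_fun"
  unfolding abs_cont_on_def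
proof (intro allI impI)
  fix \<epsilon> :: real assume "\<epsilon> > 0"
  then obtain \<delta> where \<delta>: "\<delta> > 0" "\<And>d. interval_packing {a..b} d \<Longrightarrow> measure lebesgue (\<Union>d) < \<delta> \<Longrightarrow> osc_sum f d < \<epsilon>/2"
    using AC_osc_small[OF AC, of "\<epsilon>/2" a b] by auto
  show "\<exists>\<delta>>0. \<forall>d. d division_of \<Union> d \<and> \<Union> d \<subseteq> {a..b} \<and> (\<Sum>k\<in>d. Sup k - Inf k) < \<delta> \<longrightarrow>
                (\<Sum>k\<in>d. norm (variation_fun (Sup k) - variation_fun (Inf k))) < \<epsilon>"
  proof (intro exI[of _ \<delta>] conjI allI impI)
    fix d assume d: "d division_of \<Union> d \<and> \<Union> d \<subseteq> {a..b} \<and> (\<Sum>k\<in>d. Sup k - Inf k) < \<delta>"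
    then have p: "interval_packing {a..b} d" by (auto simp: interval_packing_def)
    have k: "norm (variation_fun (Sup k) - variation_fun (Inf k)) = variation f k \<and> Sup k - Inf k = measure lebesgue k" if kd: "k \<in> d" for k
    proof -
      obtain s t where st: "s \<le> t" "k = {s..t}" using packing_member[OF p kd] by blast
      then show ?thesis using variation_fun_diff[OF st(1)] variation_nonneg[of "{s..t}" s t] by simp
    qed
    have m: "measure lebesgue (\<Union>d) < \<delta>" using d content_division[of d "\<Union>d"] k by simp
    have "(\<Sum>k\<in>d. norm (variation_fun (Sup k) - variation_fun (Inf k))) = (\<Sum>k\<in>d. variation f k)" using k by simp
    also have "\<dots> \<le> variation f (\<Union>d)" using sum_variation_le[OF p] .
    also have "\<dots> \<le> \<epsilon>/2"
    proof (rule variation_le)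
      fix d' assume d': "interval_packing (\<Union>d) d'"
      then have p': "interval_packing {a..b} d'" using packing_mono d by blast
      have "measure lebesgue (\<Union>d') \<le> measure lebesgue (\<Union>d)"
        using d d' unfolding interval_packing_def
        by (intro measure_mono_fmeasurable fmeasurableD) (auto intro: lmeasurable_division)
      then show "osc_sum f d' \<le> \<epsilon>/2" using \<delta>(2)[OF p'] m by simp
    qed
    finally show "(\<Sum>k\<in>d. norm (variation_fun (Sup k) - variation_fun (Inf k))) < \<epsilon>" using \<open>\<epsilon> > 0\<close> by simp
  qed (use \<delta> in simp)
qed

end

section \<open>The fundamental theorem of calculus for absolutely continuous functions\<close>

lemma AC_continuous:
  assumes "\<And>a b. abs_cont_on a b (f::real\<Rightarrow>real)"
  shows "continuous_on UNIV f"
  unfolding continuous_on_iff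
proof (intro ballI allI impI)
  fix x \<epsilon> :: real assume e: "\<epsilon> > 0"
  obtain \<delta> where \<delta>: "\<delta> > 0" "\<And>d. interval_packing {x-1..x+1} d \<Longrightarrow> measure lebesgue (\<Union>d) < \<delta> \<Longrightarrow> osc_sum f d < \<epsilon>"
    using AC_osc_small[OF assms e, of "x-1" "x+1"] by blast
  have *: "\<bar>f t - f s\<bar> < \<epsilon>" if "s \<le> t" "x - 1 \<le> s" "t \<le> x + 1" "t - s < \<delta>" for s t
    using \<delta>(2)[of "{{s..t}}"] packing_mono[OF packing_singleton[of s t], of "{x-1..x+1}"] that
    by (simp add: osc_sum_def)
  show "\<exists>d>0. \<forall>x'\<in>UNIV. dist x' x < d \<longrightarrow> dist (f x') (f x) < \<epsilon>"
  proof (intro exI[of _ "min 1 \<delta>"] conjI ballI impI)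
    fix y assume "dist y x < min 1 \<delta>"
    then show "dist (f y) (f x) < \<epsilon>" using *[of x y] *[of y x] by (cases "x \<le> y") (auto simp: dist_real_def abs_minus_commute)
  qed (use \<delta> in auto)
qed

lemma AC_add:
  assumes "abs_cont_on a b (f::real\<Rightarrow>real)" "abs_cont_on a b g"
  shows "abs_cont_on a b (\<lambda>x. f x + c * g x)"
  unfolding abs_cont_on_def
proof (intro allI impI)
  fix \<epsilon> :: real assume e: "\<epsilon> > 0"
  define \<eta> where "\<eta> = \<epsilon> / (2 * (1 + \<bar>c\<bar>))"
  have \<eta>: "\<eta> > 0" using e by (auto simp: \<eta>_def intro!: divide_pos_pos)
  obtain \<delta>1 where 1: "\<delta>1 > 0" "\<And>d. d division_of \<Union>d \<and> \<Union>d \<subseteq> {a..b} \<and> (\<Sum>k\<in>d. Sup k - Inf k) < \<delta>1 \<Longrightarrow>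
        (\<Sum>k\<in>d. norm (f (Sup k) - f (Inf k))) < \<eta>" using assms(1) \<eta> unfolding abs_cont_on_def by meson
  obtain \<delta>2 where 2: "\<delta>2 > 0" "\<And>d. d division_of \<Union>d \<and> \<Union>d \<subseteq> {a..b} \<and> (\<Sum>k\<in>d. Sup k - Inf k) < \<delta>2 \<Longrightarrow>
        (\<Sum>k\<in>d. norm (g (Sup k) - g (Inf k))) < \<eta>" using assms(2) \<eta> unfolding abs_cont_on_def by meson
  show "\<exists>\<delta>>0. \<forall>d. d division_of \<Union> d \<and> \<Union> d \<subseteq> {a..b} \<and> (\<Sum>k\<in>d. Sup k - Inf k) < \<delta> \<longrightarrow>
                (\<Sum>k\<in>d. norm (f (Sup k) + c * g (Sup k) - (f (Inf k) + c * g (Inf k)))) < \<epsilon>"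
  proof (intro exI[of _ "min \<delta>1 \<delta>2"] conjI allI impI)
    fix d assume d: "d division_of \<Union> d \<and> \<Union> d \<subseteq> {a..b} \<and> (\<Sum>k\<in>d. Sup k - Inf k) < min \<delta>1 \<delta>2"
    have "(\<Sum>k\<in>d. norm (f (Sup k) + c * g (Sup k) - (f (Inf k) + c * g (Inf k))))
       \<le> (\<Sum>k\<in>d. norm (f (Sup k) - f (Inf k)) + \<bar>c\<bar> * norm (g (Sup k) - g (Inf k)))"
    proof (rule sum_mono)
      fix k
      have "f (Sup k) + c * g (Sup k) - (f (Inf k) + c * g (Inf k)) = (f (Sup k) - f (Inf k)) + c * (g (Sup k) - g (Inf k))"
        by (simp add: algebra_simps)
      then show "norm (f (Sup k) + c * g (Sup k) - (f (Inf k) + c * g (Inf k))) \<le> norm (f (Sup k) - f (Inf k)) + \<bar>c\<bar> * norm (g (Sup k) - g (Inf k))"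
        by (metis norm_mult norm_triangle_ineq real_norm_def)
    qed
    also have "\<dots> = (\<Sum>k\<in>d. norm (f (Sup k) - f (Inf k))) + \<bar>c\<bar> * (\<Sum>k\<in>d. norm (g (Sup k) - g (Inf k)))"
      by (simp add: sum.distrib sum_distrib_left)
    also have "\<dots> \<le> \<eta> + \<bar>c\<bar> * \<eta>"
      using 1(2)[of d] 2(2)[of d] d by (intro add_mono mult_left_mono) auto
    also have "\<dots> = \<epsilon> / 2"
      unfolding \<eta>_def by (simp add: divide_simps) (simp add: algebra_simps)
    also have "\<dots> < \<epsilon>" using e by simp
    finally show "(\<Sum>k\<in>d. norm (f (Sup k) + c * g (Sup k) - (f (Inf k) + c * g (Inf k)))) < \<epsilon>" .
  qed (use 1 2 in auto)
qed

text \<open>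
  Cover a bounded null set by an open set of small Lebesgue measure. A finite union of compact
  intervals inside the open set has a division, and its Stieltjes measure is the corresponding
  oscillation sum, which is small. The open set is the increasing limit of such unions.
\<close>

lemma interval_measure_AC:
  fixes F :: "real \<Rightarrow> real"
  assumes mono: "\<And>x y. x \<le> y \<Longrightarrow> F x \<le> F y" and AC: "\<And>a b. abs_cont_on a b F"
  shows "absolutely_continuous lborel (interval_measure F)"
  unfolding absolutely_continuous_def
proof
  fix N :: "real set" assume N: "N \<in> null_sets lborel"
  have cont: "continuous_on UNIV F" using AC_continuous[OF AC] .
  have Icc: "emeasure (interval_measure F) {s..t} = ennreal (F t - F s)" if "s \<le> t" for s t
    using emeasure_interval_measure_Icc[OF that mono cont] by simp
  have bnd: "N \<inter> {-real n<..<real n} \<in> null_sets (interval_measure F)" for n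
  proof -
    let ?M = "N \<inter> {-real n<..<real n}"
    have Mb: "?M \<in> sets borel" using N by (auto simp: null_sets_def)
    have M0: "emeasure lborel ?M = 0" using N
      by (metis Mb emeasure_mono Int_lower1 le_zero_eq null_setsD1 null_setsD2)
    have small: "emeasure (interval_measure F) ?M \<le> ennreal \<epsilon>" if e: "\<epsilon> > 0" for \<epsilon>
    proof -
      obtain \<delta> where \<delta>: "\<delta> > 0" "\<And>d. interval_packing {-real n..real n} d \<Longrightarrow> measure lebesgue (\<Union>d) < \<delta> \<Longrightarrow> osc_sum F d < \<epsilon>"
        using AC_osc_small[OF AC e, of "-real n" "real n"] by blast
      obtain U where U: "open U" "?M \<subseteq> U" "emeasure lborel (U - ?M) < \<delta>"
        using outer_regular_lborel[OF Mb \<delta>(1)] by blast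
      define W where "W = U \<inter> {-real n<..<real n}"
      have W: "open W" "?M \<subseteq> W" using U by (auto simp: W_def)
      have "emeasure lborel W \<le> emeasure lborel ((U - ?M) \<union> ?M)"
        using U Mb by (intro emeasure_mono) (auto simp: W_def)
      also have "\<dots> \<le> emeasure lborel (U - ?M) + emeasure lborel ?M"
        using U Mb by (intro emeasure_subadditive) auto
      finally have Wm: "emeasure lborel W < \<delta>" using U(3) M0 by (simp add: order_le_less_trans)
      obtain \<D> where D: "countable \<D>" "\<D> \<subseteq> Pow W" "\<And>X. X \<in> \<D> \<Longrightarrow> \<exists>a b. X = cbox a b" "\<Union>\<D> = W"
        using open_countable_Union_open_cbox[OF W(1)] by blast
      have fin: "emeasure (interval_measure F) (\<Union>\<D>') \<le> ennreal \<epsilon>" if D': "finite \<D>'" "\<D>' \<subseteq> \<D>" for \<D>'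
      proof -
        obtain p where p: "p division_of \<Union>\<D>'"
          using elementary_unions_intervals[of \<D>'] D' D(3) by (metis subsetD)
        have pe: "\<Union>p = \<Union>\<D>'" using division_ofD(6)[OF p] .
        have p2: "p division_of \<Union>p" using p unfolding pe .
        have sub: "\<Union>p \<subseteq> W" using pe D D' by blast
        have pk: "interval_packing {-real n..real n} p"
          using p2 sub by (auto simp: interval_packing_def W_def)
        have "measure lebesgue (\<Union>p) < \<delta>"
        proof -
          have lm: "\<Union>p \<in> lmeasurable" using lmeasurable_division[OF p2] .
          have "ennreal (measure lebesgue (\<Union>p)) = emeasure lebesgue (\<Union>p)"
            using lm by (simp add: emeasure_eq_measure2)
          also have "\<dots> \<le> emeasure lebesgue W"
            using sub W by (intro emeasure_mono) auto
          also have "\<dots> = emeasure lborel W" using W by simp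
          also have "\<dots> < \<delta>" using Wm .
          finally show ?thesis using \<delta>(1) by (simp add: ennreal_less_iff)
        qed
        then have osc: "osc_sum F p < \<epsilon>" using \<delta>(2)[OF pk] by simp
        have "emeasure (interval_measure F) (\<Union>p) \<le> (\<Sum>k\<in>p. emeasure (interval_measure F) k)"
        proof -
          have "emeasure (interval_measure F) (\<Union>k\<in>p. k) \<le> (\<Sum>k\<in>p. emeasure (interval_measure F) k)"
          proof (rule emeasure_subadditive_finite)
            show "finite p" using packing_finite[OF pk] .
            show "(\<lambda>k. k) ` p \<subseteq> sets (interval_measure F)"
              using packing_member[OF pk] by force
          qed
          then show ?thesis by simp
        qed
        also have "\<dots> = (\<Sum>k\<in>p. ennreal \<bar>F (Sup k) - F (Inf k)\<bar>)"
        proof (rule sum.cong)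
          fix k assume "k \<in> p"
          then obtain s t where "s \<le> t" "k = {s..t}" using packing_member[OF pk] by blast
          then show "emeasure (interval_measure F) k = ennreal \<bar>F (Sup k) - F (Inf k)\<bar>"
            using Icc[of s t] mono[of s t] by simp
        qed simp
        also have "\<dots> = ennreal (osc_sum F p)" unfolding osc_sum_def by (rule sum_ennreal) simp
        also have "\<dots> \<le> ennreal \<epsilon>" using osc by (simp add: ennreal_leI)
        finally show ?thesis using pe by simp
      qed
      have "emeasure (interval_measure F) W \<le> ennreal \<epsilon>"
      proof (cases "\<D> = {}")
        case True
        then show ?thesis using D(4) by simp
      next
        case False
        define A where "A i = \<Union>(from_nat_into \<D> ` {..i})" for i :: nat
        have rng: "range (from_nat_into \<D>) = \<D>" using range_from_nat_into[OF False D(1)] .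
        have "(\<Union>i. A i) = \<Union>(range (from_nat_into \<D>))" unfolding A_def by auto
        then have "(\<Union>i. A i) = W" unfolding rng D(4) .
        moreover have "(SUP i. emeasure (interval_measure F) (A i)) = emeasure (interval_measure F) (\<Union>i. A i)"
        proof (rule SUP_emeasure_incseq)
          have "A i \<in> sets borel" for i
            unfolding A_def
          proof (rule sets.finite_Union)
            have "X \<in> sets borel" if "X \<in> \<D>" for X using D(3)[OF that] by auto
            then show "from_nat_into \<D> ` {..i} \<subseteq> sets borel" using rng by (metis image_subset_iff rangeI subsetI)
          qed simp
          then show "range A \<subseteq> sets (interval_measure F)" by auto
          show "incseq A" unfolding incseq_def A_def by (intro allI impI Union_mono image_mono) simp
        qed
        moreover have "emeasure (interval_measure F) (A i) \<le> ennreal \<epsilon>" for i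
          unfolding A_def
        proof (rule fin)
          show "from_nat_into \<D> ` {..i} \<subseteq> \<D>" using rng by blast
        qed simp
        then have "(SUP i. emeasure (interval_measure F) (A i)) \<le> ennreal \<epsilon>"
          by (rule SUP_least)
        ultimately show ?thesis by simp
      qed
      moreover have "emeasure (interval_measure F) ?M \<le> emeasure (interval_measure F) W"
        using W by (intro emeasure_mono) auto
      ultimately show ?thesis by order
    qed
    have "emeasure (interval_measure F) ?M \<le> 0"
    proof (rule ennreal_le_epsilon)
      fix e :: real assume "0 < e"
      then show "emeasure (interval_measure F) ?M \<le> 0 + ennreal e" using small[of e] by (simp only: add_0)
    qed
    then show ?thesis using Mb by (intro null_setsI) simp_all
  qed
  have "N = (\<Union>n. N \<inter> {-real n<..<real n})"
  proof (intro set_eqI iffI)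
    fix x assume "x \<in> N"
    obtain n where "\<bar>x\<bar> < real n" using reals_Archimedean2[of "\<bar>x\<bar>"] by blast
    then have "-real n < x \<and> x < real n" by linarith
    then show "x \<in> (\<Union>n. N \<inter> {-real n<..<real n})" using \<open>x \<in> N\<close> by auto
  qed auto
  moreover have "(\<Union>n. N \<inter> {-real n<..<real n}) \<in> null_sets (interval_measure F)"
    using bnd by (intro null_sets_UN) auto
  ultimately show "N \<in> null_sets (interval_measure F)" by simp
qed

text \<open>
  The density is the Radon-Nikodym derivative of the Stieltjes measure of \<open>F\<close>.
\<close>

lemma mono_AC_density:
  fixes F :: "real \<Rightarrow> real"
  assumes mono: "\<And>x y. x \<le> y \<Longrightarrow> F x \<le> F y" and AC: "\<And>a b. abs_cont_on a b F"
  obtains h :: "real \<Rightarrow> real" where "\<And>a b. h absolutely_integrable_on {a..b}"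
    "\<And>a b. a \<le> b \<Longrightarrow> (h has_integral (F b - F a)) {a..b}"
proof -
  have cont: "continuous_on UNIV F" using AC_continuous[OF AC] .
  have Icc: "emeasure (interval_measure F) {s..t} = ennreal (F t - F s)" if "s \<le> t" for s t
    using emeasure_interval_measure_Icc[OF that mono cont] by simp
  define H where "H = RN_deriv lborel (interval_measure F)"
  have Hm[measurable]: "H \<in> borel_measurable borel" unfolding H_def by simp
  have dens: "density lborel H = interval_measure F"
    unfolding H_def by (rule sigma_finite_measure.density_RN_deriv[OF sigma_finite_lborel interval_measure_AC[OF assms]]) simp_all
  have HI: "(\<integral>\<^sup>+x\<in>{s..t}. H x \<partial>lborel) = ennreal (F t - F s)" if "s \<le> t" for s t
    using Icc[OF that] unfolding dens[symmetric] by (simp add: emeasure_density)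
  have Hfin: "AE x in lborel. H x \<noteq> \<infinity>"
  proof -
    have sf: "sigma_finite_measure (interval_measure F)"
      by (rule sigma_finite_interval_measure[OF mono])
        (use cont in \<open>auto simp: continuous_on_eq_continuous_within intro: continuous_within_subset\<close>)
    show ?thesis unfolding H_def
      using sigma_finite_measure.RN_deriv_finite[OF sigma_finite_lborel sf interval_measure_AC[OF assms]] by simp
  qed
  define h where "h x = enn2real (H x)" for x
  have hm[measurable]: "h \<in> borel_measurable borel" unfolding h_def by simp
  have hI: "(h has_integral (F t - F s)) {s..t}" if "s \<le> t" for s t
  proof -
    have "(\<integral>\<^sup>+x. ennreal (h x * indicator {s..t} x) \<partial>lborel) = (\<integral>\<^sup>+x\<in>{s..t}. H x \<partial>lborel)"
    proof (rule nn_integral_cong_AE)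
      show "AE x in lborel. ennreal (h x * indicator {s..t} x) = H x * indicator {s..t} x"
        using Hfin
      proof eventually_elim
        case (elim x)
        then show ?case by (auto simp: h_def indicator_def less_top)
      qed
    qed
    also have "\<dots> = ennreal (F t - F s)" using HI[OF that] .
    finally have "((\<lambda>x. h x * indicator {s..t} x) has_integral (F t - F s)) UNIV"
      using mono[OF that] by (intro nn_integral_has_integral) (auto simp: h_def)
    moreover have "(\<lambda>x. h x * indicator {s..t} x) = (\<lambda>x. if x \<in> {s..t} then h x else 0)"
      by (auto simp: indicator_def)
    ultimately show ?thesis using has_integral_restrict_UNIV[of "{s..t}" h] by (simp only:)
  qed
  moreover have "h absolutely_integrable_on {a..b}" for a b
  proof (cases "a \<le> b")
    case True
    show ?thesis using hI[OF True] by (intro nonnegative_absolutely_integrable_1) (auto simp: h_def)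
  qed simp
  ultimately show ?thesis using that by blast
qed

text \<open>
  If \<open>v\<close> is the variation function, then \<open>v + f\<close> and \<open>v - f\<close> are increasing and absolutely continuous. Half the
  difference of their densities is a density for \<open>f\<close>.
\<close>

lemma AC_indefinite_integral:
  fixes f :: "real \<Rightarrow> real"
  assumes AC: "\<And>a b. abs_cont_on a b f"
  obtains g :: "real \<Rightarrow> real" where "\<And>a b. g absolutely_integrable_on {a..b}"
    "\<And>a b. a \<le> b \<Longrightarrow> (g has_integral (f b - f a)) {a..b}"
proof -
  interpret AC_fun f by unfold_locales (rule AC)
  have "variation_fun x + c * f x \<le> variation_fun y + c * f y" if "x \<le> y" "c = 1 \<or> c = -1" for x y c
    using osc_le_variation_fun[OF that(1)] that(2) by auto
  then have mono: "\<And>x y. x \<le> y \<Longrightarrow> variation_fun x + 1 * f x \<le> variation_fun y + 1 * f y" "\<And>x y. x \<le> y \<Longrightarrow> variation_fun x + (-1) * f x \<le> variation_fun y + (-1) * f y"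
    by blast+
  obtain h1 where h1: "\<And>a b. h1 absolutely_integrable_on {a..b}"
    "\<And>a b. a \<le> b \<Longrightarrow> (h1 has_integral ((variation_fun b + 1 * f b) - (variation_fun a + 1 * f a))) {a..b}"
    using mono_AC_density[OF mono(1) AC_add[OF variation_fun_AC AC]] by blast
  obtain h2 where h2: "\<And>a b. h2 absolutely_integrable_on {a..b}"
    "\<And>a b. a \<le> b \<Longrightarrow> (h2 has_integral ((variation_fun b + (-1) * f b) - (variation_fun a + (-1) * f a))) {a..b}"
    using mono_AC_density[OF mono(2) AC_add[OF variation_fun_AC AC]] by blast
  show ?thesis
  proof (rule that[of "\<lambda>x. (1/2) * (h1 x - h2 x)"])
    show "(\<lambda>x. (1/2) * (h1 x - h2 x)) absolutely_integrable_on {a..b}" for a b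
      by (intro set_integrable_mult_right set_integral_diff(1) h1 h2)
    fix a b :: real assume "a \<le> b"
    then have "((\<lambda>x. (1/2) * (h1 x - h2 x)) has_integral ((1/2) * (((variation_fun b + 1 * f b) - (variation_fun a + 1 * f a)) - ((variation_fun b + (-1) * f b) - (variation_fun a + (-1) * f a))))) {a..b}"
      by (intro has_integral_mult_right has_integral_diff h1 h2)
    then show "((\<lambda>x. (1/2) * (h1 x - h2 x)) has_integral (f b - f a)) {a..b}" by (simp add: algebra_simps)
  qed
qed


text \<open>
  An integrable function \<open>g\<close> is, outside a negligible set, the limit of its averages over intervals to the
  right. Applied also to the reflected function \<open>g(-x)\<close>, this gives both one-sided derivatives of an
  indefinite integral of \<open>g\<close>; so \<open>deriv f = g\<close> almost everywhere.
\<close>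

lemma AC_FTC:
  fixes f :: "real \<Rightarrow> real"
  assumes AC: "loc_abs_cont f"
  shows AC_differentiable_ae: "negligible {x. \<not> (f has_real_derivative deriv f x) (at x)}"
    and AC_deriv_abs_integrable: "deriv f absolutely_integrable_on {a..b}"
    and AC_has_integral_deriv: "a \<le> b \<Longrightarrow> (deriv f has_integral (f b - f a)) {a..b}"
proof -
  obtain g where g: "\<And>a b. g absolutely_integrable_on {a..b}"
    "\<And>a b. a \<le> b \<Longrightarrow> (g has_integral (f b - f a)) {a..b}"
    using AC_indefinite_integral[of f] AC unfolding loc_abs_cont_def by blast
  have gi: "g integrable_on cbox a b" for a b
    using g(1) by (simp add: set_lebesgue_integral_eq_integral(1))
  obtain N1 where N1: "negligible N1" "\<And>x e. \<lbrakk>x \<notin> N1; 0 < e\<rbrakk> \<Longrightarrow>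
      \<exists>d>0. \<forall>h. 0 < h \<and> h < d \<longrightarrow> norm (integral (cbox x (x + h *\<^sub>R One)) g /\<^sub>R h ^ DIM(real) - g x) < e"
    using integrable_ccontinuous_explicit[OF gi] by metis
  define g' where "g' x = g (-x)" for x
  have gI: "(g' has_integral (f (-a) - f (-b))) {a..b}" if "a \<le> b" for a b
    unfolding g'_def using g(2)[of "-b" "-a"] that has_integral_reflect_real[of g _ "-a" "-b"] by simp
  have g'i: "g' integrable_on cbox a b" for a b
    using gI[of a b] by (cases "a \<le> b") auto
  obtain N2 where N2: "negligible N2" "\<And>x e. \<lbrakk>x \<notin> N2; 0 < e\<rbrakk> \<Longrightarrow>
      \<exists>d>0. \<forall>h. 0 < h \<and> h < d \<longrightarrow> norm (integral (cbox x (x + h *\<^sub>R One)) g' /\<^sub>R h ^ DIM(real) - g' x) < e"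
    using integrable_ccontinuous_explicit[OF g'i] by metis
  define N where "N = N1 \<union> uminus ` N2"
  have N: "negligible N" unfolding N_def using N1(1) N2(1)
    by (intro negligible_Un negligible_differentiable_image_negligible)
      (auto intro!: linear_imp_differentiable_on linear_uminus)
  have der: "(f has_real_derivative g x) (at x)" if x: "x \<notin> N" for x
    unfolding DERIV_def LIM_eq
  proof (intro allI impI)
    fix e :: real assume e: "0 < e"
    have "x \<notin> N1" "-x \<notin> N2" using x unfolding N_def by (auto simp: image_iff)
    then obtain d1 d2 where
      d1: "d1 > 0" "\<And>h. 0 < h \<Longrightarrow> h < d1 \<Longrightarrow> norm (integral (cbox x (x + h *\<^sub>R One)) g /\<^sub>R h ^ DIM(real) - g x) < e" and
      d2: "d2 > 0" "\<And>h. 0 < h \<Longrightarrow> h < d2 \<Longrightarrow> norm (integral (cbox (-x) (-x + h *\<^sub>R One)) g' /\<^sub>R h ^ DIM(real) - g' (-x)) < e"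
      using N1(2)[of x e] N2(2)[of "-x" e] e by metis
    have R: "\<bar>(f (x + h) - f x) / h - g x\<bar> < e" if "0 < h" "h < d1" for h
      using d1(2)[OF that] integral_unique[OF g(2)[of x "x+h"]] that by (simp add: divide_inverse mult.commute)
    have L: "\<bar>(f x - f (x - h)) / h - g x\<bar> < e" if "0 < h" "h < d2" for h
      using d2(2)[OF that] integral_unique[OF gI[of "-x" "-x+h"]] that by (simp add: divide_inverse mult.commute g'_def)
    show "\<exists>s>0. \<forall>h. h \<noteq> 0 \<and> norm (h - 0) < s \<longrightarrow> norm ((f (x + h) - f x) / h - g x) < e"
    proof (intro exI[of _ "min d1 d2"] conjI allI impI)
      fix h :: real assume h: "h \<noteq> 0 \<and> norm (h - 0) < min d1 d2"
      show "norm ((f (x + h) - f x) / h - g x) < e"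
      proof (cases "h > 0")
        case True
        then show ?thesis using R[of h] h by simp
      next
        case False
        have "(f (x + h) - f x) / h = (f x - f (x - (-h))) / (-h)"
          using h by (simp add: field_simps)
        then show ?thesis using L[of "-h"] h False by simp
      qed
    qed (use d1 d2 in auto)
  qed
  then have dg: "deriv f x = g x" if "x \<notin> N" for x using that DERIV_imp_deriv by blast
  show "negligible {x. \<not> (f has_real_derivative deriv f x) (at x)}"
    by (rule negligible_subset[OF N]) (use der dg in force)
  show "deriv f absolutely_integrable_on {a..b}"
    by (rule absolutely_integrable_spike[OF g(1) N]) (use dg in auto)
  show "a \<le> b \<Longrightarrow> (deriv f has_integral (f b - f a)) {a..b}"
    by (rule has_integral_spike[OF N _ g(2)]) (use dg in auto)
qed

section \<open>Steklov averages\<close>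

lemma Cauchy_Schwarz_mean:
  fixes a :: "real \<Rightarrow> real"
  assumes "a integrable_on {s..t}" "(\<lambda>x. (a x)\<^sup>2) integrable_on {s..t}" "s < t"
  shows "(integral {s..t} a / (t - s))\<^sup>2 \<le> integral {s..t} (\<lambda>x. (a x)\<^sup>2) / (t - s)"
proof -
  define c where "c = integral {s..t} a / (t - s)"
  have ca: "integral {s..t} a = c * (t - s)" using assms(3) by (simp add: c_def)
  have "((\<lambda>x. (a x)\<^sup>2 - 2 * c * a x + c\<^sup>2) has_integral
      (integral {s..t} (\<lambda>x. (a x)\<^sup>2) - 2 * c * integral {s..t} a + (t - s) * c\<^sup>2)) {s..t}"
    using assms has_integral_const_real[of "c\<^sup>2" s t]
    by (intro has_integral_add has_integral_diff has_integral_mult_right integrable_integral) simp_all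
  moreover have "0 \<le> (a x)\<^sup>2 - 2 * c * a x + c\<^sup>2" for x
    using zero_le_power2[of "a x - c"] by (simp add: power2_eq_square algebra_simps)
  ultimately have "0 \<le> integral {s..t} (\<lambda>x. (a x)\<^sup>2) - 2 * c * integral {s..t} a + (t - s) * c\<^sup>2"
    by (rule has_integral_nonneg)
  then have "(t - s) * c\<^sup>2 \<le> integral {s..t} (\<lambda>x. (a x)\<^sup>2)"
    unfolding ca by (simp add: power2_eq_square algebra_simps)
  then show ?thesis unfolding c_def[symmetric] using assms(3) by (simp add: field_simps)
qed


text \<open>
  With \<open>\<Gamma>\<close> an indefinite integral of \<open>a\<^sup>2\<close>, the square of the average of \<open>a\<close> over \<open>[x, x + h]\<close> is at most
  \<open>(\<Gamma>(x + h) - \<Gamma>(x))/h\<close>. Integrating over a period leaves the integral of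
  \<open>\<Gamma>(x + 2\<pi>) - \<Gamma>(x)\<close> over \<open>[0, h]\<close>, divided by \<open>h\<close>; by periodicity this is the integral of \<open>a\<^sup>2\<close> over a
  period. The function \<open>A\<close> is an antiderivative of \<open>a\<close>.
\<close>

lemma Steklov_contraction:
  fixes a :: "real \<Rightarrow> real"
  assumes ai: "\<And>s t. a integrable_on {s..t}" and per: "\<And>x. a (x + 2 * pi) = a x"
    and sq: "(\<lambda>x. (a x)\<^sup>2) integrable_on {0..2*pi}" and h: "0 < h" "h \<le> 2 * pi"
    and A: "continuous_on UNIV A" "\<And>s t. s \<le> t \<Longrightarrow> integral {s..t} a = A t - A s"
  shows "integral {0..2*pi} (\<lambda>x. ((A (x + h) - A x) / h)\<^sup>2) \<le> integral {0..2*pi} (\<lambda>x. (a x)\<^sup>2)"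
proof -
  let ?b = "\<lambda>x. (a x)\<^sup>2" and ?I = "integral {0..2*pi} (\<lambda>x. (a x)\<^sup>2)"
  have shift: "(?b has_integral J) {s + 2*pi..t + 2*pi}" if "(?b has_integral J) {s..t}" for J s t
  proof -
    have "((\<lambda>x. (a (x + (- (2*pi))))\<^sup>2) has_integral J) {s + 2*pi..t + 2*pi}"
      using has_integral_shift_real_ivl[OF that, of "- (2*pi)"] by simp
    moreover have "a (x + (- (2*pi))) = a x" for x using per[of "x - 2*pi"] by simp
    ultimately show ?thesis by simp
  qed
  have "(?b has_integral ?I) {2*pi..4*pi}"
    using shift[OF integrable_integral[OF sq]] by simp
  then have b4: "?b integrable_on {0..4*pi}"
    using has_integral_combine[OF _ _ integrable_integral[OF sq], of "4*pi"] by (auto simp: integrable_on_def)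
  have bi: "?b integrable_on {s..t}" if "0 \<le> s" "t \<le> 4*pi" for s t
    by (rule integrable_on_subinterval[OF b4]) (use that in auto)
  define \<Gamma> where "\<Gamma> x = integral {0..x} ?b" for x
  have \<Gamma>c: "continuous_on S \<Gamma>" if "S \<subseteq> {0..4*pi}" for S
    unfolding \<Gamma>_def using indefinite_integral_continuous_1[OF b4] continuous_on_subset that by blast
  have \<Gamma>d: "integral {s..t} ?b = \<Gamma> t - \<Gamma> s" if "0 \<le> s" "s \<le> t" "t \<le> 4*pi" for s t
    using Henstock_Kurzweil_Integration.integral_combine[of 0 s t ?b] bi[of 0 t] that by (simp add: \<Gamma>_def)
  have \<Gamma>p: "\<Gamma> (x + 2*pi) = \<Gamma> x + ?I" if x: "0 \<le> x" "x \<le> 2*pi" for x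
  proof -
    have "integral {0+2*pi..x + 2*pi} ?b = integral {0..x} ?b"
      using shift[OF integrable_integral[OF bi[of 0 x]]] x by (auto intro: integral_unique)
    then show ?thesis using \<Gamma>d[of "2*pi" "x + 2*pi"] x by (simp add: \<Gamma>_def)
  qed
  have \<Gamma>i: "\<Gamma> integrable_on {s..t}" if "0 \<le> s" "t \<le> 4*pi" for s t
    using that by (intro integrable_continuous_real \<Gamma>c) auto
  have \<Gamma>s: "((\<lambda>x. \<Gamma> (x + c)) has_integral integral {s + c..t + c} \<Gamma>) {s..t}" if "0 \<le> s + c" "t + c \<le> 4*pi" for s t c
    using has_integral_shift_real_ivl[OF integrable_integral[OF \<Gamma>i[OF that]], of c] by simp
  have "integral {h..2*pi+h} \<Gamma> - integral {0..2*pi} \<Gamma> = integral {2*pi..2*pi+h} \<Gamma> - integral {0..h} \<Gamma>"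
    using Henstock_Kurzweil_Integration.integral_combine[of 0 "2*pi" "2*pi+h" \<Gamma>]
      Henstock_Kurzweil_Integration.integral_combine[of 0 h "2*pi+h" \<Gamma>] h \<Gamma>i[of 0 "2*pi+h"] by simp
  also have "integral {2*pi..2*pi+h} \<Gamma> = integral {0..h} (\<lambda>x. \<Gamma> (x + 2*pi))"
    using integral_unique[OF \<Gamma>s[of 0 "2*pi" h]] h by (simp add: add.commute)
  also have "\<dots> = integral {0..h} (\<lambda>x. \<Gamma> x + ?I)"
    using h by (intro integral_cong \<Gamma>p) auto
  also have "\<dots> = integral {0..h} \<Gamma> + h * ?I"
    using has_integral_add[OF integrable_integral[OF \<Gamma>i[of 0 h]] has_integral_const_real[of ?I 0 h]] h
    by (simp add: integral_unique)
  finally have tot: "integral {h..2*pi+h} \<Gamma> - integral {0..2*pi} \<Gamma> = h * ?I" by simp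
  have "((\<lambda>x. 1 / h * (\<Gamma> (x + h) - \<Gamma> x)) has_integral (1 / h * (integral {0+h..2*pi+h} \<Gamma> - integral {0..2*pi} \<Gamma>))) {0..2*pi}"
    using h \<Gamma>i[of 0 "2*pi"] by (intro has_integral_mult_right has_integral_diff \<Gamma>s integrable_integral) auto
  then have R: "((\<lambda>x. 1 / h * (\<Gamma> (x + h) - \<Gamma> x)) has_integral ?I) {0..2*pi}"
    using tot h by simp
  have L: "(\<lambda>x. ((A (x + h) - A x) / h)\<^sup>2) integrable_on {0..2*pi}"
    by (intro integrable_continuous_real continuous_intros continuous_on_compose2[OF A(1)]) (use h in auto)
  show ?thesis
  proof (rule has_integral_le[OF integrable_integral[OF L] R])
    fix x assume x: "x \<in> {0..2*pi}"
    have "(integral {x..x+h} a / (x + h - x))\<^sup>2 \<le> integral {x..x+h} ?b / (x + h - x)"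
      using x h by (intro Cauchy_Schwarz_mean ai bi) auto
    then show "((A (x + h) - A x) / h)\<^sup>2 \<le> 1 / h * (\<Gamma> (x + h) - \<Gamma> x)"
      using x h A(2)[of x "x+h"] \<Gamma>d[of x "x+h"] by simp
  qed
qed

definition Steklov :: "(real \<Rightarrow> real) \<Rightarrow> nat \<Rightarrow> real \<Rightarrow> real" where
  "Steklov u n x = integral {x..x + inverse (real (Suc n))} u / inverse (real (Suc n))"

lemma Steklov_properties:
  fixes u :: "real \<Rightarrow> real"
  assumes u: "continuous_on UNIV u"
  shows Steklov_deriv: "(Steklov u n has_real_derivative (u (x + inverse (real (Suc n))) - u x) / inverse (real (Suc n))) (at x)"
    and Steklov_tendsto: "(\<lambda>n. Steklov u n x) \<longlonglongrightarrow> u x"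
    and Steklov_intermediate: "\<exists>z. Steklov u n x = u z"
    and Steklov_periodic: "(\<And>y. u (y + 2 * pi) = u y) \<Longrightarrow> Steklov u n (x + 2 * pi) = Steklov u n x"
proof -
  obtain G where G: "\<And>x. (G has_real_derivative u x) (at x)"
    using continuous_has_antiderivative[OF u] by blast
  define h where "h n = inverse (real (Suc n))" for n
  have h: "h n > 0" for n by (simp add: h_def)
  have h0: "h \<longlonglongrightarrow> 0" unfolding h_def by (rule LIMSEQ_inverse_real_of_nat)
  have "(u has_integral (G (x + h n) - G x)) {x..x + h n}" for x n
    using G h[of n] by (intro has_integral_of_derivative) auto
  then have S: "Steklov u n x = (G (x + h n) - G x) / h n" for n x
    unfolding Steklov_def h_def[symmetric] by (simp add: integral_unique)
  then have Sf: "Steklov u n = (\<lambda>x. (G (x + h n) - G x) / h n)" for n by auto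
  have "((\<lambda>x. (G (x + h n) - G x) / h n) has_real_derivative (u (x + h n) - u x) / h n) (at x)"
    using G[of "x + h n"] by (intro DERIV_cdivide DERIV_diff G) (simp add: DERIV_shift)
  then show "(Steklov u n has_real_derivative (u (x + inverse (real (Suc n))) - u x) / inverse (real (Suc n))) (at x)"
    unfolding Sf h_def .
  have "((\<lambda>h. (G (x + h) - G x) / h) \<longlongrightarrow> u x) (at 0)" using G[of x] by (simp add: DERIV_def)
  moreover have "filterlim h (at 0) sequentially"
    unfolding filterlim_at using h0 h by (auto simp: less_imp_neq[symmetric])
  ultimately show "(\<lambda>n. Steklov u n x) \<longlonglongrightarrow> u x"
    unfolding S using filterlim_compose[of "\<lambda>h. (G (x + h) - G x) / h"] by blast
  obtain z where "G (x + h n) - G x = (x + h n - x) * u z"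
    using MVT2[of x "x + h n" G u] G h[of n] by auto
  then show "\<exists>z. Steklov u n x = u z" unfolding S using h[of n] by auto
  show "Steklov u n (x + 2 * pi) = Steklov u n x" if per: "\<And>y. u (y + 2 * pi) = u y"
  proof -
    have "((\<lambda>x. G (x + 2*pi) - G x) has_real_derivative 0) (at x)" for x
      using DERIV_diff[OF _ G[of x], of "\<lambda>x. G (x + 2*pi)" "u (x + 2*pi)"] G[of "x + 2*pi"] per[of x]
      by (simp add: DERIV_shift)
    then have "G (x + h n + 2*pi) - G (x + h n) = G (x + 2*pi) - G x"
      using DERIV_isconst_all[of "\<lambda>x. G (x + 2*pi) - G x" "x + h n" x] by blast
    then show ?thesis unfolding S by (simp add: algebra_simps)
  qed
qed

section \<open>The energy inequality for absolutely continuous functions\<close>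

lemma periodic_continuous_bounds:
  fixes f :: "real \<Rightarrow> real"
  assumes f: "continuous_on UNIV f" and per: "\<And>x. f (x + 2 * pi) = f x"
  shows periodic_attains_inf: "\<exists>x0. \<forall>x. f x0 \<le> f x" and periodic_attains_sup: "\<exists>x1. \<forall>x. f x \<le> f x1"
proof -
  have K: "compact {0..2*pi}" "{0..2*pi} \<noteq> {}" by auto
  have fc: "continuous_on {0..2*pi} f" using f by (rule continuous_on_subset) simp
  obtain x0 where x0: "\<And>x. x \<in> {0..2*pi} \<Longrightarrow> f x0 \<le> f x" using continuous_attains_inf[OF K fc] by blast
  obtain x1 where x1: "\<And>x. x \<in> {0..2*pi} \<Longrightarrow> f x \<le> f x1" using continuous_attains_sup[OF K fc] by blast
  have "f x0 \<le> f x \<and> f x \<le> f x1" for x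
  proof -
    obtain k :: int where k: "x + of_int k * (2 * pi) \<in> {0..2*pi}" using periodic_representative by blast
    show ?thesis using x0[OF k] x1[OF k] periodic_int_shift[of f "2*pi", OF per] by simp
  qed
  then show "\<exists>x0. \<forall>x. f x0 \<le> f x" "\<exists>x1. \<forall>x. f x \<le> f x1" by blast+
qed

lemma AC_continuous_on: "loc_abs_cont (f :: real \<Rightarrow> real) \<Longrightarrow> continuous_on A f"
  by (rule continuous_on_subset[OF AC_continuous]) (auto simp: loc_abs_cont_def)

lemma deriv_periodic:
  fixes f :: "real \<Rightarrow> real"
  assumes "\<And>x. f (x + P) = f x"
  shows "deriv f (x + P) = deriv f x"
proof -
  have "(f has_real_derivative D) (at (x + P)) \<longleftrightarrow> (f has_real_derivative D) (at x)" for D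
    using DERIV_shift[of f D x P] assms by simp
  then show ?thesis by (simp add: deriv_def)
qed

text \<open>
  The expression on the left is the Steklov average of \<open>p' + cs\<close>. With \<open>c = \<plusminus>\<alpha>\<close> these are the real and
  imaginary parts of \<open>u' + i\<alpha>u\<close>, and with \<open>c = 0\<close> it is the derivative alone.
\<close>

lemma Steklov_energy:
  fixes p s :: "real \<Rightarrow> real"
  assumes p: "loc_abs_cont p" "\<And>x. p (x + 2 * pi) = p x"
    and s: "continuous_on UNIV s" "\<And>x. s (x + 2 * pi) = s x"
    and sq: "(\<lambda>x. (deriv p x + c * s x)\<^sup>2) integrable_on {0..2*pi}"
  shows "integral {0..2*pi} (\<lambda>x. ((p (x + inverse (real (Suc n))) - p x) / inverse (real (Suc n)) + c * Steklov s n x)\<^sup>2)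
    \<le> integral {0..2*pi} (\<lambda>x. (deriv p x + c * s x)\<^sup>2)"
proof -
  let ?h = "inverse (real (Suc n))"
  obtain G where G: "\<And>x. (G has_real_derivative s x) (at x)"
    using continuous_has_antiderivative[OF s(1)] by blast
  have GI: "(s has_integral (G b - G a)) {a..b}" if "a \<le> b" for a b
    using G that by (intro has_integral_of_derivative) auto
  have aI: "((\<lambda>x. deriv p x + c * s x) has_integral ((p b + c * G b) - (p a + c * G a))) {a..b}" if "a \<le> b" for a b
    using has_integral_add[OF AC_has_integral_deriv[OF p(1) that] has_integral_mult_right[OF GI[OF that], of c]]
    by (simp add: algebra_simps)
  have h: "0 < ?h" "?h \<le> 2 * pi"
  proof -
    have "?h \<le> 1" by (simp add: inverse_le_1_iff)
    then show "0 < ?h" "?h \<le> 2 * pi" using pi_gt3 by simp_all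
  qed
  have Gc: "continuous_on UNIV G" using G by (meson DERIV_isCont continuous_at_imp_continuous_on)
  have "integral {0..2*pi} (\<lambda>x. (((p (x + ?h) + c * G (x + ?h)) - (p x + c * G x)) / ?h)\<^sup>2)
    \<le> integral {0..2*pi} (\<lambda>x. (deriv p x + c * s x)\<^sup>2)"
  proof (rule Steklov_contraction[OF _ _ sq h])
    show "(\<lambda>x. deriv p x + c * s x) integrable_on {a..b}" for a b
      using aI[of a b] by (cases "a \<le> b") (auto simp: integrable_on_def)
    show "continuous_on UNIV (\<lambda>x. p x + c * G x)" by (intro continuous_intros AC_continuous_on p Gc)
  qed (use aI in \<open>auto simp: deriv_periodic[of p "2*pi", OF p(2)] s(2) intro: integral_unique\<close>)
  moreover have "((p (x + ?h) + c * G (x + ?h)) - (p x + c * G x)) / ?h = (p (x + ?h) - p x) / ?h + c * Steklov s n x" for x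
  proof -
    have "Steklov s n x = (G (x + ?h) - G x) / ?h"
      unfolding Steklov_def using GI[of x "x + ?h"] h(1) by (simp add: integral_unique)
    moreover have "((P + c * g) - (P' + c * g')) / k = (P - P') / k + c * ((g - g') / k)" for P P' g g' k :: real
      by (simp add: add_divide_distrib diff_divide_distrib algebra_simps)
    ultimately show ?thesis by simp
  qed
  ultimately show ?thesis by simp
qed

text \<open>
  Steklov averages lie between the minimum and the maximum of \<open>r\<close> and converge to \<open>r\<close>; hence dominated
  convergence applies to the integrals of \<open>r\<^sup>q\<close> and \<open>r\<^sup>-\<^sup>2\<close>, while the integral of \<open>r'\<^sup>2\<close> does not increase.
\<close>

lemma reduced_energy_bound:
  fixes r :: "real \<Rightarrow> real"
  assumes r: "loc_abs_cont r" "\<And>x. r (x + 2 * pi) = r x" and pos: "\<And>x. r x > 0"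
    and sq: "(\<lambda>x. (deriv r x)\<^sup>2) integrable_on {0..2*pi}"
    and q: "2 < q" and \<alpha>: "(q + 2) * \<alpha>\<^sup>2 \<le> 1"
  shows "\<alpha>\<^sup>2 * Lq_square q r \<le> integral {0..2*pi} (\<lambda>x. (deriv r x)\<^sup>2)
    + (2 * pi * \<alpha>)\<^sup>2 / integral {0..2*pi} (\<lambda>x. 1 / (r x)\<^sup>2)"
proof -
  have rc: "continuous_on A r" for A using AC_continuous_on[OF r(1)] .
  obtain x0 x1 where x01: "\<And>x. r x0 \<le> r x" "\<And>x. r x \<le> r x1"
    using periodic_attains_inf[OF rc r(2)] periodic_attains_sup[OF rc r(2)] by blast
  let ?R = "Steklov r" and ?h = "\<lambda>n. inverse (real (Suc n))"
  let ?R' = "\<lambda>n x. (r (x + ?h n) - r x) / ?h n"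
  have bounds: "r x0 \<le> ?R n x \<and> ?R n x \<le> r x1" for n x
    using Steklov_intermediate[OF rc, of n x] x01 by metis
  have Rpos: "0 < ?R n x" for n x using bounds[of n x] pos[of x0] by linarith
  have dR: "(?R n has_real_derivative ?R' n x) (at x)" for n x by (rule Steklov_deriv[OF rc])
  have Rc: "continuous_on A (?R n)" for A n using dR by (meson DERIV_isCont continuous_at_imp_continuous_on)
  have R'c: "continuous_on UNIV (?R' n)" for n
    by (intro continuous_intros continuous_on_compose2[OF rc[of UNIV]]) auto
  have lim: "(\<lambda>n. ?R n x) \<longlonglongrightarrow> r x" for x by (rule Steklov_tendsto[OF rc])
  have ineq: "\<alpha>\<^sup>2 * Lq_square q (?R n) \<le> integral {0..2*pi} (\<lambda>x. (deriv r x)\<^sup>2)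
    + (2 * pi * \<alpha>)\<^sup>2 / integral {0..2*pi} (\<lambda>x. 1 / (?R n x)\<^sup>2)" for n
  proof -
    have "\<alpha>\<^sup>2 * Lq_square q (?R n) \<le> integral {0..2*pi} (\<lambda>x. (?R' n x)\<^sup>2)
      + (2 * pi * \<alpha>)\<^sup>2 / integral {0..2*pi} (\<lambda>x. 1 / (?R n x)\<^sup>2)"
      unfolding Lq_square_def by (rule reduced_energy_bound_C1[OF dR R'c Steklov_periodic[OF rc r(2)] Rpos q \<alpha>])
    moreover have "integral {0..2*pi} (\<lambda>x. (?R' n x)\<^sup>2) \<le> integral {0..2*pi} (\<lambda>x. (deriv r x)\<^sup>2)"
      using Steklov_energy[OF r rc r(2), of 0 n] sq by simp
    ultimately show ?thesis by linarith
  qed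
  have "(\<lambda>n. Lq_square q (?R n)) \<longlonglongrightarrow> Lq_square q r"
    by (rule Lq_square_tendsto[where M = "r x1"]) (use Rc bounds lim q Rpos in \<open>auto simp: less_imp_le\<close>)
  moreover have "(\<lambda>n. integral {0..2*pi} (\<lambda>x. 1 / (?R n x)\<^sup>2)) \<longlonglongrightarrow> integral {0..2*pi} (\<lambda>x. 1 / (r x)\<^sup>2)"
  proof (rule dominated_convergence(2)[OF _ integrable_const_ivl])
    show "(\<lambda>x. 1 / (?R n x)\<^sup>2) integrable_on {0..2*pi}" for n by (rule inverse_square_integrable[OF Rc Rpos])
    show "norm (1 / (?R n x)\<^sup>2) \<le> 1 / (r x0)\<^sup>2" for n x
      using bounds[of n x] pos[of x0] by (simp add: frac_le power_mono)
    show "(\<lambda>n. 1 / (?R n x)\<^sup>2) \<longlonglongrightarrow> 1 / (r x)\<^sup>2" for x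
      using pos[of x] by (intro tendsto_intros lim) simp
  qed
  ultimately show ?thesis using inverse_square_integral_pos[OF rc pos]
    by (intro LIMSEQ_le[OF tendsto_mult_left tendsto_add[OF tendsto_const tendsto_divide[OF tendsto_const]]])
      (use ineq in auto)
qed

text \<open>
  The analogue for \<open>u = p + is\<close>, whose zeros are harmless because the inequality for continuously
  differentiable functions permits them.
\<close>

lemma energy_bound:
  fixes p s :: "real \<Rightarrow> real"
  assumes p: "loc_abs_cont p" "\<And>x. p (x + 2 * pi) = p x" and s: "loc_abs_cont s" "\<And>x. s (x + 2 * pi) = s x"
    and sq: "(\<lambda>x. (deriv p x - \<alpha> * s x)\<^sup>2) integrable_on {0..2*pi}" "(\<lambda>x. (deriv s x + \<alpha> * p x)\<^sup>2) integrable_on {0..2*pi}"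
    and q: "2 < q" and \<alpha>: "\<bar>\<alpha>\<bar> \<le> 1/2" "(q + 2) * \<alpha>\<^sup>2 \<le> 1"
  shows "\<alpha>\<^sup>2 * Lq_square q (\<lambda>x. sqrt ((p x)\<^sup>2 + (s x)\<^sup>2))
    \<le> integral {0..2*pi} (\<lambda>x. (deriv p x - \<alpha> * s x)\<^sup>2) + integral {0..2*pi} (\<lambda>x. (deriv s x + \<alpha> * p x)\<^sup>2)"
proof -
  have pc: "continuous_on A p" "continuous_on A s" for A using AC_continuous_on p s by blast+
  have pc2: "continuous_on UNIV (\<lambda>x. \<bar>p x\<bar> + \<bar>s x\<bar>)" by (intro continuous_intros pc)
  have per2: "\<bar>p (x + 2*pi)\<bar> + \<bar>s (x + 2*pi)\<bar> = \<bar>p x\<bar> + \<bar>s x\<bar>" for x by (simp add: p s)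
  let ?P = "Steklov p" and ?S = "Steklov s" and ?h = "\<lambda>n. inverse (real (Suc n))"
  let ?P' = "\<lambda>n x. (p (x + ?h n) - p x) / ?h n" and ?S' = "\<lambda>n x. (s (x + ?h n) - s x) / ?h n"
  have dP: "(?P n has_real_derivative ?P' n x) (at x)" "(?S n has_real_derivative ?S' n x) (at x)" for n x
    by (rule Steklov_deriv[OF pc(1)], rule Steklov_deriv[OF pc(2)])
  have Pc: "continuous_on A (?P n)" "continuous_on A (?S n)" for A n
    using dP by (meson DERIV_isCont continuous_at_imp_continuous_on)+
  have P'c: "continuous_on A (?P' n)" "continuous_on A (?S' n)" for A n
    by (intro continuous_intros continuous_on_compose2[OF pc(1)[of UNIV]] continuous_on_compose2[OF pc(2)[of UNIV]]; simp)+
  have lim: "(\<lambda>n. ?P n x) \<longlonglongrightarrow> p x" "(\<lambda>n. ?S n x) \<longlonglongrightarrow> s x" for x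
    by (rule Steklov_tendsto[OF pc(1)], rule Steklov_tendsto[OF pc(2)])
  obtain x1 where "\<forall>x. \<bar>p x\<bar> + \<bar>s x\<bar> \<le> \<bar>p x1\<bar> + \<bar>s x1\<bar>"
    using periodic_attains_sup[OF pc2 per2] by (rule exE)
  then have x1: "\<bar>p x\<bar> + \<bar>s x\<bar> \<le> \<bar>p x1\<bar> + \<bar>s x1\<bar>" for x by (rule spec)
  let ?M = "2 * (\<bar>p x1\<bar> + \<bar>s x1\<bar>)"
  have le: "sqrt ((?P n x)\<^sup>2 + (?S n x)\<^sup>2) \<le> ?M" for n x
  proof -
    obtain y z where yz: "?P n x = p y" "?S n x = s z"
      using Steklov_intermediate[OF pc(1), of n x] Steklov_intermediate[OF pc(2), of n x] by blast
    have "\<bar>p y\<bar> \<le> \<bar>p x1\<bar> + \<bar>s x1\<bar>" "\<bar>s z\<bar> \<le> \<bar>p x1\<bar> + \<bar>s x1\<bar>" using x1[of y] x1[of z] by linarith+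
    then have "\<bar>?P n x\<bar> + \<bar>?S n x\<bar> \<le> ?M" unfolding yz mult_2 by (rule add_mono)
    then show ?thesis using sqrt_sum_squares_le_sum_abs[of "?P n x" "?S n x"] by linarith
  qed
  have L: "(\<lambda>n. Lq_square q (\<lambda>x. sqrt ((?P n x)\<^sup>2 + (?S n x)\<^sup>2))) \<longlonglongrightarrow> Lq_square q (\<lambda>x. sqrt ((p x)\<^sup>2 + (s x)\<^sup>2))"
  proof (rule Lq_square_tendsto[where M = ?M])
    show "continuous_on {0..2*pi} (\<lambda>x. sqrt ((?P n x)\<^sup>2 + (?S n x)\<^sup>2))" for n by (intro continuous_intros Pc)
    show "(\<lambda>n. sqrt ((?P n x)\<^sup>2 + (?S n x)\<^sup>2)) \<longlonglongrightarrow> sqrt ((p x)\<^sup>2 + (s x)\<^sup>2)" for x by (intro tendsto_intros lim)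
  qed (use le q in auto)
  have "\<alpha>\<^sup>2 * Lq_square q (\<lambda>x. sqrt ((?P n x)\<^sup>2 + (?S n x)\<^sup>2))
    \<le> integral {0..2*pi} (\<lambda>x. (deriv p x - \<alpha> * s x)\<^sup>2) + integral {0..2*pi} (\<lambda>x. (deriv s x + \<alpha> * p x)\<^sup>2)" for n
  proof -
    have "\<alpha>\<^sup>2 * Lq_square q (\<lambda>x. sqrt ((?P n x)\<^sup>2 + (?S n x)\<^sup>2))
      \<le> integral {0..2*pi} (\<lambda>x. (?P' n x - \<alpha> * ?S n x)\<^sup>2 + (?S' n x + \<alpha> * ?P n x)\<^sup>2)"
      by (rule energy_bound_C1[OF dP P'c Steklov_periodic[OF pc(1) p(2)] Steklov_periodic[OF pc(2) s(2)] q \<alpha>])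
    also have "\<dots> = integral {0..2*pi} (\<lambda>x. (?P' n x - \<alpha> * ?S n x)\<^sup>2) + integral {0..2*pi} (\<lambda>x. (?S' n x + \<alpha> * ?P n x)\<^sup>2)"
      by (intro Henstock_Kurzweil_Integration.integral_add integrable_continuous_real continuous_on_power
          continuous_on_add continuous_on_diff continuous_on_mult_left Pc P'c)
    also have "integral {0..2*pi} (\<lambda>x. (?P' n x - \<alpha> * ?S n x)\<^sup>2) \<le> integral {0..2*pi} (\<lambda>x. (deriv p x - \<alpha> * s x)\<^sup>2)"
      using Steklov_energy[OF p pc(2) s(2), of "-\<alpha>" n] sq(1) by simp
    also have "integral {0..2*pi} (\<lambda>x. (?S' n x + \<alpha> * ?P n x)\<^sup>2) \<le> integral {0..2*pi} (\<lambda>x. (deriv s x + \<alpha> * p x)\<^sup>2)"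
      using Steklov_energy[OF s pc(1) p(2), of \<alpha> n] sq(2) by simp
    finally show ?thesis by simp
  qed
  then show ?thesis by (intro LIMSEQ_le_const2[OF tendsto_mult_left[OF L]]) blast
qed

section \<open>The two minimization problems\<close>

text \<open>
  Links the integrals of the problem, which may be infinite, to gauge integrals, in terms of which the
  inequalities above are stated.
\<close>

lemma nn_integral_finite_HK:
  fixes f :: "real \<Rightarrow> real"
  assumes m: "(\<lambda>x. f x * indicator S x) \<in> borel_measurable lebesgue" and nonneg: "\<And>x. 0 \<le> f x"
    and fin: "(\<integral>\<^sup>+x\<in>S. ennreal (f x) \<partial>lebesgue) \<noteq> top"
  shows "f integrable_on S" and "(\<integral>\<^sup>+x\<in>S. ennreal (f x) \<partial>lebesgue) = ennreal (integral S f)"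
proof -
  let ?F = "\<lambda>x. f x * indicator S x"
  have eq: "(\<integral>\<^sup>+x\<in>S. ennreal (f x) \<partial>lebesgue) = (\<integral>\<^sup>+x. ennreal (?F x) \<partial>lebesgue)"
    by (intro nn_integral_cong) (auto simp: indicator_def)
  obtain c where c: "0 \<le> c" "(\<integral>\<^sup>+x. ennreal (?F x) \<partial>lebesgue) = ennreal c"
    using fin unfolding eq by (cases "\<integral>\<^sup>+x. ennreal (?F x) \<partial>lebesgue") auto
  have "(?F has_integral c) UNIV"
    by (subst has_integral_iff_nn_integral_lebesgue) (use c m nonneg in \<open>auto simp: indicator_def\<close>)
  moreover have "?F = (\<lambda>x. if x \<in> S then f x else 0)" by (auto simp: indicator_def)
  ultimately have h: "(f has_integral c) S" using has_integral_restrict_UNIV[of S f c] by (simp only:)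
  then show "f integrable_on S" by (auto simp: integrable_on_def)
  show "(\<integral>\<^sup>+x\<in>S. ennreal (f x) \<partial>lebesgue) = ennreal (integral S f)"
    using h c unfolding eq by (simp add: integral_unique)
qed

lemma nn_integral_sum_HK:
  fixes f g :: "real \<Rightarrow> real"
  assumes m: "(\<lambda>x. f x * indicator S x) \<in> borel_measurable lebesgue" "(\<lambda>x. g x * indicator S x) \<in> borel_measurable lebesgue"
    and nonneg: "\<And>x. 0 \<le> f x" "\<And>x. 0 \<le> g x"
    and fin: "(\<integral>\<^sup>+x\<in>S. ennreal (f x + g x) \<partial>lebesgue) \<noteq> top"
  shows "f integrable_on S" "g integrable_on S"
    "(\<integral>\<^sup>+x\<in>S. ennreal (f x + g x) \<partial>lebesgue) = ennreal (integral S f + integral S g)"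
proof -
  let ?I = "\<integral>\<^sup>+x\<in>S. ennreal (f x + g x) \<partial>lebesgue"
  have "(\<integral>\<^sup>+x\<in>S. ennreal (f x) \<partial>lebesgue) \<le> ?I" "(\<integral>\<^sup>+x\<in>S. ennreal (g x) \<partial>lebesgue) \<le> ?I"
    using nonneg by (auto intro!: nn_integral_mono mult_right_mono ennreal_leI)
  then have "(\<integral>\<^sup>+x\<in>S. ennreal (f x) \<partial>lebesgue) \<noteq> top" "(\<integral>\<^sup>+x\<in>S. ennreal (g x) \<partial>lebesgue) \<noteq> top"
    using fin by (metis top.extremum_uniqueI)+
  then show i: "f integrable_on S" "g integrable_on S" using nn_integral_finite_HK(1) m nonneg by blast+
  have "(\<lambda>x. (f x + g x) * indicator S x) \<in> borel_measurable lebesgue"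
    using borel_measurable_add[OF m] by (simp add: distrib_right)
  then have "?I = ennreal (integral S (\<lambda>x. f x + g x))"
    by (rule nn_integral_finite_HK(2)[OF _ _ fin]) (simp add: nonneg)
  then show "?I = ennreal (integral S f + integral S g)"
    by (simp only: Henstock_Kurzweil_Integration.integral_add[OF i])
qed

lemma nn_integral_continuous:
  fixes f :: "real \<Rightarrow> real"
  assumes f: "continuous_on UNIV f" "\<And>x. 0 \<le> f x"
  shows "(\<integral>\<^sup>+x\<in>{a..b}. ennreal (f x) \<partial>lebesgue) = ennreal (integral {a..b} f)"
proof -
  have fb: "f \<in> borel_measurable borel" using f(1) by (rule borel_measurable_continuous_onI)
  have "((\<lambda>x. if x \<in> {a..b} then f x else 0) has_integral integral {a..b} f) UNIV"
    unfolding has_integral_restrict_UNIV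
    by (intro integrable_integral integrable_continuous_real continuous_on_subset[OF f(1)]) simp
  moreover have "(\<lambda>x. if x \<in> {a..b} then f x else 0) = (\<lambda>x. f x * indicator {a..b} x)" by (auto simp: indicator_def)
  ultimately have "((\<lambda>x. f x * indicator {a..b} x) has_integral integral {a..b} f) UNIV" by simp
  then have "(\<integral>\<^sup>+x. ennreal (f x * indicator {a..b} x) \<partial>lebesgue) = ennreal (integral {a..b} f)"
    using f(2) by (subst (asm) has_integral_iff_nn_integral_lebesgue) (auto simp: indicator_def)
  moreover have "(\<integral>\<^sup>+x\<in>{a..b}. ennreal (f x) \<partial>lebesgue) = (\<integral>\<^sup>+x. ennreal (f x * indicator {a..b} x) \<partial>lebesgue)"
    by (intro nn_integral_cong) (auto simp: indicator_def)
  ultimately show ?thesis by simp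
qed

lemma loc_abs_cont_linear: "loc_abs_cont (\<lambda>x. c * x :: real)"
  unfolding loc_abs_cont_def abs_cont_on_def
proof (intro allI impI)
  fix a b \<epsilon> :: real assume e: "\<epsilon> > 0"
  show "\<exists>\<delta>>0. \<forall>d. d division_of \<Union> d \<and> \<Union> d \<subseteq> {a..b} \<and> (\<Sum>k\<in>d. Sup k - Inf k) < \<delta> \<longrightarrow>
      (\<Sum>k\<in>d. norm (c * Sup k - c * Inf k)) < \<epsilon>"
  proof (intro exI[of _ "\<epsilon> / (\<bar>c\<bar> + 1)"] conjI allI impI)
    show "\<epsilon> / (\<bar>c\<bar> + 1) > 0" using e by simp
    fix d assume d: "d division_of \<Union> d \<and> \<Union> d \<subseteq> {a..b} \<and> (\<Sum>k\<in>d. Sup k - Inf k) < \<epsilon> / (\<bar>c\<bar> + 1)"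
    then have p: "interval_packing {a..b} d" by (simp add: interval_packing_def)
    have k: "Inf k \<le> Sup k" if "k \<in> d" for k using packing_member[OF p that] by fastforce
    have "(\<Sum>k\<in>d. norm (c * Sup k - c * Inf k)) = (\<Sum>k\<in>d. \<bar>c\<bar> * (Sup k - Inf k))"
      using k by (intro sum.cong) (simp_all add: right_diff_distrib[symmetric] abs_mult)
    also have "\<dots> = \<bar>c\<bar> * (\<Sum>k\<in>d. Sup k - Inf k)" by (simp add: sum_distrib_left)
    also have "\<dots> \<le> (\<bar>c\<bar> + 1) * (\<Sum>k\<in>d. Sup k - Inf k)"
      using k by (intro mult_right_mono sum_nonneg) auto
    also have "\<dots> < (\<bar>c\<bar> + 1) * (\<epsilon> / (\<bar>c\<bar> + 1))" using d by (intro mult_strict_left_mono) auto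
    also have "\<dots> = \<epsilon>" by simp
    finally show "(\<Sum>k\<in>d. norm (c * Sup k - c * Inf k)) < \<epsilon>" .
  qed
qed

lemma loc_abs_cont_const: "loc_abs_cont (\<lambda>x. c)"
  unfolding loc_abs_cont_def abs_cont_on_def by (auto intro: exI[of _ 1])

lemma loc_abs_cont_Re_Im:
  assumes "loc_abs_cont (u :: real \<Rightarrow> complex)"
  shows "loc_abs_cont (\<lambda>x. Re (u x))" "loc_abs_cont (\<lambda>x. Im (u x))"
proof -
  have *: "loc_abs_cont (\<lambda>x. L (u x))" if L: "\<And>z w. \<bar>L z - L w\<bar> \<le> norm (z - w)" for L :: "complex \<Rightarrow> real"
    unfolding loc_abs_cont_def abs_cont_on_def
  proof (intro allI impI)
    fix a b \<epsilon> :: real assume e: "\<epsilon> > 0"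
    obtain \<delta> where \<delta>: "\<delta> > 0" "\<And>d. d division_of \<Union>d \<and> \<Union>d \<subseteq> {a..b} \<and> (\<Sum>k\<in>d. Sup k - Inf k) < \<delta> \<Longrightarrow>
        (\<Sum>k\<in>d. norm (u (Sup k) - u (Inf k))) < \<epsilon>"
      using assms e unfolding loc_abs_cont_def abs_cont_on_def by meson
    show "\<exists>\<delta>>0. \<forall>d. d division_of \<Union> d \<and> \<Union> d \<subseteq> {a..b} \<and> (\<Sum>k\<in>d. Sup k - Inf k) < \<delta> \<longrightarrow>
      (\<Sum>k\<in>d. norm (L (u (Sup k)) - L (u (Inf k)))) < \<epsilon>"
    proof (intro exI[of _ \<delta>] conjI allI impI)
      fix d assume d: "d division_of \<Union> d \<and> \<Union> d \<subseteq> {a..b} \<and> (\<Sum>k\<in>d. Sup k - Inf k) < \<delta>"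
      have "(\<Sum>k\<in>d. norm (L (u (Sup k)) - L (u (Inf k)))) \<le> (\<Sum>k\<in>d. norm (u (Sup k) - u (Inf k)))"
        using L by (intro sum_mono) simp
      also have "\<dots> < \<epsilon>" using \<delta>(2)[OF d] .
      finally show "(\<Sum>k\<in>d. norm (L (u (Sup k)) - L (u (Inf k)))) < \<epsilon>" .
    qed (rule \<delta>(1))
  qed
  show "loc_abs_cont (\<lambda>x. Re (u x))" "loc_abs_cont (\<lambda>x. Im (u x))"
    using *[of Re] *[of Im] abs_Re_le_cmod abs_Im_le_cmod by (metis minus_complex.sel)+
qed

text \<open>
  Absolute integrability gives measurability of \<open>f\<close> only on \<open>S\<close>, so the indicator has to be moved inside
  the square.
\<close>

lemma square_indicator_measurable:
  fixes f g h :: "real \<Rightarrow> real"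
  assumes f: "f absolutely_integrable_on S" and c: "continuous_on UNIV g" "continuous_on UNIV h" and S: "S \<in> sets lebesgue"
  shows "(\<lambda>x. (h x * f x + g x)\<^sup>2 * indicator S x) \<in> borel_measurable lebesgue"
proof -
  have cm: "k \<in> borel_measurable lebesgue" if "continuous_on UNIV k" for k :: "real \<Rightarrow> real"
    using borel_measurable_continuous_onI[OF that] by (intro measurable_completion) simp
  have fm: "(\<lambda>x. indicator S x * f x) \<in> borel_measurable lebesgue"
    using f borel_measurable_integrable unfolding set_integrable_def by fastforce
  have "(\<lambda>x. (h x * (indicator S x * f x) + g x)\<^sup>2) \<in> borel_measurable lebesgue"
    by (rule borel_measurable_power[OF borel_measurable_add[OF borel_measurable_times[OF cm[OF c(2)] fm] cm[OF c(1)]]])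
  then have "(\<lambda>x. (h x * (indicator S x * f x) + g x)\<^sup>2 * indicator S x) \<in> borel_measurable lebesgue"
    by (rule borel_measurable_times) (rule borel_measurable_indicator[OF S])
  moreover have "(\<lambda>x. (h x * (indicator S x * f x) + g x)\<^sup>2 * indicator S x) = (\<lambda>x. (h x * f x + g x)\<^sup>2 * indicator S x)"
    by (auto simp: indicator_def)
  ultimately show ?thesis by simp
qed

text \<open>
  The Lebesgue integral of a function that is not integrable is \<open>0\<close> by convention.
\<close>

lemma abs_integrable_of_nonzero_integral:
  fixes f :: "real \<Rightarrow> real"
  shows "(LINT x:S|lebesgue. f x) \<noteq> 0 \<Longrightarrow> f absolutely_integrable_on S"
  unfolding set_integrable_def set_lebesgue_integral_def using not_integrable_integral_eq by blast

text \<open>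
  For \<open>\<alpha> \<noteq> 0\<close> the prescribed integral of \<open>deriv \<phi>\<close> is not \<open>0\<close>, which makes \<open>deriv \<phi>\<close> integrable. The phase enters
  only through that integral, by the Cauchy-Schwarz inequality.
\<close>

lemma J_lower_bound:
  assumes q: "2 < q" and \<alpha>: "(q + 2) * \<alpha>\<^sup>2 \<le> 1" and adm: "admissible q \<alpha> r \<phi>"
  shows "ennreal (2 * pi * \<alpha>\<^sup>2) \<le> J r \<phi>"
proof (cases "\<alpha> = 0 \<or> J r \<phi> = top")
  case True
  then show ?thesis by auto
next
  case False
  have pos: "r x > 0" and per: "r (x + 2*pi) = r x" and rAC: "loc_abs_cont r" for x
    using adm by (auto simp: admissible_def periodic_2pi_def)
  have I\<phi>: "(LINT x:{0..2*pi}|lebesgue. deriv \<phi> x) = 2 * pi * \<alpha>" and Ir: "(LINT x:{0..2*pi}|lebesgue. r x powr q) = 2 * pi"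
    using adm by (auto simp: admissible_def)
  have rc: "continuous_on A r" for A using AC_continuous_on[OF rAC] .
  have s\<phi>: "deriv \<phi> absolutely_integrable_on {0..2*pi}"
    using I\<phi> False by (intro abs_integrable_of_nonzero_integral) simp
  then have h\<phi>: "(deriv \<phi> has_integral 2 * pi * \<alpha>) {0..2*pi}"
    using has_integral_set_lebesgue[OF s\<phi>] I\<phi> by simp
  have sr: "(\<lambda>x. r x powr q) absolutely_integrable_on {0..2*pi}"
    using Ir by (intro abs_integrable_of_nonzero_integral) simp
  have Lq: "Lq_square q r = 2 * pi"
    using set_lebesgue_integral_eq_integral(2)[OF sr] Ir by (simp add: Lq_square_def)
  have m: "(\<lambda>x. (deriv r x)\<^sup>2 * indicator {0..2*pi} x) \<in> borel_measurable lebesgue"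
      "(\<lambda>x. (r x)\<^sup>2 * (deriv \<phi> x)\<^sup>2 * indicator {0..2*pi} x) \<in> borel_measurable lebesgue"
    using square_indicator_measurable[OF AC_deriv_abs_integrable[OF rAC], of "\<lambda>_. 0" "\<lambda>_. 1" 0 "2*pi"]
      square_indicator_measurable[OF s\<phi>, of "\<lambda>_. 0" r] rc by (simp_all add: power_mult_distrib)
  have nn: "0 \<le> (r x)\<^sup>2 * (deriv \<phi> x)\<^sup>2" for x by simp
  have "(\<integral>\<^sup>+x\<in>{0..2*pi}. ennreal ((deriv r x)\<^sup>2 + (r x)\<^sup>2 * (deriv \<phi> x)\<^sup>2) \<partial>lebesgue) \<noteq> top"
    using False by (simp add: J_def)
  note HK = nn_integral_sum_HK[OF m zero_le_power2 nn this]
  note i1 = HK(1) and i2 = HK(2)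
  have J': "J r \<phi> = ennreal (integral {0..2*pi} (\<lambda>x. (deriv r x)\<^sup>2) + integral {0..2*pi} (\<lambda>x. (r x)\<^sup>2 * (deriv \<phi> x)\<^sup>2))"
    unfolding J_def by (rule HK(3))
  have "2 * pi * \<alpha>\<^sup>2 = \<alpha>\<^sup>2 * Lq_square q r" by (simp add: Lq)
  also have "\<dots> \<le> integral {0..2*pi} (\<lambda>x. (deriv r x)\<^sup>2) + (2 * pi * \<alpha>)\<^sup>2 / integral {0..2*pi} (\<lambda>x. 1 / (r x)\<^sup>2)"
    by (rule reduced_energy_bound[OF rAC per pos i1 q \<alpha>])
  also have "(2 * pi * \<alpha>)\<^sup>2 / integral {0..2*pi} (\<lambda>x. 1 / (r x)\<^sup>2) \<le> integral {0..2*pi} (\<lambda>x. (r x)\<^sup>2 * (deriv \<phi> x)\<^sup>2)"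
    by (rule phase_energy_bound[OF rc pos h\<phi> i2])
  finally show ?thesis unfolding J' by (simp add: ennreal_leI)
qed

lemma J_minimizer:
  assumes q: "2 < q" and \<alpha>: "(q + 2) * \<alpha>\<^sup>2 \<le> 1"
  shows "is_arg_min (\<lambda>(r, \<psi>). J r \<psi>) (\<lambda>(r, \<psi>). admissible q \<alpha> r \<psi>) (\<lambda>_. 1, \<lambda>x. \<alpha> * x)"
proof -
  have d: "deriv (\<lambda>x. \<alpha> * x) = (\<lambda>x. \<alpha>)"
  proof
    fix x
    have "((\<lambda>x. \<alpha> * x) has_real_derivative \<alpha>) (at x)" by (auto intro!: derivative_eq_intros)
    then show "deriv (\<lambda>x. \<alpha> * x) x = \<alpha>" by (rule DERIV_imp_deriv)
  qed
  have "admissible q \<alpha> (\<lambda>_. 1) (\<lambda>x. \<alpha> * x)"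
    unfolding admissible_def d
    by (auto simp: periodic_2pi_def loc_abs_cont_const loc_abs_cont_linear set_lebesgue_integral_def)
  moreover have "J (\<lambda>_. 1) (\<lambda>x. \<alpha> * x) = ennreal (2 * pi * \<alpha>\<^sup>2)"
    unfolding J_def d using nn_integral_continuous[of "\<lambda>x. \<alpha>\<^sup>2" 0 "2*pi"] by simp
  ultimately show ?thesis
    unfolding is_arg_min_def using J_lower_bound[OF q \<alpha>] by (auto simp: not_less)
qed

lemma AE_lebesgue_Ioo_Icc:
  assumes "AE x in lebesgue. P x"
  shows "AE x in lebesgue. P x \<and> (indicator {0<..<2*pi} x :: ennreal) = indicator {0..2*pi} x"
proof -
  have "AE x in lebesgue. x \<notin> {0, 2*pi :: real}"
    by (rule AE_not_in) (auto simp: negligible_iff_null_sets[symmetric])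
  then show ?thesis using assms
  proof eventually_elim
    case (elim x)
    then show ?case by (auto simp: indicator_def)
  qed
qed

text \<open>
  Replaces the open interval by the closed one and the integrand by a representative; both changes
  concern null sets.
\<close>

lemma Lp_norm_cong_AE:
  assumes "AE x in lebesgue. cmod (f x) powr p = F x"
    and "(\<integral>\<^sup>+x\<in>{0..2*pi}. ennreal (F x) \<partial>lebesgue) = I"
  shows "Lp_norm p f = (if I = top then top else ennreal (enn2real I powr (1 / p)))"
proof -
  have "(\<integral>\<^sup>+x\<in>{0<..<2*pi}. ennreal (cmod (f x) powr p) \<partial>lebesgue) = (\<integral>\<^sup>+x\<in>{0..2*pi}. ennreal (F x) \<partial>lebesgue)"
  proof (rule nn_integral_cong_AE)
    show "AE x in lebesgue. ennreal (cmod (f x) powr p) * indicator {0<..<2*pi} x = ennreal (F x) * indicator {0..2*pi} x"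
      using AE_lebesgue_Ioo_Icc[OF assms(1)] by eventually_elim simp
  qed
  then show ?thesis unfolding Lp_norm_def assms(2) Let_def by simp
qed

text \<open>
  If \<open>u' + i\<alpha>u\<close> is not square integrable the quotient is \<open>\<infinity>\<close>: the denominator is finite and, by continuity
  of \<open>u \<noteq> 0\<close>, positive. Otherwise take square roots in \<open>energy_bound\<close>.
\<close>

lemma mu_quotient_lower_bound:
  assumes q: "2 < q" and \<alpha>: "\<bar>\<alpha>\<bar> \<le> 1/2" "(q + 2) * \<alpha>\<^sup>2 \<le> 1" and u: "competitor u"
  shows "ennreal ((2 * pi) powr (1 / 2 - 1 / q) * \<bar>\<alpha>\<bar>) \<le> mu_quotient q \<alpha> u"
proof -
  define p s where "p x = Re (u x)" and "s x = Im (u x)" for x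
  have AC: "loc_abs_cont p" "loc_abs_cont s"
    using loc_abs_cont_Re_Im[of u] u unfolding p_def s_def competitor_def by auto
  have per: "p (x + 2*pi) = p x" "s (x + 2*pi) = s x" for x
    using u by (auto simp: p_def s_def competitor_def periodic_2pi_def)
  have c: "continuous_on A p" "continuous_on A s" for A using AC_continuous_on AC by blast+
  define r where "r x = sqrt ((p x)\<^sup>2 + (s x)\<^sup>2)" for x
  have r: "cmod (u x) = r x" for x by (simp add: r_def p_def s_def cmod_def)
  have rc: "continuous_on A r" for A unfolding r_def by (intro continuous_intros c)
  have rq: "continuous_on A (\<lambda>x. r x powr q)" for A
    using q by (intro continuous_on_powr' rc continuous_on_const) (auto simp: r_def)
  define B where "B = integral {0..2*pi} (\<lambda>x. r x powr q)"
  have B: "B > 0"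
  proof -
    have "B \<ge> 0" unfolding B_def by (intro integral_nonneg integrable_continuous_real rq) simp
    moreover have "B \<noteq> 0"
    proof
      assume "B = 0"
      then have z: "\<forall>x\<in>{0..2*pi}. r x powr q = 0"
        unfolding B_def using integral_eq_0_iff[OF rq, of 0 "2*pi"] by simp
      obtain y where y: "u y \<noteq> 0" using u by (auto simp: competitor_def)
      obtain k :: int where k: "y + of_int k * (2 * pi) \<in> {0..2*pi}" using periodic_representative by blast
      have "r (y + of_int k * (2*pi)) = r y" by (rule periodic_int_shift) (simp add: r_def per)
      then have "r y = 0" using z k by force
      then show False using y r[of y] by simp
    qed
    ultimately show ?thesis by simp
  qed
  have Nq: "Lp_norm q u = ennreal (B powr (1/q))"
  proof -
    have "(\<integral>\<^sup>+x\<in>{0..2*pi}. ennreal (r x powr q) \<partial>lebesgue) = ennreal B"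
      unfolding B_def by (rule nn_integral_continuous[OF rq]) simp
    from Lp_norm_cong_AE[of u q "\<lambda>x. r x powr q", OF _ this] show ?thesis using B by (simp add: r)
  qed
  define a b where "a x = deriv p x - \<alpha> * s x" and "b x = deriv s x + \<alpha> * p x" for x
  let ?v = "\<lambda>x. vector_derivative u (at x) + \<i> * of_real \<alpha> * u x"
  have AE: "AE x in lebesgue. cmod (?v x) powr 2 = (a x)\<^sup>2 + (b x)\<^sup>2"
  proof -
    have "AE x in lebesgue. (p has_real_derivative deriv p x) (at x)" "AE x in lebesgue. (s has_real_derivative deriv s x) (at x)"
      using AC_differentiable_ae[OF AC(1)] AC_differentiable_ae[OF AC(2)]
      by (auto simp: negligible_iff_null_sets AE_iff_null_sets eventually_ae_filter)
    then show ?thesis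
    proof eventually_elim
      case (elim x)
      have "(u has_vector_derivative Complex (deriv p x) (deriv s x)) (at x)"
        unfolding has_vector_derivative_complex_iff using elim
        by (simp add: p_def[abs_def] s_def[abs_def] has_real_derivative_iff_has_vector_derivative)
      then have "vector_derivative u (at x) = Complex (deriv p x) (deriv s x)" by (rule vector_derivative_at)
      then show ?case by (simp add: cmod_def a_def b_def p_def s_def)
    qed
  qed
  have m: "(\<lambda>x. (a x)\<^sup>2 * indicator {0..2*pi} x) \<in> borel_measurable lebesgue"
      "(\<lambda>x. (b x)\<^sup>2 * indicator {0..2*pi} x) \<in> borel_measurable lebesgue"
    using square_indicator_measurable[OF AC_deriv_abs_integrable[OF AC(1)], of "\<lambda>x. - \<alpha> * s x" "\<lambda>_. 1" 0 "2*pi"]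
      square_indicator_measurable[OF AC_deriv_abs_integrable[OF AC(2)], of "\<lambda>x. \<alpha> * p x" "\<lambda>_. 1" 0 "2*pi"]
      continuous_on_mult_left[OF c(1)] continuous_on_minus[OF continuous_on_mult_left[OF c(2)]]
    by (simp_all add: a_def b_def)
  define I where "I = (\<integral>\<^sup>+x\<in>{0..2*pi}. ennreal ((a x)\<^sup>2 + (b x)\<^sup>2) \<partial>lebesgue)"
  have N2: "Lp_norm 2 ?v = (if I = top then top else ennreal (enn2real I powr (1 / 2)))"
    by (rule Lp_norm_cong_AE[OF AE I_def[symmetric]])
  show ?thesis
  proof (cases "I = top")
    case True
    then show ?thesis unfolding mu_quotient_def N2 Nq by (simp add: ennreal_top_divide)
  next
    case False
    note HK = nn_integral_sum_HK[OF m zero_le_power2 zero_le_power2 False[unfolded I_def]]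
    note ia = HK(1) and ib = HK(2)
    define A where "A = integral {0..2*pi} (\<lambda>x. (a x)\<^sup>2) + integral {0..2*pi} (\<lambda>x. (b x)\<^sup>2)"
    have IA: "I = ennreal A" unfolding I_def A_def by (rule HK(3))
    have A0: "0 \<le> A" unfolding A_def by (intro add_nonneg_nonneg integral_nonneg ia ib) simp_all
    have "\<alpha>\<^sup>2 * Lq_square q r \<le> A"
      unfolding A_def r_def[abs_def]
      using energy_bound[OF AC(1) per(1) AC(2) per(2) _ _ q \<alpha>] ia ib unfolding a_def b_def by simp
    then have le: "\<alpha>\<^sup>2 * (2 * pi * (B / (2*pi)) powr (2/q)) \<le> A" unfolding Lq_square_def B_def .
    have "((2 * pi) powr (1/2 - 1/q) * \<bar>\<alpha>\<bar> * B powr (1/q))\<^sup>2 = \<alpha>\<^sup>2 * (2 * pi * (B / (2*pi)) powr (2/q))"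
    proof -
      have "((2 * pi) powr (1/2 - 1/q))\<^sup>2 = (2*pi) powr (1 - 2/q)" "(B powr (1/q))\<^sup>2 = B powr (2/q)"
        by (simp_all add: power2_eq_square powr_add[symmetric])
      moreover have "(2*pi) powr (1 - 2/q) = 2 * pi / (2*pi) powr (2/q)" by (simp add: powr_diff)
      ultimately show ?thesis using B by (simp add: power_mult_distrib powr_divide)
    qed
    then have "((2 * pi) powr (1/2 - 1/q) * \<bar>\<alpha>\<bar> * B powr (1/q))\<^sup>2 \<le> (A powr (1/2))\<^sup>2"
      using le A0 by (simp add: powr_half_sqrt)
    then have "(2 * pi) powr (1/2 - 1/q) * \<bar>\<alpha>\<bar> * B powr (1/q) \<le> A powr (1/2)"
      by (rule power2_le_imp_le) simp
    then have "(2 * pi) powr (1/2 - 1/q) * \<bar>\<alpha>\<bar> \<le> A powr (1/2) / B powr (1/q)"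
      using B by (simp add: pos_le_divide_eq)
    then have "ennreal ((2 * pi) powr (1/2 - 1/q) * \<bar>\<alpha>\<bar>) \<le> ennreal (A powr (1/2) / B powr (1/q))"
      by (rule ennreal_leI)
    also have "\<dots> = ennreal (A powr (1/2)) / ennreal (B powr (1/q))"
      using B by (intro divide_ennreal[symmetric]) auto
    finally show ?thesis unfolding mu_quotient_def N2 Nq using False IA A0 by simp
  qed
qed

lemma mu_quotient_one:
  assumes q: "2 < q"
  shows "competitor (\<lambda>_. 1)" and "mu_quotient q \<alpha> (\<lambda>_. 1) = ennreal ((2 * pi) powr (1 / 2 - 1 / q) * \<bar>\<alpha>\<bar>)"
proof -
  show "competitor (\<lambda>_. 1)" by (simp add: competitor_def loc_abs_cont_const periodic_2pi_def)
  have "(\<integral>\<^sup>+x\<in>{0..2*pi}. ennreal 1 \<partial>lebesgue) = ennreal (2*pi)"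
    using nn_integral_continuous[of "\<lambda>x. 1" 0 "2*pi"] by simp
  from Lp_norm_cong_AE[of "\<lambda>_. 1" q "\<lambda>x. 1", OF _ this]
  have Nq: "Lp_norm q (\<lambda>_. 1) = ennreal ((2*pi) powr (1/q))" by simp
  have "(\<integral>\<^sup>+x\<in>{0..2*pi}. ennreal (\<alpha>\<^sup>2) \<partial>lebesgue) = ennreal (2*pi*\<alpha>\<^sup>2)"
    using nn_integral_continuous[of "\<lambda>x. \<alpha>\<^sup>2" 0 "2*pi"] by simp
  from Lp_norm_cong_AE[of "\<lambda>x. vector_derivative (\<lambda>_. 1) (at x) + \<i> * of_real \<alpha> * 1" 2 "\<lambda>x. \<alpha>\<^sup>2", OF _ this]
  have N2: "Lp_norm 2 (\<lambda>x. vector_derivative (\<lambda>_. 1) (at x) + \<i> * of_real \<alpha> * 1) = ennreal ((2*pi*\<alpha>\<^sup>2) powr (1/2))"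
    by (simp add: norm_mult)
  have "(2*pi*\<alpha>\<^sup>2) powr (1/2) / (2*pi) powr (1/q) = (2 * pi) powr (1 / 2 - 1 / q) * \<bar>\<alpha>\<bar>"
    by (simp add: powr_diff powr_mult powr_half_sqrt)
  then show "mu_quotient q \<alpha> (\<lambda>_. 1) = ennreal ((2 * pi) powr (1 / 2 - 1 / q) * \<bar>\<alpha>\<bar>)"
    unfolding mu_quotient_def N2 Nq by (subst divide_ennreal) simp_all
qed

theorem theorem2p2:
  fixes q \<alpha> :: real
  assumes "2 < q" and "\<bar>\<alpha>\<bar> \<le> 1 / 2" and "(q + 2) * \<alpha>\<^sup>2 \<le> 1"
  shows "(\<exists>\<phi>. is_arg_min (\<lambda>(r, \<psi>). J r \<psi>) (\<lambda>(r, \<psi>). admissible q \<alpha> r \<psi>) (\<lambda>_. 1, \<phi>)) \<and>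
         mu q \<alpha> = ennreal ((2 * pi) powr (1 / 2 - 1 / q) * \<bar>\<alpha>\<bar>)"
proof
  show "\<exists>\<phi>. is_arg_min (\<lambda>(r, \<psi>). J r \<psi>) (\<lambda>(r, \<psi>). admissible q \<alpha> r \<psi>) (\<lambda>_. 1, \<phi>)"
    using J_minimizer[OF assms(1,3)] by blast
  show "mu q \<alpha> = ennreal ((2 * pi) powr (1 / 2 - 1 / q) * \<bar>\<alpha>\<bar>)"
    unfolding mu_def
  proof (rule Least_equality)
    show "\<exists>u. competitor u \<and> ennreal ((2 * pi) powr (1 / 2 - 1 / q) * \<bar>\<alpha>\<bar>) = mu_quotient q \<alpha> u"
      using mu_quotient_one[OF assms(1)] by metis
  qed (use mu_quotient_lower_bound[OF assms] in blast)
qed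

end
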